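(* Let $R$ be a commutative ring. Each object $\mathcal C$ of the biset category $\mathbb B=\mathbb B_R$ has a dual in the sense of tensor categories, namely the opposite category $\mathcal C^{\mathrm{op}}$. Thus the tensor category $\mathbb B$ is rigid.
   Context: All categories are finite and $\mathrm{Set}$ is the category of finite sets. A $(\mathcal C,\mathcal D)$-biset is a functor $\Omega:\mathcal C\times\mathcal D^{\mathrm{op}}\to\mathrm{Set}$. The composite of a $(\mathcal C,\mathcal D)$-biset $\Omega$ and a $(\mathcal D,\mathcal E)$-biset $\Psi$ is $(\Omega\circ\Psi)(x,z)=\left(\bigsqcup_{y}\Omega(x,y)\times\Psi(y,z)\right)/\sim$, with $\sim$ generated by $(u\beta,v)\sim(u,\beta v)$ for morphisms $\beta$ of $\mathcal D$. $A_R(\mathcal D,\mathcal C)$ is $R\otimes_{\mathbb Z}$ of the Grothendieck group of finite $(\mathcal D,\mathcal C)$-bisets with respect to disjoint union. $\mathbb B_R$ has finite categories as objects, $\mathrm{Hom}_{\mathbb B_R}(\mathcal C,\mathcal D)=A_R(\mathcal D,\mathcal C)$, and composition the $R$-bilinear extension of $\circ$. It is a symmetric monoidal $R$-linear category (a tensor category), with $\otimes$ given on objects by the product of categories, on morphisms by the $R$-bilinear extension of the product of bisets, and with unit the category $\mathbf 1$ with one object and one morphism. For an object $X$ of a tensor category with unit $\mathbf 1$, a dual of $X$ is an object $X^\vee$ equipped with maps $\alpha:\mathbf 1\to X\otimes X^\vee$ (coevaluation) and $\beta:X^\vee\otimes X\to\mathbf 1$ (evaluation) such that the composites $X\xrightarrow{\alpha\otimes\mathrm{id}}X\otimes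 X^\vee\otimes X\xrightarrow{\mathrm{id}\otimes\beta}X$ and $X^\vee\xrightarrow{\mathrm{id}\otimes\alpha}X^\vee\otimes X\otimes X^\vee\xrightarrow{\beta\otimes\mathrm{id}}X^\vee$ are the identity. A tensor category is rigid if every object has a dual. *)

theory Defs
  imports "HOL-Algebra.Free_Abelian_Groups" "HOL-Algebra.Generated_Groups"
    "HOL-Algebra.Module" "HOL-Library.FSet"
begin

section \<open>Finite categories and finite sets\<close>

text \<open>Hereditarily finite sets over atoms \<open>'u\<close>, with ordered pairs as a primitive. The category of
  finite sets is modelled by the finite subsets of this type: it is closed under products and
  quotients by \<open>Pair\<close> and \<open>Coll\<close>. Since \<open>'u\<close> is arbitrary, any finite
  category whose objects and arrows are drawn from some type \<open>'u\<close> occurs, through \<open>Atom\<close>.\<close>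

datatype 'u elt = Atom 'u | Pair (p1: "'u elt") (p2: "'u elt") | Coll (members: "'u elt fset")

record 'u category =
  cobj :: "'u elt set"
  carr :: "'u elt set"
  cdom :: "'u elt \<Rightarrow> 'u elt"
  ccod :: "'u elt \<Rightarrow> 'u elt"
  cid :: "'u elt \<Rightarrow> 'u elt"
  ccomp :: "'u elt \<Rightarrow> 'u elt \<Rightarrow> 'u elt"  \<comment> \<open>\<open>ccomp C g f\<close> is \<open>g\<close> after \<open>f\<close>\<close>

locale finite_category =
  fixes C :: "'u category"
  assumes finite_objects: "finite (cobj C)"
    and finite_arrows: "finite (carr C)"
    and dom_closed: "f \<in> carr C \<Longrightarrow> cdom C f \<in> cobj C"
    and cod_closed: "f \<in> carr C \<Longrightarrow> ccod C f \<in> cobj C"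
    and id_closed: "x \<in> cobj C \<Longrightarrow> cid C x \<in> carr C"
    and dom_id: "x \<in> cobj C \<Longrightarrow> cdom C (cid C x) = x"
    and cod_id: "x \<in> cobj C \<Longrightarrow> ccod C (cid C x) = x"
    and comp_closed: "\<lbrakk>f \<in> carr C; g \<in> carr C; ccod C f = cdom C g\<rbrakk> \<Longrightarrow> ccomp C g f \<in> carr C"
    and dom_comp: "\<lbrakk>f \<in> carr C; g \<in> carr C; ccod C f = cdom C g\<rbrakk>
      \<Longrightarrow> cdom C (ccomp C g f) = cdom C f"
    and cod_comp: "\<lbrakk>f \<in> carr C; g \<in> carr C; ccod C f = cdom C g\<rbrakk>
      \<Longrightarrow> ccod C (ccomp C g f) = ccod C g"
    and comp_id_right: "f \<in> carr C \<Longrightarrow> ccomp C f (cid C (cdom C f)) = f"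
    and comp_id_left: "f \<in> carr C \<Longrightarrow> ccomp C (cid C (ccod C f)) f = f"
    and comp_assoc: "\<lbrakk>f \<in> carr C; g \<in> carr C; h \<in> carr C; ccod C f = cdom C g; ccod C g = cdom C h\<rbrakk>
      \<Longrightarrow> ccomp C h (ccomp C g f) = ccomp C (ccomp C h g) f"

definition op_cat :: "'u category \<Rightarrow> 'u category" where
  "op_cat C = \<lparr>cobj = cobj C, carr = carr C, cdom = ccod C, ccod = cdom C, cid = cid C,
    ccomp = (\<lambda>g f. ccomp C f g)\<rparr>"

definition elt_times :: "'u elt set \<Rightarrow> 'u elt set \<Rightarrow> 'u elt set" where
  "elt_times A B = {Pair a b |a b. a \<in> A \<and> b \<in> B}"

definition prod_cat :: "'u category \<Rightarrow> 'u category \<Rightarrow> 'u category" where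
  "prod_cat C D = \<lparr>cobj = elt_times (cobj C) (cobj D), carr = elt_times (carr C) (carr D),
    cdom = (\<lambda>f. Pair (cdom C (p1 f)) (cdom D (p2 f))),
    ccod = (\<lambda>f. Pair (ccod C (p1 f)) (ccod D (p2 f))),
    cid = (\<lambda>x. Pair (cid C (p1 x)) (cid D (p2 x))),
    ccomp = (\<lambda>g f. Pair (ccomp C (p1 g) (p1 f)) (ccomp D (p2 g) (p2 f)))\<rparr>"

definition pt :: "'u elt" where
  "pt = Coll {||}"

definition unit_cat :: "'u category" where
  "unit_cat = \<lparr>cobj = {pt}, carr = {pt}, cdom = (\<lambda>_. pt), ccod = (\<lambda>_. pt), cid = (\<lambda>_. pt),
    ccomp = (\<lambda>_ _. pt)\<rparr>"


section \<open>Bisets\<close>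

record 'u setfun =
  fob :: "'u elt \<Rightarrow> 'u elt set"
  farr :: "'u elt \<Rightarrow> 'u elt \<Rightarrow> 'u elt"

definition set_functor :: "'u category \<Rightarrow> 'u setfun \<Rightarrow> bool" where
  "set_functor K F \<longleftrightarrow>
    (\<forall>x \<in> cobj K. finite (fob F x)) \<and>
    (\<forall>f \<in> carr K. farr F f \<in> fob F (cdom K f) \<rightarrow> fob F (ccod K f)) \<and>
    (\<forall>x \<in> cobj K. \<forall>u \<in> fob F x. farr F (cid K x) u = u) \<and>
    (\<forall>f \<in> carr K. \<forall>g \<in> carr K. ccod K f = cdom K g \<longrightarrow>
      (\<forall>u \<in> fob F (cdom K f). farr F (ccomp K g f) u = farr F g (farr F f u)))"

definition functor_iso :: "'u category \<Rightarrow> 'u setfun \<Rightarrow> 'u setfun \<Rightarrow> bool" where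
  "functor_iso K F G \<longleftrightarrow> (\<exists>\<eta>.
    (\<forall>x \<in> cobj K. bij_betw (\<eta> x) (fob F x) (fob G x)) \<and>
    (\<forall>f \<in> carr K. \<forall>u \<in> fob F (cdom K f). \<eta> (ccod K f) (farr F f u) = farr G f (\<eta> (cdom K f) u)))"

abbreviation biset :: "'u category \<Rightarrow> 'u category \<Rightarrow> 'u setfun \<Rightarrow> bool" where
  "biset C D \<equiv> set_functor (prod_cat C (op_cat D))"

abbreviation biset_iso :: "'u category \<Rightarrow> 'u category \<Rightarrow> 'u setfun \<Rightarrow> 'u setfun \<Rightarrow> bool" where
  "biset_iso C D \<equiv> functor_iso (prod_cat C (op_cat D))"

text \<open>The generating relation \<open>(u\<beta>, v) \<sim> (u, \<beta>v)\<close> on \<open>\<Squnion>\<^sub>y \<Omega>(x,y) \<times> \<Psi>(y,z)\<close>, whose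
  elements are written \<open>Pair y (Pair u v)\<close>.\<close>

inductive slide :: "'u category \<Rightarrow> 'u category \<Rightarrow> 'u category \<Rightarrow> 'u setfun \<Rightarrow> 'u setfun \<Rightarrow>
    'u elt \<Rightarrow> 'u elt \<Rightarrow> 'u elt \<Rightarrow> 'u elt \<Rightarrow> bool"
  for C D E \<Omega> \<Psi> x z where
  "\<lbrakk>\<beta> \<in> carr D; u \<in> fob \<Omega> (Pair x (ccod D \<beta>)); v \<in> fob \<Psi> (Pair (cdom D \<beta>) z)\<rbrakk> \<Longrightarrow>
    slide C D E \<Omega> \<Psi> x z
      (Pair (cdom D \<beta>) (Pair (farr \<Omega> (Pair (cid C x) \<beta>) u) v))
      (Pair (ccod D \<beta>) (Pair u (farr \<Psi> (Pair \<beta> (cid E z)) v)))"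

definition slide_equiv :: "'u category \<Rightarrow> 'u category \<Rightarrow> 'u category \<Rightarrow> 'u setfun \<Rightarrow> 'u setfun \<Rightarrow>
    'u elt \<Rightarrow> 'u elt \<Rightarrow> ('u elt \<times> 'u elt) set" where
  "slide_equiv C D E \<Omega> \<Psi> x z = {(s, t). equivclp (slide C D E \<Omega> \<Psi> x z) s t}"

definition total_set :: "'u category \<Rightarrow> 'u setfun \<Rightarrow> 'u setfun \<Rightarrow> 'u elt \<Rightarrow> 'u elt \<Rightarrow> 'u elt set" where
  "total_set D \<Omega> \<Psi> x z = {Pair y (Pair u v) |y u v.
    y \<in> cobj D \<and> u \<in> fob \<Omega> (Pair x y) \<and> v \<in> fob \<Psi> (Pair y z)}"

definition encode :: "'u elt set \<Rightarrow> 'u elt" where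
  "encode A = Coll (Abs_fset A)"

definition decode :: "'u elt \<Rightarrow> 'u elt set" where
  "decode a = fset (members a)"

text \<open>The composite \<open>\<Omega> \<circ> \<Psi>\<close> of a \<open>(C,D)\<close>-biset and a \<open>(D,E)\<close>-biset. An arrow \<open>(f,g)\<close> sends
  the class of \<open>(y,u,v)\<close> to the class of \<open>(y,fu,vg)\<close>; it is computed by saturating the image of
  the class.\<close>

definition biset_comp :: "'u category \<Rightarrow> 'u category \<Rightarrow> 'u category \<Rightarrow> 'u setfun \<Rightarrow> 'u setfun \<Rightarrow>
    'u setfun" where
  "biset_comp C D E \<Omega> \<Psi> = \<lparr>
    fob = (\<lambda>p. encode ` (total_set D \<Omega> \<Psi> (p1 p) (p2 p) // slide_equiv C D E \<Omega> \<Psi> (p1 p) (p2 p))),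
    farr = (\<lambda>a c. encode (slide_equiv C D E \<Omega> \<Psi> (ccod C (p1 a)) (cdom E (p2 a)) ``
      {Pair y (Pair (farr \<Omega> (Pair (p1 a) (cid D y)) u) (farr \<Psi> (Pair (cid D y) (p2 a)) v)) |y u v.
        Pair y (Pair u v) \<in> decode c}))\<rparr>"

definition biset_prod :: "'u setfun \<Rightarrow> 'u setfun \<Rightarrow> 'u setfun" where
  "biset_prod \<Omega> \<Psi> = \<lparr>
    fob = (\<lambda>p. elt_times (fob \<Omega> (Pair (p1 (p1 p)) (p1 (p2 p)))) (fob \<Psi> (Pair (p2 (p1 p)) (p2 (p2 p))))),
    farr = (\<lambda>a w. Pair (farr \<Omega> (Pair (p1 (p1 a)) (p1 (p2 a))) (p1 w))
      (farr \<Psi> (Pair (p2 (p1 a)) (p2 (p2 a))) (p2 w)))\<rparr>"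

definition biset_sum :: "'u setfun \<Rightarrow> 'u setfun \<Rightarrow> 'u setfun" where
  "biset_sum \<Omega> \<Psi> = \<lparr>
    fob = (\<lambda>p. Pair pt ` fob \<Omega> p \<union> Pair (Coll {|pt|}) ` fob \<Psi> p),
    farr = (\<lambda>a w. Pair (p1 w) (if p1 w = pt then farr \<Omega> a (p2 w) else farr \<Psi> a (p2 w)))\<rparr>"

text \<open>The \<open>(D,C)\<close>-biset \<open>(y,x) \<mapsto> D(Fx,y)\<close> of a functor \<open>F : C \<rightarrow> D\<close> with object map \<open>Fo\<close> and
  arrow map \<open>Fa\<close>.\<close>

definition functor_biset :: "'u category \<Rightarrow> ('u elt \<Rightarrow> 'u elt) \<Rightarrow> ('u elt \<Rightarrow> 'u elt) \<Rightarrow> 'u setfun" where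
  "functor_biset D Fo Fa = \<lparr>
    fob = (\<lambda>p. {h \<in> carr D. cdom D h = Fo (p2 p) \<and> ccod D h = p1 p}),
    farr = (\<lambda>a h. ccomp D (p1 a) (ccomp D h (Fa (p2 a))))\<rparr>"


section \<open>The modules of morphisms\<close>

definition iso_class :: "'u category \<Rightarrow> 'u category \<Rightarrow> 'u setfun \<Rightarrow> 'u setfun set" where
  "iso_class C D \<Omega> = {\<Psi>. biset C D \<Psi> \<and> biset_iso C D \<Omega> \<Psi>}"

definition grothendieck_rels :: "'u category \<Rightarrow> 'u category \<Rightarrow> ('u setfun set \<Rightarrow>\<^sub>0 int) set" where
  "grothendieck_rels C D =
    {frag_of (iso_class C D (biset_sum \<Omega> \<Psi>)) - frag_of (iso_class C D \<Omega>) - frag_of (iso_class C D \<Psi>)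
      |\<Omega> \<Psi>. biset C D \<Omega> \<and> biset C D \<Psi>}"

definition biset_free :: "'u category \<Rightarrow> 'u category \<Rightarrow> ('u setfun set \<Rightarrow>\<^sub>0 int) monoid" where
  "biset_free C D = free_Abelian_group (iso_class C D ` Collect (biset C D))"

text \<open>The group operation of the Grothendieck group is the multiplication of the record.\<close>

definition grothendieck_group :: "'u category \<Rightarrow> 'u category \<Rightarrow> ('u setfun set \<Rightarrow>\<^sub>0 int) set monoid" where
  "grothendieck_group C D = biset_free C D Mod generate (biset_free C D) (grothendieck_rels C D)"

definition grothendieck_class :: "'u category \<Rightarrow> 'u category \<Rightarrow> 'u setfun \<Rightarrow>
    ('u setfun set \<Rightarrow>\<^sub>0 int) set" where
  "grothendieck_class C D \<Omega> = generate (biset_free C D) (grothendieck_rels C D)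
    #>\<^bsub>biset_free C D\<^esub> frag_of (iso_class C D \<Omega>)"

text \<open>The \<open>R\<close>-module \<open>R \<otimes>\<^sub>\<int> G\<close> of an abelian group \<open>G\<close> written multiplicatively: the free abelian
  group on the pairs \<open>(r,g)\<close> modulo biadditivity.\<close>

definition tensor_free :: "('r, 'k) ring_scheme \<Rightarrow> ('g, 'l) monoid_scheme \<Rightarrow> ('r \<times> 'g \<Rightarrow>\<^sub>0 int) monoid" where
  "tensor_free R G = free_Abelian_group (carrier R \<times> carrier G)"

definition tensor_rels :: "('r, 'k) ring_scheme \<Rightarrow> ('g, 'l) monoid_scheme \<Rightarrow> ('r \<times> 'g \<Rightarrow>\<^sub>0 int) set" where
  "tensor_rels R G =
    {frag_of (r \<oplus>\<^bsub>R\<^esub> s, g) - frag_of (r, g) - frag_of (s, g) |r s g.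
      r \<in> carrier R \<and> s \<in> carrier R \<and> g \<in> carrier G} \<union>
    {frag_of (r, g \<otimes>\<^bsub>G\<^esub> h) - frag_of (r, g) - frag_of (r, h) |r g h.
      r \<in> carrier R \<and> g \<in> carrier G \<and> h \<in> carrier G}"

definition tensor_subgroup :: "('r, 'k) ring_scheme \<Rightarrow> ('g, 'l) monoid_scheme \<Rightarrow> ('r \<times> 'g \<Rightarrow>\<^sub>0 int) set" where
  "tensor_subgroup R G = generate (tensor_free R G) (tensor_rels R G)"

definition pure_tensor :: "('r, 'k) ring_scheme \<Rightarrow> ('g, 'l) monoid_scheme \<Rightarrow> 'r \<Rightarrow> 'g \<Rightarrow>
    ('r \<times> 'g \<Rightarrow>\<^sub>0 int) set" where
  "pure_tensor R G r g = tensor_subgroup R G #>\<^bsub>tensor_free R G\<^esub> frag_of (r, g)"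

text \<open>Only the module part of the record is meaningful; \<open>mult\<close> and \<open>one\<close> are inherited from the
  record type \<open>ring\<close> and are not used by \<open>module\<close>.\<close>

definition scalar_extension :: "('r, 'k) ring_scheme \<Rightarrow> ('g, 'l) monoid_scheme \<Rightarrow>
    ('r, ('r \<times> 'g \<Rightarrow>\<^sub>0 int) set) module" where
  "scalar_extension R G =
    (let Q = tensor_free R G Mod tensor_subgroup R G in
     \<lparr>carrier = carrier Q, monoid.mult = undefined, one = undefined,
      zero = \<one>\<^bsub>Q\<^esub>, add = monoid.mult Q,
      smult = (\<lambda>t c. \<Union>w\<in>c. tensor_subgroup R G #>\<^bsub>tensor_free R G\<^esub>
        frag_extend (\<lambda>(r, g). frag_of (t \<otimes>\<^bsub>R\<^esub> r, g)) w)\<rparr>)"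

type_synonym ('u, 'r) biset_mor = "('r \<times> ('u setfun set \<Rightarrow>\<^sub>0 int) set \<Rightarrow>\<^sub>0 int) set"

definition biset_module :: "('r, 'k) ring_scheme \<Rightarrow> 'u category \<Rightarrow> 'u category \<Rightarrow>
    ('r, ('u, 'r) biset_mor) module" where
  "biset_module R C D = scalar_extension R (grothendieck_group C D)"

definition biset_class :: "('r, 'k) ring_scheme \<Rightarrow> 'u category \<Rightarrow> 'u category \<Rightarrow> 'u setfun \<Rightarrow>
    ('u, 'r) biset_mor" where
  "biset_class R C D \<Omega> = pure_tensor R (grothendieck_group C D) \<one>\<^bsub>R\<^esub> (grothendieck_class C D \<Omega>)"

definition bilinear_map :: "('r, 'k) ring_scheme \<Rightarrow> ('r, 'a) module \<Rightarrow> ('r, 'b) module \<Rightarrow>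
    ('r, 'c) module \<Rightarrow> ('a \<Rightarrow> 'b \<Rightarrow> 'c) \<Rightarrow> bool" where
  "bilinear_map R M N P m \<longleftrightarrow>
    (\<forall>x \<in> carrier M. \<forall>y \<in> carrier N. m x y \<in> carrier P) \<and>
    (\<forall>x \<in> carrier M. \<forall>x' \<in> carrier M. \<forall>y \<in> carrier N. m (x \<oplus>\<^bsub>M\<^esub> x') y = m x y \<oplus>\<^bsub>P\<^esub> m x' y) \<and>
    (\<forall>x \<in> carrier M. \<forall>y \<in> carrier N. \<forall>y' \<in> carrier N. m x (y \<oplus>\<^bsub>N\<^esub> y') = m x y \<oplus>\<^bsub>P\<^esub> m x y') \<and>
    (\<forall>r \<in> carrier R. \<forall>x \<in> carrier M. \<forall>y \<in> carrier N.
      m (r \<odot>\<^bsub>M\<^esub> x) y = r \<odot>\<^bsub>P\<^esub> m x y \<and> m x (r \<odot>\<^bsub>N\<^esub> y) = r \<odot>\<^bsub>P\<^esub> m x y)"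

text \<open>The \<open>R\<close>-bilinear extensions of composition and product of bisets. On the carriers such an
  extension is unique, because the classes of bisets generate the modules.\<close>

definition biset_mor_comp :: "('r, 'k) ring_scheme \<Rightarrow> 'u category \<Rightarrow> 'u category \<Rightarrow> 'u category \<Rightarrow>
    ('u, 'r) biset_mor \<Rightarrow> ('u, 'r) biset_mor \<Rightarrow> ('u, 'r) biset_mor" where
  "biset_mor_comp R C D E = (SOME m.
    bilinear_map R (biset_module R C D) (biset_module R D E) (biset_module R C E) m \<and>
    (\<forall>\<Omega> \<Psi>. biset C D \<Omega> \<longrightarrow> biset D E \<Psi> \<longrightarrow>
      m (biset_class R C D \<Omega>) (biset_class R D E \<Psi>) = biset_class R C E (biset_comp C D E \<Omega> \<Psi>)))"

definition biset_mor_prod :: "('r, 'k) ring_scheme \<Rightarrow> 'u category \<Rightarrow> 'u category \<Rightarrow> 'u category \<Rightarrow>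
    'u category \<Rightarrow> ('u, 'r) biset_mor \<Rightarrow> ('u, 'r) biset_mor \<Rightarrow> ('u, 'r) biset_mor" where
  "biset_mor_prod R C D C' D' = (SOME m.
    bilinear_map R (biset_module R C D) (biset_module R C' D')
      (biset_module R (prod_cat C C') (prod_cat D D')) m \<and>
    (\<forall>\<Omega> \<Psi>. biset C D \<Omega> \<longrightarrow> biset C' D' \<Psi> \<longrightarrow>
      m (biset_class R C D \<Omega>) (biset_class R C' D' \<Psi>) =
        biset_class R (prod_cat C C') (prod_cat D D') (biset_prod \<Omega> \<Psi>)))"


section \<open>Tensor categories\<close>

record ('o, 'r, 'm) tensor_data =
  Ob :: "'o set"
  Hom :: "'o \<Rightarrow> 'o \<Rightarrow> ('r, 'm) module"
  Cmp :: "'o \<Rightarrow> 'o \<Rightarrow> 'o \<Rightarrow> 'm \<Rightarrow> 'm \<Rightarrow> 'm"  \<comment> \<open>\<open>Cmp T X Y Z g f\<close>: \<open>g : Y \<rightarrow> Z\<close> after \<open>f : X \<rightarrow> Y\<close>\<close>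
  Idn :: "'o \<Rightarrow> 'm"
  Ten :: "'o \<Rightarrow> 'o \<Rightarrow> 'o"
  TenMor :: "'o \<Rightarrow> 'o \<Rightarrow> 'o \<Rightarrow> 'o \<Rightarrow> 'm \<Rightarrow> 'm \<Rightarrow> 'm"
    \<comment> \<open>\<open>TenMor T X Y X' Y' f f'\<close>: tensor product of \<open>f : X \<rightarrow> Y\<close> and \<open>f' : X' \<rightarrow> Y'\<close>\<close>
  Unt :: 'o
  Assoc :: "'o \<Rightarrow> 'o \<Rightarrow> 'o \<Rightarrow> 'm"  \<comment> \<open>\<open>(X \<otimes> Y) \<otimes> Z \<rightarrow> X \<otimes> (Y \<otimes> Z)\<close>\<close>
  LUnit :: "'o \<Rightarrow> 'm"  \<comment> \<open>\<open>1 \<otimes> X \<rightarrow> X\<close>\<close>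
  RUnit :: "'o \<Rightarrow> 'm"  \<comment> \<open>\<open>X \<otimes> 1 \<rightarrow> X\<close>\<close>
  Braid :: "'o \<Rightarrow> 'o \<Rightarrow> 'm"  \<comment> \<open>\<open>X \<otimes> Y \<rightarrow> Y \<otimes> X\<close>\<close>

abbreviation Mor :: "('o, 'r, 'm) tensor_data \<Rightarrow> 'o \<Rightarrow> 'o \<Rightarrow> 'm set" where
  "Mor T X Y \<equiv> carrier (Hom T X Y)"

definition is_inverse :: "('o, 'r, 'm) tensor_data \<Rightarrow> 'o \<Rightarrow> 'o \<Rightarrow> 'm \<Rightarrow> 'm \<Rightarrow> bool" where
  "is_inverse T X Y f g \<longleftrightarrow> f \<in> Mor T X Y \<and> g \<in> Mor T Y X \<and>
    Cmp T X Y X g f = Idn T X \<and> Cmp T Y X Y f g = Idn T Y"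

definition iso_mor :: "('o, 'r, 'm) tensor_data \<Rightarrow> 'o \<Rightarrow> 'o \<Rightarrow> 'm \<Rightarrow> bool" where
  "iso_mor T X Y f \<longleftrightarrow> (\<exists>g. is_inverse T X Y f g)"

definition inv_mor :: "('o, 'r, 'm) tensor_data \<Rightarrow> 'o \<Rightarrow> 'o \<Rightarrow> 'm \<Rightarrow> 'm" where
  "inv_mor T X Y f = (THE g. is_inverse T X Y f g)"

text \<open>Symmetric monoidal \<open>R\<close>-linear categories.\<close>

locale tensor_category =
  fixes R :: "('r, 'k) ring_scheme" and T :: "('o, 'r, 'm) tensor_data"
  assumes hom_module: "\<lbrakk>X \<in> Ob T; Y \<in> Ob T\<rbrakk> \<Longrightarrow> module R (Hom T X Y)"
    and cmp_bilinear: "\<lbrakk>X \<in> Ob T; Y \<in> Ob T; Z \<in> Ob T\<rbrakk>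
      \<Longrightarrow> bilinear_map R (Hom T Y Z) (Hom T X Y) (Hom T X Z) (Cmp T X Y Z)"
    and idn_closed: "X \<in> Ob T \<Longrightarrow> Idn T X \<in> Mor T X X"
    and cmp_idn_right: "\<lbrakk>X \<in> Ob T; Y \<in> Ob T; f \<in> Mor T X Y\<rbrakk> \<Longrightarrow> Cmp T X X Y f (Idn T X) = f"
    and cmp_idn_left: "\<lbrakk>X \<in> Ob T; Y \<in> Ob T; f \<in> Mor T X Y\<rbrakk> \<Longrightarrow> Cmp T X Y Y (Idn T Y) f = f"
    and cmp_assoc: "\<lbrakk>W \<in> Ob T; X \<in> Ob T; Y \<in> Ob T; Z \<in> Ob T;
        f \<in> Mor T W X; g \<in> Mor T X Y; h \<in> Mor T Y Z\<rbrakk>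
      \<Longrightarrow> Cmp T W Y Z h (Cmp T W X Y g f) = Cmp T W X Z (Cmp T X Y Z h g) f"
    and unt_closed: "Unt T \<in> Ob T"
    and ten_closed: "\<lbrakk>X \<in> Ob T; Y \<in> Ob T\<rbrakk> \<Longrightarrow> Ten T X Y \<in> Ob T"
    and ten_bilinear: "\<lbrakk>X \<in> Ob T; Y \<in> Ob T; X' \<in> Ob T; Y' \<in> Ob T\<rbrakk>
      \<Longrightarrow> bilinear_map R (Hom T X Y) (Hom T X' Y') (Hom T (Ten T X X') (Ten T Y Y')) (TenMor T X Y X' Y')"
    and ten_idn: "\<lbrakk>X \<in> Ob T; Y \<in> Ob T\<rbrakk> \<Longrightarrow> TenMor T X X Y Y (Idn T X) (Idn T Y) = Idn T (Ten T X Y)"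
    and ten_cmp: "\<lbrakk>X \<in> Ob T; Y \<in> Ob T; Z \<in> Ob T; X' \<in> Ob T; Y' \<in> Ob T; Z' \<in> Ob T;
        f \<in> Mor T X Y; g \<in> Mor T Y Z; f' \<in> Mor T X' Y'; g' \<in> Mor T Y' Z'\<rbrakk>
      \<Longrightarrow> TenMor T X Z X' Z' (Cmp T X Y Z g f) (Cmp T X' Y' Z' g' f') =
        Cmp T (Ten T X X') (Ten T Y Y') (Ten T Z Z') (TenMor T Y Z Y' Z' g g') (TenMor T X Y X' Y' f f')"
    and assoc_iso: "\<lbrakk>X \<in> Ob T; Y \<in> Ob T; Z \<in> Ob T\<rbrakk>
      \<Longrightarrow> iso_mor T (Ten T (Ten T X Y) Z) (Ten T X (Ten T Y Z)) (Assoc T X Y Z)"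
    and assoc_natural: "\<lbrakk>X \<in> Ob T; Y \<in> Ob T; Z \<in> Ob T; X' \<in> Ob T; Y' \<in> Ob T; Z' \<in> Ob T;
        f \<in> Mor T X X'; g \<in> Mor T Y Y'; h \<in> Mor T Z Z'\<rbrakk>
      \<Longrightarrow> Cmp T (Ten T (Ten T X Y) Z) (Ten T (Ten T X' Y') Z') (Ten T X' (Ten T Y' Z'))
          (Assoc T X' Y' Z') (TenMor T (Ten T X Y) (Ten T X' Y') Z Z' (TenMor T X X' Y Y' f g) h) =
        Cmp T (Ten T (Ten T X Y) Z) (Ten T X (Ten T Y Z)) (Ten T X' (Ten T Y' Z'))
          (TenMor T X X' (Ten T Y Z) (Ten T Y' Z') f (TenMor T Y Y' Z Z' g h)) (Assoc T X Y Z)"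
    and lunit_iso: "X \<in> Ob T \<Longrightarrow> iso_mor T (Ten T (Unt T) X) X (LUnit T X)"
    and lunit_natural: "\<lbrakk>X \<in> Ob T; Y \<in> Ob T; f \<in> Mor T X Y\<rbrakk>
      \<Longrightarrow> Cmp T (Ten T (Unt T) X) (Ten T (Unt T) Y) Y
          (LUnit T Y) (TenMor T (Unt T) (Unt T) X Y (Idn T (Unt T)) f) =
        Cmp T (Ten T (Unt T) X) X Y f (LUnit T X)"
    and runit_iso: "X \<in> Ob T \<Longrightarrow> iso_mor T (Ten T X (Unt T)) X (RUnit T X)"
    and runit_natural: "\<lbrakk>X \<in> Ob T; Y \<in> Ob T; f \<in> Mor T X Y\<rbrakk>
      \<Longrightarrow> Cmp T (Ten T X (Unt T)) (Ten T Y (Unt T)) Y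
          (RUnit T Y) (TenMor T X Y (Unt T) (Unt T) f (Idn T (Unt T))) =
        Cmp T (Ten T X (Unt T)) X Y f (RUnit T X)"
    and braid_closed: "\<lbrakk>X \<in> Ob T; Y \<in> Ob T\<rbrakk> \<Longrightarrow> Braid T X Y \<in> Mor T (Ten T X Y) (Ten T Y X)"
    and braid_natural: "\<lbrakk>X \<in> Ob T; Y \<in> Ob T; X' \<in> Ob T; Y' \<in> Ob T; f \<in> Mor T X X'; g \<in> Mor T Y Y'\<rbrakk>
      \<Longrightarrow> Cmp T (Ten T X Y) (Ten T X' Y') (Ten T Y' X') (Braid T X' Y') (TenMor T X X' Y Y' f g) =
        Cmp T (Ten T X Y) (Ten T Y X) (Ten T Y' X') (TenMor T Y Y' X X' g f) (Braid T X Y)"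
    and braid_symmetric: "\<lbrakk>X \<in> Ob T; Y \<in> Ob T\<rbrakk>
      \<Longrightarrow> Cmp T (Ten T X Y) (Ten T Y X) (Ten T X Y) (Braid T Y X) (Braid T X Y) = Idn T (Ten T X Y)"
    and pentagon: "\<lbrakk>W \<in> Ob T; X \<in> Ob T; Y \<in> Ob T; Z \<in> Ob T\<rbrakk>
      \<Longrightarrow> Cmp T (Ten T (Ten T (Ten T W X) Y) Z) (Ten T (Ten T W X) (Ten T Y Z))
          (Ten T W (Ten T X (Ten T Y Z)))
          (Assoc T W X (Ten T Y Z)) (Assoc T (Ten T W X) Y Z) =
        Cmp T (Ten T (Ten T (Ten T W X) Y) Z) (Ten T W (Ten T (Ten T X Y) Z))
          (Ten T W (Ten T X (Ten T Y Z)))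
          (TenMor T W W (Ten T (Ten T X Y) Z) (Ten T X (Ten T Y Z)) (Idn T W) (Assoc T X Y Z))
          (Cmp T (Ten T (Ten T (Ten T W X) Y) Z) (Ten T (Ten T W (Ten T X Y)) Z)
            (Ten T W (Ten T (Ten T X Y) Z))
            (Assoc T W (Ten T X Y) Z)
            (TenMor T (Ten T (Ten T W X) Y) (Ten T W (Ten T X Y)) Z Z (Assoc T W X Y) (Idn T Z)))"
    and triangle: "\<lbrakk>X \<in> Ob T; Y \<in> Ob T\<rbrakk>
      \<Longrightarrow> Cmp T (Ten T (Ten T X (Unt T)) Y) (Ten T X (Ten T (Unt T) Y)) (Ten T X Y)
          (TenMor T X X (Ten T (Unt T) Y) Y (Idn T X) (LUnit T Y)) (Assoc T X (Unt T) Y) =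
        TenMor T (Ten T X (Unt T)) X Y Y (RUnit T X) (Idn T Y)"
    and hexagon: "\<lbrakk>X \<in> Ob T; Y \<in> Ob T; Z \<in> Ob T\<rbrakk>
      \<Longrightarrow> Cmp T (Ten T (Ten T X Y) Z) (Ten T (Ten T Y Z) X) (Ten T Y (Ten T Z X))
          (Assoc T Y Z X)
          (Cmp T (Ten T (Ten T X Y) Z) (Ten T X (Ten T Y Z)) (Ten T (Ten T Y Z) X)
            (Braid T X (Ten T Y Z)) (Assoc T X Y Z)) =
        Cmp T (Ten T (Ten T X Y) Z) (Ten T Y (Ten T X Z)) (Ten T Y (Ten T Z X))
          (TenMor T Y Y (Ten T X Z) (Ten T Z X) (Idn T Y) (Braid T X Z))
          (Cmp T (Ten T (Ten T X Y) Z) (Ten T (Ten T Y X) Z) (Ten T Y (Ten T X Z))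
            (Assoc T Y X Z)
            (TenMor T (Ten T X Y) (Ten T Y X) Z Z (Braid T X Y) (Idn T Z)))"

text \<open>The composites \<open>X \<rightarrow> X \<otimes> X' \<otimes> X \<rightarrow> X\<close> and \<open>X' \<rightarrow> X' \<otimes> X \<otimes> X' \<rightarrow> X'\<close> of a coevaluation
  \<open>\<alpha> : 1 \<rightarrow> X \<otimes> X'\<close> and an evaluation \<open>\<beta> : X' \<otimes> X \<rightarrow> 1\<close>, with unit and associativity isomorphisms
  inserted.\<close>

definition zigzag :: "('o, 'r, 'm) tensor_data \<Rightarrow> 'o \<Rightarrow> 'o \<Rightarrow> 'm \<Rightarrow> 'm \<Rightarrow> 'm" where
  "zigzag T X X' \<alpha> \<beta> = (let I = Unt T in
    Cmp T X (Ten T X I) X (RUnit T X)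
      (Cmp T X (Ten T X (Ten T X' X)) (Ten T X I) (TenMor T X X (Ten T X' X) I (Idn T X) \<beta>)
        (Cmp T X (Ten T (Ten T X X') X) (Ten T X (Ten T X' X)) (Assoc T X X' X)
          (Cmp T X (Ten T I X) (Ten T (Ten T X X') X) (TenMor T I (Ten T X X') X X \<alpha> (Idn T X))
            (inv_mor T (Ten T I X) X (LUnit T X))))))"

definition zagzig :: "('o, 'r, 'm) tensor_data \<Rightarrow> 'o \<Rightarrow> 'o \<Rightarrow> 'm \<Rightarrow> 'm \<Rightarrow> 'm" where
  "zagzig T X X' \<alpha> \<beta> = (let I = Unt T in
    Cmp T X' (Ten T I X') X' (LUnit T X')
      (Cmp T X' (Ten T (Ten T X' X) X') (Ten T I X') (TenMor T (Ten T X' X) I X' X' \<beta> (Idn T X'))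
        (Cmp T X' (Ten T X' (Ten T X X')) (Ten T (Ten T X' X) X')
          (inv_mor T (Ten T (Ten T X' X) X') (Ten T X' (Ten T X X')) (Assoc T X' X X'))
          (Cmp T X' (Ten T X' I) (Ten T X' (Ten T X X')) (TenMor T X' X' I (Ten T X X') (Idn T X') \<alpha>)
            (inv_mor T (Ten T X' I) X' (RUnit T X'))))))"

definition is_dual :: "('o, 'r, 'm) tensor_data \<Rightarrow> 'o \<Rightarrow> 'o \<Rightarrow> bool" where
  "is_dual T X X' \<longleftrightarrow> X' \<in> Ob T \<and>
    (\<exists>\<alpha> \<in> Mor T (Unt T) (Ten T X X'). \<exists>\<beta> \<in> Mor T (Ten T X' X) (Unt T).
      zigzag T X X' \<alpha> \<beta> = Idn T X \<and> zagzig T X X' \<alpha> \<beta> = Idn T X')"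

locale rigid_tensor_category = tensor_category R T
  for R :: "('r, 'k) ring_scheme" and T :: "('o, 'r, 'm) tensor_data" +
  assumes has_dual: "X \<in> Ob T \<Longrightarrow> \<exists>X'. is_dual T X X'"


section \<open>The biset category\<close>

text \<open>A morphism \<open>C \<rightarrow> D\<close> is an element of the module of \<open>(D,C)\<close>-bisets, so \<open>g\<close> after \<open>f\<close> is the
  product \<open>g \<circ> f\<close> of bisets in the same order. The identity of \<open>C\<close> is \<open>(x,y) \<mapsto> C(y,x)\<close>, and the
  structural isomorphisms are the bisets of the evident functors between products of categories.\<close>

definition biset_category :: "('r, 'k) ring_scheme \<Rightarrow> ('u category, 'r, ('u, 'r) biset_mor) tensor_data" where
  "biset_category R = \<lparr>
    Ob = Collect finite_category,
    Hom = (\<lambda>C D. biset_module R D C),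
    Cmp = (\<lambda>C D E. biset_mor_comp R E D C),
    Idn = (\<lambda>C. biset_class R C C (functor_biset C (\<lambda>x. x) (\<lambda>f. f))),
    Ten = prod_cat,
    TenMor = (\<lambda>C D C' D'. biset_mor_prod R D C D' C'),
    Unt = unit_cat,
    Assoc = (\<lambda>C D E. let K = prod_cat C (prod_cat D E); a = (\<lambda>p. Pair (p1 (p1 p)) (Pair (p2 (p1 p)) (p2 p)))
      in biset_class R K (prod_cat (prod_cat C D) E) (functor_biset K a a)),
    LUnit = (\<lambda>C. biset_class R C (prod_cat unit_cat C) (functor_biset C p2 p2)),
    RUnit = (\<lambda>C. biset_class R C (prod_cat C unit_cat) (functor_biset C p1 p1)),
    Braid = (\<lambda>C D. let K = prod_cat D C; s = (\<lambda>p. Pair (p2 p) (p1 p))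
      in biset_class R K (prod_cat C D) (functor_biset K s s))\<rparr>"

end

theory Submission
  imports Defs
begin

text \<open>All structure morphisms of the biset category are classes of bisets, and hom modules only see bisets up
  to isomorphism. Every axiom of a tensor category is an equation between multilinear maps, so it suffices to
  check it on classes of bisets, where it becomes the existence of an isomorphism of bisets; no coherence
  between these isomorphisms is needed. The structure morphisms come from functors, and by the Yoneda lemma
  composing with the biset of a functor amounts to reindexing. Evaluation and coevaluation are both given by
  the hom biset of \<open>C\<close>: a triangle composite reduces to the quotient of chains of four composable arrows
  by sliding, and such a chain is equivalent to the one in which the total composite is followed by identities.\<close>

section \<open>Presented abelian groups\<close>

text \<open>Composition and tensor product of morphisms are picked by \<open>SOME\<close> among
  bilinear extensions, so nothing is known about them until such an extension exists. Hence the
  effort spent on a universal property of the hom modules: it asks that composition and product of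
  bisets respect isomorphisms and disjoint unions in each variable.

  Absorbing a functor is unproblematic when its biset stands on the right. On the left the composite
  is a Kan extension; it is a reindexing here because every structure functor met on that side is an
  isomorphism of categories, and the reindexing is then along its inverse.

  The opposite category is the dual because a contravariant variable of \<open>C\<close> on one side
  of a biset is a covariant variable of \<open>op_cat C\<close> on the same side: the hom functor
  can be read with both variables on the left or with both on the right. In a triangle composite the
  middle variable is shared by evaluation and coevaluation, and sliding along it is what carries an
  arrow from one to the other.\<close>

abbreviation presented_group :: "'a set \<Rightarrow> ('a \<Rightarrow>\<^sub>0 int) set \<Rightarrow> ('a \<Rightarrow>\<^sub>0 int) set monoid" where
  "presented_group S N \<equiv> free_Abelian_group S Mod generate (free_Abelian_group S) N"

abbreviation presented_gen :: "'a set \<Rightarrow> ('a \<Rightarrow>\<^sub>0 int) set \<Rightarrow> ('a \<Rightarrow>\<^sub>0 int) \<Rightarrow> ('a \<Rightarrow>\<^sub>0 int) set" where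
  "presented_gen S N w \<equiv> generate (free_Abelian_group S) N #>\<^bsub>free_Abelian_group S\<^esub> w"

text \<open>Relations of the shape a = b + c between generators. Disjoint unions in the Grothendieck
  group and biadditivity in a tensor product both have it, so one treatment serves both
  quotients.\<close>

definition additive_rels :: "'a set \<Rightarrow> ('a \<Rightarrow>\<^sub>0 int) set \<Rightarrow> bool" where
  "additive_rels S N \<longleftrightarrow> (\<forall>w\<in>N. \<exists>a\<in>S. \<exists>b\<in>S. \<exists>c\<in>S. w = frag_of a - frag_of b - frag_of c)"

lemma additive_rels_subset:
  assumes "additive_rels S N"
  shows "N \<subseteq> carrier (free_Abelian_group S)"
proof
  fix w assume "w \<in> N"
  then obtain a b c where "a \<in> S" "b \<in> S" "c \<in> S" "w = frag_of a - frag_of b - frag_of c"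
    using assms unfolding additive_rels_def by blast
  then show "w \<in> carrier (free_Abelian_group S)"
    using keys_diff[of "frag_of a - frag_of b" "frag_of c"] keys_diff[of "frag_of a" "frag_of b"]
    by (auto simp: keys_frag_of)
qed

lemma subgroup_rels:
  assumes "additive_rels S N"
  shows "subgroup (generate (free_Abelian_group S) N) (free_Abelian_group S)"
  using group.generate_is_subgroup[OF group_free_Abelian_group additive_rels_subset[OF assms]] .

lemma normal_rels:
  assumes "additive_rels S N"
  shows "generate (free_Abelian_group S) N \<lhd> free_Abelian_group S"
  using comm_group.normal_iff_subgroup[OF abelian_free_Abelian_group] subgroup_rels[OF assms] by blast

lemma presented_comm_group:
  assumes "additive_rels S N"
  shows "comm_group (presented_group S N)"
  using comm_group.abelian_FactGroup[OF abelian_free_Abelian_group subgroup_rels[OF assms]] .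

lemma presented_gen_closed:
  "w \<in> carrier (free_Abelian_group S) \<Longrightarrow> presented_gen S N w \<in> carrier (presented_group S N)"
  by (auto simp: carrier_FactGroup)

lemma presented_gen_hom:
  assumes "additive_rels S N"
  shows "presented_gen S N \<in> hom (free_Abelian_group S) (presented_group S N)"
  using normal.r_coset_hom_Mod[OF normal_rels[OF assms]] .

lemma presented_gen_group_hom:
  assumes "additive_rels S N"
  shows "group_hom (free_Abelian_group S) (presented_group S N) (presented_gen S N)"
  using presented_gen_hom[OF assms] presented_comm_group[OF assms]
  by (simp add: group_hom_def group_hom_axioms_def comm_group_def)

lemma presented_gen_add:
  assumes "additive_rels S N" "x \<in> carrier (free_Abelian_group S)" "y \<in> carrier (free_Abelian_group S)"
  shows "presented_gen S N (x + y) = presented_gen S N x \<otimes>\<^bsub>presented_group S N\<^esub> presented_gen S N y"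
  using hom_mult[OF presented_gen_hom[OF assms(1)] assms(2,3)] by (simp del: mult_FactGroup)

lemma presented_gen_eq:
  assumes "additive_rels S N" "frag_of a - frag_of b - frag_of c \<in> N" "a \<in> S" "b \<in> S" "c \<in> S"
  shows "presented_gen S N (frag_of a) =
    presented_gen S N (frag_of b) \<otimes>\<^bsub>presented_group S N\<^esub> presented_gen S N (frag_of c)"
proof -
  interpret H: group_hom "free_Abelian_group S" "presented_group S N" "presented_gen S N"
    by (rule presented_gen_group_hom[OF assms(1)])
  let ?w = "frag_of a - frag_of b - frag_of c"
  have w: "?w \<in> carrier (free_Abelian_group S)"
    using additive_rels_subset[OF assms(1)] assms(2) by blast
  have "?w \<in> generate (free_Abelian_group S) N"
    using assms(2) by (rule generate.incl)
  then have "presented_gen S N ?w = \<one>\<^bsub>presented_group S N\<^esub>"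
    using group.coset_join2[OF group_free_Abelian_group w subgroup_rels[OF assms(1)]]
    by (simp del: mult_FactGroup)
  moreover have "frag_of b + frag_of c \<in> carrier (free_Abelian_group S)"
    using assms keys_add[of "frag_of b" "frag_of c"] by (auto simp: keys_frag_of)
  \<comment> \<open>The relator is added back: its class is the unit, so \<open>a\<close> and
    \<open>b + c\<close> have the same class.\<close>
  moreover have "frag_of a = ?w + (frag_of b + frag_of c)" by simp
  ultimately have "presented_gen S N (frag_of a) = presented_gen S N (frag_of b + frag_of c)"
    using presented_gen_add[OF assms(1) w] H.hom_closed H.H.l_one by metis
  also have "\<dots> = presented_gen S N (frag_of b) \<otimes>\<^bsub>presented_group S N\<^esub> presented_gen S N (frag_of c)"
    using presented_gen_add[OF assms(1)] assms(4,5) by (simp add: keys_frag_of del: mult_FactGroup)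
  finally show ?thesis .
qed

text \<open>The induction on the free group runs over differences. These are split into product and
  inverse, since later an inverse is handled as a multiple by the scalar -1.\<close>

lemma presented_induct [consumes 2, case_names one mult inv gen]:
  assumes "additive_rels S N" "x \<in> carrier (presented_group S N)"
    and one: "P \<one>\<^bsub>presented_group S N\<^esub>"
    and mult: "\<And>x y. \<lbrakk>x \<in> carrier (presented_group S N); y \<in> carrier (presented_group S N); P x; P y\<rbrakk>
      \<Longrightarrow> P (x \<otimes>\<^bsub>presented_group S N\<^esub> y)"
    and inv: "\<And>x. \<lbrakk>x \<in> carrier (presented_group S N); P x\<rbrakk> \<Longrightarrow> P (inv\<^bsub>presented_group S N\<^esub> x)"
    and gen: "\<And>a. a \<in> S \<Longrightarrow> P (presented_gen S N (frag_of a))"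
  shows "P x"
proof -
  interpret H: group_hom "free_Abelian_group S" "presented_group S N" "presented_gen S N"
    by (rule presented_gen_group_hom[OF assms(1)])
  obtain w where w: "Poly_Mapping.keys w \<subseteq> S" "x = presented_gen S N w"
    using assms(2) by (auto simp: carrier_FactGroup)
  have "P (presented_gen S N w)"
  proof (rule free_Abelian_group_induct[OF w(1)])
    show "P (presented_gen S N 0)" using one H.hom_one by simp
  next
    fix x y assume xy: "Poly_Mapping.keys x \<subseteq> S" "Poly_Mapping.keys y \<subseteq> S"
      "P (presented_gen S N x)" "P (presented_gen S N y)"
    have "presented_gen S N (x - y) = presented_gen S N (x + - y)" by simp
    also have "\<dots> = presented_gen S N x \<otimes>\<^bsub>presented_group S N\<^esub> presented_gen S N (- y)"
      by (rule presented_gen_add[OF assms(1)]) (use xy in \<open>auto simp: keys_minus\<close>)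
    also have "presented_gen S N (- y) = inv\<^bsub>presented_group S N\<^esub> presented_gen S N y"
      using H.hom_inv[of y] xy by (simp del: mult_FactGroup)
    finally show "P (presented_gen S N (x - y))"
      using xy H.hom_closed by (simp add: inv mult del: mult_FactGroup)
  qed (rule gen)
  then show ?thesis using w by simp
qed

text \<open>The extension of \<open>f\<close> to the free group kills every relator, so its kernel
  contains the subgroup they generate and it factors through the quotient. One decomposition
  respected by \<open>f\<close> is enough for each relator, because the value of the extension can
  be computed from any of them.\<close>

lemma presented_universal:
  assumes "additive_rels S N" "comm_group H" "\<And>a. a \<in> S \<Longrightarrow> f a \<in> carrier H"
    and rel: "\<And>w. w \<in> N \<Longrightarrow> \<exists>a\<in>S. \<exists>b\<in>S. \<exists>c\<in>S. w = frag_of a - frag_of b - frag_of c \<and>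
      f a = f b \<otimes>\<^bsub>H\<^esub> f c"
  obtains h where "h \<in> hom (presented_group S N) H"
    "\<And>a. a \<in> S \<Longrightarrow> h (presented_gen S N (frag_of a)) = f a"
proof -
  interpret H: comm_group H by fact
  obtain k where k: "k \<in> hom (free_Abelian_group S) H" "\<And>a. a \<in> S \<Longrightarrow> k (frag_of a) = f a"
    using H.free_Abelian_group_universal[of f S] assms(3) by (metis image_subset_iff)
  interpret K: group_hom "free_Abelian_group S" H k
    using k(1) by (simp add: group_hom_def group_hom_axioms_def)
  have "N \<subseteq> kernel (free_Abelian_group S) H k"
  proof
    fix w assume w: "w \<in> N"
    then obtain a b c where abc: "a \<in> S" "b \<in> S" "c \<in> S" "w = frag_of a - frag_of b - frag_of c"
      and fa: "f a = f b \<otimes>\<^bsub>H\<^esub> f c"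
      using rel by blast
    have wc: "w \<in> carrier (free_Abelian_group S)"
      using additive_rels_subset[OF assms(1)] w by blast
    have bc: "frag_of b + frag_of c \<in> carrier (free_Abelian_group S)"
      using abc keys_add[of "frag_of b" "frag_of c"] by (auto simp: keys_frag_of)
    have kbc: "k (frag_of b + frag_of c) = k (frag_of b) \<otimes>\<^bsub>H\<^esub> k (frag_of c)"
      using K.hom_mult[of "frag_of b" "frag_of c"] abc by (simp add: keys_frag_of)
    have "k (w + (frag_of b + frag_of c)) = k w \<otimes>\<^bsub>H\<^esub> k (frag_of b + frag_of c)"
      using K.hom_mult[OF wc bc] by simp
    moreover have "w + (frag_of b + frag_of c) = frag_of a" using abc by simp
    ultimately have "f b \<otimes>\<^bsub>H\<^esub> f c = k w \<otimes>\<^bsub>H\<^esub> (f b \<otimes>\<^bsub>H\<^esub> f c)"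
      using kbc k(2) abc fa by metis
    then have "k w = \<one>\<^bsub>H\<^esub>"
      using K.hom_closed[OF wc] assms(3) abc by (metis H.m_closed H.r_cancel_one')
    then show "w \<in> kernel (free_Abelian_group S) H k"
      using wc by (simp add: kernel_def)
  qed
  then have "generate (free_Abelian_group S) N \<subseteq> kernel (free_Abelian_group S) H k"
    using K.subgroup_kernel K.G.generate_subgroup_incl by blast
  from K.FactGroup_universal_kernel[OF normal_rels[OF assms(1)] this]
  obtain h where "h \<in> hom (presented_group S N) H"
    "\<And>x. x \<in> carrier (free_Abelian_group S) \<Longrightarrow> h (presented_gen S N x) = k x"
    by metis
  then show thesis
    using that[of h] k(2) by (simp add: keys_frag_of)
qed


section \<open>Extension of scalars\<close>

lemma tensor_rels_additive:
  assumes "cring R" "comm_group G"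
  shows "additive_rels (carrier R \<times> carrier G) (tensor_rels R G)"
proof -
  interpret R: cring R by fact
  interpret G: comm_group G by fact
  show ?thesis
    unfolding additive_rels_def tensor_rels_def
    by (auto; metis G.m_closed R.add.m_closed mem_Sigma_iff)
qed

abbreviation tensor_group :: "('r, 'k) ring_scheme \<Rightarrow> ('g, 'l) monoid_scheme \<Rightarrow>
    ('r \<times> 'g \<Rightarrow>\<^sub>0 int) set monoid" where
  "tensor_group R G \<equiv> presented_group (carrier R \<times> carrier G) (tensor_rels R G)"

lemma pure_tensor_eq:
  "pure_tensor R G r g = presented_gen (carrier R \<times> carrier G) (tensor_rels R G) (frag_of (r, g))"
  by (simp add: pure_tensor_def tensor_subgroup_def tensor_free_def)

lemma scalar_extension_simps [simp]:
  "carrier (scalar_extension R G) = carrier (tensor_group R G)"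
  "zero (scalar_extension R G) = \<one>\<^bsub>tensor_group R G\<^esub>"
  "add (scalar_extension R G) = monoid.mult (tensor_group R G)"
  by (simp_all add: scalar_extension_def Let_def tensor_free_def tensor_subgroup_def)

locale tensor_setting = R: cring R + G: comm_group G
  for R :: "('r, 'k) ring_scheme" and G :: "('g, 'l) monoid_scheme"
begin

abbreviation "T \<equiv> tensor_group R G"

lemma rels: "additive_rels (carrier R \<times> carrier G) (tensor_rels R G)"
  by (rule tensor_rels_additive) unfold_locales

sublocale T: comm_group T
  by (rule presented_comm_group[OF rels])

lemma pure_closed: "\<lbrakk>r \<in> carrier R; g \<in> carrier G\<rbrakk> \<Longrightarrow> pure_tensor R G r g \<in> carrier T"
  unfolding pure_tensor_eq by (rule presented_gen_closed) (simp add: keys_frag_of)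

lemma pure_add_left:
  assumes "r \<in> carrier R" "s \<in> carrier R" "g \<in> carrier G"
  shows "pure_tensor R G (r \<oplus>\<^bsub>R\<^esub> s) g = pure_tensor R G r g \<otimes>\<^bsub>T\<^esub> pure_tensor R G s g"
  unfolding pure_tensor_eq
  by (rule presented_gen_eq[OF rels]) (use assms in \<open>auto simp: tensor_rels_def\<close>)

lemma pure_add_right:
  assumes "r \<in> carrier R" "g \<in> carrier G" "h \<in> carrier G"
  shows "pure_tensor R G r (g \<otimes>\<^bsub>G\<^esub> h) = pure_tensor R G r g \<otimes>\<^bsub>T\<^esub> pure_tensor R G r h"
  unfolding pure_tensor_eq
  by (rule presented_gen_eq[OF rels]) (use assms in \<open>auto simp: tensor_rels_def\<close>)

lemma tensor_induct [consumes 1, case_names one mult inv pure]: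
  assumes "x \<in> carrier T" "P \<one>\<^bsub>T\<^esub>"
    "\<And>x y. \<lbrakk>x \<in> carrier T; y \<in> carrier T; P x; P y\<rbrakk> \<Longrightarrow> P (x \<otimes>\<^bsub>T\<^esub> y)"
    "\<And>x. \<lbrakk>x \<in> carrier T; P x\<rbrakk> \<Longrightarrow> P (inv\<^bsub>T\<^esub> x)"
    "\<And>r g. \<lbrakk>r \<in> carrier R; g \<in> carrier G\<rbrakk> \<Longrightarrow> P (pure_tensor R G r g)"
  shows "P x"
  by (rule presented_induct[OF rels assms(1)]) (use assms(2-) in \<open>auto simp: pure_tensor_eq simp del: mult_FactGroup one_FactGroup\<close>)

lemma tensor_universal:
  assumes "comm_group H" "\<And>r g. \<lbrakk>r \<in> carrier R; g \<in> carrier G\<rbrakk> \<Longrightarrow> f r g \<in> carrier H"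
    "\<And>r s g. \<lbrakk>r \<in> carrier R; s \<in> carrier R; g \<in> carrier G\<rbrakk> \<Longrightarrow> f (r \<oplus>\<^bsub>R\<^esub> s) g = f r g \<otimes>\<^bsub>H\<^esub> f s g"
    "\<And>r g h. \<lbrakk>r \<in> carrier R; g \<in> carrier G; h \<in> carrier G\<rbrakk> \<Longrightarrow> f r (g \<otimes>\<^bsub>G\<^esub> h) = f r g \<otimes>\<^bsub>H\<^esub> f r h"
  obtains k where "k \<in> hom T H" "\<And>r g. \<lbrakk>r \<in> carrier R; g \<in> carrier G\<rbrakk> \<Longrightarrow> k (pure_tensor R G r g) = f r g"
proof -
  let ?S = "carrier R \<times> carrier G"
  let ?N = "tensor_rels R G"
  have rel: "\<exists>a\<in>?S. \<exists>b\<in>?S. \<exists>c\<in>?S. w = frag_of a - frag_of b - frag_of c \<and>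
      (\<lambda>(r, g). f r g) a = (\<lambda>(r, g). f r g) b \<otimes>\<^bsub>H\<^esub> (\<lambda>(r, g). f r g) c" if w: "w \<in> ?N" for w
  proof -
    consider (l) r s g where "w = frag_of (r \<oplus>\<^bsub>R\<^esub> s, g) - frag_of (r, g) - frag_of (s, g)"
        "r \<in> carrier R" "s \<in> carrier R" "g \<in> carrier G"
      | (r) r g h where "w = frag_of (r, g \<otimes>\<^bsub>G\<^esub> h) - frag_of (r, g) - frag_of (r, h)"
        "r \<in> carrier R" "g \<in> carrier G" "h \<in> carrier G"
      using w unfolding tensor_rels_def by blast
    then show ?thesis
    proof cases
      case l
      then show ?thesis
        by (intro bexI[of _ "(r \<oplus>\<^bsub>R\<^esub> s, g)"] bexI[of _ "(r, g)"] bexI[of _ "(s, g)"]) (auto simp: assms)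
    next
      case r
      then show ?thesis
        by (intro bexI[of _ "(r, g \<otimes>\<^bsub>G\<^esub> h)"] bexI[of _ "(r, g)"] bexI[of _ "(r, h)"]) (auto simp: assms)
    qed
  qed
  have closed: "(\<lambda>(r, g). f r g) a \<in> carrier H" if "a \<in> ?S" for a
    using that assms(2) by auto
  obtain k where "k \<in> hom T H"
    "\<And>a. a \<in> ?S \<Longrightarrow> k (presented_gen ?S ?N (frag_of a)) = (\<lambda>(r, g). f r g) a"
    using presented_universal[OF rels assms(1) closed rel] by blast
  then show thesis using that[of k] by (auto simp: pure_tensor_eq)
qed

text \<open>The uniqueness half of the universal property. The module laws and the linearity of
  induced maps are obtained by comparing two homomorphisms on pure tensors.\<close>

lemma hom_eqI:
  assumes "h \<in> hom T H" "k \<in> hom T H" "comm_group H" "x \<in> carrier T"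
    "\<And>r g. \<lbrakk>r \<in> carrier R; g \<in> carrier G\<rbrakk> \<Longrightarrow> h (pure_tensor R G r g) = k (pure_tensor R G r g)"
  shows "h x = k x"
proof -
  interpret H: comm_group H by fact
  interpret h: group_hom T H h
    using assms(1) by (simp add: group_hom_def group_hom_axioms_def)
  interpret k: group_hom T H k
    using assms(2) by (simp add: group_hom_def group_hom_axioms_def)
  show ?thesis
    using assms(4) by (induction rule: tensor_induct) (auto simp: assms(5) simp del: mult_FactGroup one_FactGroup)
qed

abbreviation "M \<equiv> scalar_extension R G"

text \<open>Scalar multiplication is defined through all representatives of a coset at once. The
  universal property supplies a homomorphism \<open>k\<close> with the expected values on pure
  tensors, and the multiplication is identified with \<open>k\<close>; being well defined and
  additive then comes for free.\<close>

lemma smult_hom: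
  assumes t: "t \<in> carrier R"
  shows "(\<lambda>c. t \<odot>\<^bsub>M\<^esub> c) \<in> hom T T"
    and "\<lbrakk>r \<in> carrier R; g \<in> carrier G\<rbrakk> \<Longrightarrow>
      t \<odot>\<^bsub>M\<^esub> pure_tensor R G r g = pure_tensor R G (t \<otimes>\<^bsub>R\<^esub> r) g"
proof -
  let ?S = "carrier R \<times> carrier G" and ?N = "tensor_rels R G"
  let ?F = "free_Abelian_group ?S" and ?q = "presented_gen ?S ?N"
  let ?e = "frag_extend (\<lambda>(r, g). frag_of (t \<otimes>\<^bsub>R\<^esub> r, g))"
  obtain k where k: "k \<in> hom T T"
    "\<And>r g. \<lbrakk>r \<in> carrier R; g \<in> carrier G\<rbrakk> \<Longrightarrow> k (pure_tensor R G r g) = pure_tensor R G (t \<otimes>\<^bsub>R\<^esub> r) g"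
    by (rule tensor_universal[OF T.comm_group_axioms, of "\<lambda>r g. pure_tensor R G (t \<otimes>\<^bsub>R\<^esub> r) g"])
      (use t in \<open>auto simp: pure_closed pure_add_left pure_add_right R.r_distr simp del: mult_FactGroup\<close>)
  interpret k: group_hom T T k
    using k(1) by (simp add: group_hom_def group_hom_axioms_def)
  interpret q: group_hom ?F T ?q
    by (rule presented_gen_group_hom[OF rels])
  \<comment> \<open>The formula on formal sums induces \<open>k\<close> on cosets. The condition on
    the keys is carried along because additivity of the quotient map holds only on the
    carrier.\<close>
  have e: "Poly_Mapping.keys (?e w) \<subseteq> ?S \<and> ?q (?e w) = k (?q w)" if w: "Poly_Mapping.keys w \<subseteq> ?S" for w
  proof (rule free_Abelian_group_induct[OF w])
    show "Poly_Mapping.keys (?e 0) \<subseteq> ?S \<and> ?q (?e 0) = k (?q 0)"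
      using q.hom_one k.hom_one by simp
  next
    fix x y assume xy: "Poly_Mapping.keys x \<subseteq> ?S" "Poly_Mapping.keys y \<subseteq> ?S"
      "Poly_Mapping.keys (?e x) \<subseteq> ?S \<and> ?q (?e x) = k (?q x)"
      "Poly_Mapping.keys (?e y) \<subseteq> ?S \<and> ?q (?e y) = k (?q y)"
    have diff: "?q (x - y) = ?q x \<otimes>\<^bsub>T\<^esub> inv\<^bsub>T\<^esub> ?q y"
      if "Poly_Mapping.keys x \<subseteq> ?S" "Poly_Mapping.keys y \<subseteq> ?S" for x y
      using q.hom_mult[of x "- y"] q.hom_inv[of y] that by (simp add: keys_minus del: mult_FactGroup)
    have "?e (x - y) = ?e x - ?e y" by (rule frag_extend_diff)
    moreover have "Poly_Mapping.keys (?e x - ?e y) \<subseteq> ?S"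
      using xy keys_diff[of "?e x" "?e y"] by blast
    moreover have "k (?q (x - y)) = k (?q x) \<otimes>\<^bsub>T\<^esub> inv\<^bsub>T\<^esub> k (?q y)"
      using xy q.hom_closed by (simp add: diff del: mult_FactGroup)
    ultimately show "Poly_Mapping.keys (?e (x - y)) \<subseteq> ?S \<and> ?q (?e (x - y)) = k (?q (x - y))"
      using xy diff[of "?e x" "?e y"] by (simp del: mult_FactGroup)
  next
    fix a assume "a \<in> ?S"
    then show "Poly_Mapping.keys (?e (frag_of a)) \<subseteq> ?S \<and> ?q (?e (frag_of a)) = k (?q (frag_of a))"
      using k(2) t by (auto simp: pure_tensor_eq keys_frag_of)
  qed
  \<comment> \<open>Every representative contributes the same coset \<open>k c\<close>, and the
    coset is not empty, so the union in the definition is this coset.\<close>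
  have sm: "t \<odot>\<^bsub>M\<^esub> c = k c" if c: "c \<in> carrier T" for c
  proof -
    obtain w where w: "w \<in> carrier ?F" "c = ?q w"
      using c by (auto simp: carrier_FactGroup)
    have sub: "subgroup (generate ?F ?N) ?F" by (rule subgroup_rels[OF rels])
    have "?q (?e v) = k c" if v: "v \<in> c" for v
    proof -
      have "?q w = ?q v"
        using group.repr_independence[OF group_free_Abelian_group _ w(1) sub] v w by blast
      moreover have "v \<in> carrier ?F"
        using monoid.r_coset_subset_G[OF group.is_monoid[OF group_free_Abelian_group] subgroup.subset[OF sub] w(1)] v w by blast
      ultimately show ?thesis using e[of v] w by simp
    qed
    moreover have "w \<in> c"
      using group.rcos_self[OF group_free_Abelian_group w(1) sub] w(2) by simp
    ultimately have "(\<Union>v\<in>c. ?q (?e v)) = k c" by blast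
    then show ?thesis
      by (simp add: scalar_extension_def Let_def tensor_subgroup_def tensor_free_def)
  qed
  show "(\<lambda>c. t \<odot>\<^bsub>M\<^esub> c) \<in> hom T T"
    using k(1) by (simp add: hom_def sm del: mult_FactGroup cong: Pi_cong)
  show "\<lbrakk>r \<in> carrier R; g \<in> carrier G\<rbrakk> \<Longrightarrow>
      t \<odot>\<^bsub>M\<^esub> pure_tensor R G r g = pure_tensor R G (t \<otimes>\<^bsub>R\<^esub> r) g"
    by (simp add: sm pure_closed k(2))
qed

lemma scalar_extension_module: "module R M"
proof (rule moduleI)
  show "cring R" by unfold_locales
  show "abelian_group M"
  proof -
    show ?thesis
      by (rule abelian_groupI)
        (use T.l_inv_ex in \<open>auto simp: T.m_ac simp del: mult_FactGroup one_FactGroup\<close>)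
  qed
next
  fix a x assume "a \<in> carrier R" "x \<in> carrier M"
  then show "a \<odot>\<^bsub>M\<^esub> x \<in> carrier M"
    using hom_in_carrier[OF smult_hom(1)] by auto
next
  fix a b x assume ab: "a \<in> carrier R" "b \<in> carrier R" and x: "x \<in> carrier M"
  \<comment> \<open>Both sides of the law have to be homomorphisms in \<open>x\<close>; a pointwise
    product of homomorphisms is one because the target is commutative.\<close>
  have "(\<lambda>x. (a \<odot>\<^bsub>M\<^esub> x) \<otimes>\<^bsub>T\<^esub> (b \<odot>\<^bsub>M\<^esub> x)) \<in> hom T T"
    using T.hom_group_mult smult_hom(1)[OF ab(1)] smult_hom(1)[OF ab(2)] by blast
  then show "(a \<oplus>\<^bsub>R\<^esub> b) \<odot>\<^bsub>M\<^esub> x = a \<odot>\<^bsub>M\<^esub> x \<oplus>\<^bsub>M\<^esub> b \<odot>\<^bsub>M\<^esub> x"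
    using hom_eqI[OF smult_hom(1) _ T.comm_group_axioms, of "a \<oplus>\<^bsub>R\<^esub> b" "\<lambda>x. (a \<odot>\<^bsub>M\<^esub> x) \<otimes>\<^bsub>T\<^esub> (b \<odot>\<^bsub>M\<^esub> x)" x]
      ab x by (simp add: smult_hom(2) pure_add_left R.l_distr del: mult_FactGroup)
next
  fix a x y assume "a \<in> carrier R" "x \<in> carrier M" "y \<in> carrier M"
  then show "a \<odot>\<^bsub>M\<^esub> (x \<oplus>\<^bsub>M\<^esub> y) = a \<odot>\<^bsub>M\<^esub> x \<oplus>\<^bsub>M\<^esub> a \<odot>\<^bsub>M\<^esub> y"
    using hom_mult[OF smult_hom(1)] by (simp del: mult_FactGroup)
next
  fix a b x assume ab: "a \<in> carrier R" "b \<in> carrier R" and x: "x \<in> carrier M"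
  have "(\<lambda>x. a \<odot>\<^bsub>M\<^esub> (b \<odot>\<^bsub>M\<^esub> x)) \<in> hom T T"
    using hom_compose[OF smult_hom(1)[OF ab(2)] smult_hom(1)[OF ab(1)]] by (simp add: o_def)
  then show "(a \<otimes>\<^bsub>R\<^esub> b) \<odot>\<^bsub>M\<^esub> x = a \<odot>\<^bsub>M\<^esub> (b \<odot>\<^bsub>M\<^esub> x)"
    using hom_eqI[OF smult_hom(1) _ T.comm_group_axioms, of "a \<otimes>\<^bsub>R\<^esub> b" "\<lambda>x. a \<odot>\<^bsub>M\<^esub> (b \<odot>\<^bsub>M\<^esub> x)" x]
      ab x by (simp add: smult_hom(2) R.m_assoc)
next
  fix x assume x: "x \<in> carrier M"
  have "(\<lambda>x. x) \<in> hom T T" by (simp add: hom_def)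
  then show "\<one>\<^bsub>R\<^esub> \<odot>\<^bsub>M\<^esub> x = x"
    using hom_eqI[OF smult_hom(1) _ T.comm_group_axioms, of "\<one>\<^bsub>R\<^esub>" "\<lambda>x. x" x] x
    by (simp add: smult_hom(2))
qed

text \<open>A pure tensor of r and g is r times the tensor of 1 and g, and the group inverse is
  multiplication by -1. So sums and scalar multiples of the elements with first entry 1 already
  exhaust the module.\<close>

lemma scalar_extension_induct [consumes 1, case_names zero add smult gen]:
  assumes x: "x \<in> carrier M" and zero: "P \<zero>\<^bsub>M\<^esub>"
    and add: "\<And>x y. \<lbrakk>x \<in> carrier M; y \<in> carrier M; P x; P y\<rbrakk> \<Longrightarrow> P (x \<oplus>\<^bsub>M\<^esub> y)"
    and smult: "\<And>t x. \<lbrakk>t \<in> carrier R; x \<in> carrier M; P x\<rbrakk> \<Longrightarrow> P (t \<odot>\<^bsub>M\<^esub> x)"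
    and gen: "\<And>g. g \<in> carrier G \<Longrightarrow> P (pure_tensor R G \<one>\<^bsub>R\<^esub> g)"
  shows "P x"
proof -
  interpret M: module R M by (rule scalar_extension_module)
  have "x \<in> carrier T" using x by simp
  then show ?thesis
  proof (induction rule: tensor_induct)
    case one
    show ?case using zero by (simp del: one_FactGroup)
  next
    case (mult x y)
    then show ?case using add by (simp del: mult_FactGroup)
  next
    case (inv x)
    have "(\<ominus>\<^bsub>R\<^esub> \<one>\<^bsub>R\<^esub>) \<odot>\<^bsub>M\<^esub> x \<oplus>\<^bsub>M\<^esub> \<one>\<^bsub>R\<^esub> \<odot>\<^bsub>M\<^esub> x = \<zero>\<^bsub>M\<^esub>"
      using inv M.smult_l_distr[of "\<ominus>\<^bsub>R\<^esub> \<one>\<^bsub>R\<^esub>" "\<one>\<^bsub>R\<^esub>" x] by (simp add: R.l_neg)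
    then have "inv\<^bsub>T\<^esub> x = (\<ominus>\<^bsub>R\<^esub> \<one>\<^bsub>R\<^esub>) \<odot>\<^bsub>M\<^esub> x"
      using inv M.smult_closed[of "\<ominus>\<^bsub>R\<^esub> \<one>\<^bsub>R\<^esub>" x]
      by (intro T.inv_equality) (auto simp del: one_FactGroup mult_FactGroup)
    then show ?case using inv smult by auto
  next
    case (pure r g)
    then show ?case
      using smult[OF pure(1) _ gen[OF pure(2)]] smult_hom(2)[OF pure(1) R.one_closed pure(2)]
      by (simp add: pure_closed)
  qed
qed

end

section \<open>Linear and bilinear maps between modules\<close>

definition linear_map :: "('r, 'k) ring_scheme \<Rightarrow> ('r, 'a) module \<Rightarrow> ('r, 'b) module \<Rightarrow> ('a \<Rightarrow> 'b) \<Rightarrow> bool" where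
  "linear_map R M N f \<longleftrightarrow> (\<forall>x\<in>carrier M. f x \<in> carrier N) \<and>
    (\<forall>x\<in>carrier M. \<forall>y\<in>carrier M. f (x \<oplus>\<^bsub>M\<^esub> y) = f x \<oplus>\<^bsub>N\<^esub> f y) \<and>
    (\<forall>r\<in>carrier R. \<forall>x\<in>carrier M. f (r \<odot>\<^bsub>M\<^esub> x) = r \<odot>\<^bsub>N\<^esub> f x)"

lemma linear_map_zero:
  assumes "module R M" "module R N" "linear_map R M N f"
  shows "f \<zero>\<^bsub>M\<^esub> = \<zero>\<^bsub>N\<^esub>"
proof -
  interpret M: module R M by fact
  interpret N: module R N by fact
  \<comment> \<open>Zero is kept in the form 0 times 0, so that compatibility with scalars alone
    yields the claim; the two simplification rules that would collapse this form are switched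
    off.\<close>
  have "f (\<zero>\<^bsub>R\<^esub> \<odot>\<^bsub>M\<^esub> \<zero>\<^bsub>M\<^esub>) = \<zero>\<^bsub>R\<^esub> \<odot>\<^bsub>N\<^esub> f \<zero>\<^bsub>M\<^esub>" "f \<zero>\<^bsub>M\<^esub> \<in> carrier N"
    using assms(3) by (auto simp: linear_map_def simp del: M.smult_l_null M.smult_r_null)
  then show ?thesis by simp
qed

lemma linear_map_comp:
  "\<lbrakk>linear_map R N P g; linear_map R M N f\<rbrakk> \<Longrightarrow> linear_map R M P (\<lambda>x. g (f x))"
  unfolding linear_map_def by simp

lemma linear_map_id: "linear_map R M M (\<lambda>x. x)"
  unfolding linear_map_def by simp

lemma bilinear_map_left:
  "\<lbrakk>bilinear_map R M N P m; y \<in> carrier N\<rbrakk> \<Longrightarrow> linear_map R M P (\<lambda>x. m x y)"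
  unfolding bilinear_map_def linear_map_def by simp

lemma bilinear_map_right:
  "\<lbrakk>bilinear_map R M N P m; x \<in> carrier M\<rbrakk> \<Longrightarrow> linear_map R N P (\<lambda>y. m x y)"
  unfolding bilinear_map_def linear_map_def by simp

lemma bilinear_map_closed:
  "\<lbrakk>bilinear_map R M N P m; x \<in> carrier M; y \<in> carrier N\<rbrakk> \<Longrightarrow> m x y \<in> carrier P"
  unfolding bilinear_map_def by simp

context tensor_setting
begin

text \<open>The assignment of r times h(g) to a pair (r, g) is biadditive, hence induces a group
  homomorphism. That it commutes with scalars is again an equality of two homomorphisms, tested on
  pure tensors.\<close>

lemma scalar_extension_universal:
  assumes "module R N" "h \<in> hom G (add_monoid N)"
  obtains L where "linear_map R M N L"
    "\<And>r g. \<lbrakk>r \<in> carrier R; g \<in> carrier G\<rbrakk> \<Longrightarrow> L (pure_tensor R G r g) = r \<odot>\<^bsub>N\<^esub> h g"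
proof -
  interpret N: module R N by fact
  interpret M: module R M by (rule scalar_extension_module)
  have h: "\<And>g. g \<in> carrier G \<Longrightarrow> h g \<in> carrier N"
    "\<And>x y. \<lbrakk>x \<in> carrier G; y \<in> carrier G\<rbrakk> \<Longrightarrow> h (x \<otimes>\<^bsub>G\<^esub> y) = h x \<oplus>\<^bsub>N\<^esub> h y"
    using assms(2) by (auto simp: hom_def)
  obtain k where k: "k \<in> hom T (add_monoid N)"
    "\<And>r g. \<lbrakk>r \<in> carrier R; g \<in> carrier G\<rbrakk> \<Longrightarrow> k (pure_tensor R G r g) = r \<odot>\<^bsub>N\<^esub> h g"
    by (rule tensor_universal[OF N.a_comm_group, of "\<lambda>r g. r \<odot>\<^bsub>N\<^esub> h g"])
      (auto simp: h N.smult_l_distr N.smult_r_distr)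
  have clo: "\<And>x. x \<in> carrier T \<Longrightarrow> k x \<in> carrier N"
    and add: "\<And>x y. \<lbrakk>x \<in> carrier T; y \<in> carrier T\<rbrakk> \<Longrightarrow> k (x \<otimes>\<^bsub>T\<^esub> y) = k x \<oplus>\<^bsub>N\<^esub> k y"
    using k(1) by (auto simp: hom_def)
  have "k (t \<odot>\<^bsub>M\<^esub> x) = t \<odot>\<^bsub>N\<^esub> k x" if t: "t \<in> carrier R" and x: "x \<in> carrier T" for t x
  proof (rule hom_eqI[OF _ _ N.a_comm_group x])
    show "(\<lambda>x. k (t \<odot>\<^bsub>M\<^esub> x)) \<in> hom T (add_monoid N)"
      using hom_compose[OF smult_hom(1)[OF t] k(1)] by (simp add: o_def)
    show "(\<lambda>x. t \<odot>\<^bsub>N\<^esub> k x) \<in> hom T (add_monoid N)"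
      by (rule homI) (auto simp: t clo add N.smult_r_distr simp del: mult_FactGroup)
    show "k (t \<odot>\<^bsub>M\<^esub> pure_tensor R G r g) = t \<odot>\<^bsub>N\<^esub> k (pure_tensor R G r g)"
      if "r \<in> carrier R" "g \<in> carrier G" for r g
      using that t by (simp add: smult_hom(2) k(2) h N.smult_assoc1)
  qed
  then have "linear_map R M N k"
    unfolding linear_map_def using clo add by (simp del: mult_FactGroup)
  then show thesis using that k(2) by blast
qed

end


section \<open>Modules of bisets\<close>

lemma functor_iso_refl: "functor_iso K F F"
  unfolding functor_iso_def by (intro exI[of _ "\<lambda>x u. u"]) (auto simp: bij_betw_def)

lemma functor_iso_trans:
  assumes K: "finite_category K" and "functor_iso K F G" "functor_iso K G H"
  shows "functor_iso K F H"
proof -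
  interpret K: finite_category K by fact
  obtain a where a: "\<And>x. x \<in> cobj K \<Longrightarrow> bij_betw (a x) (fob F x) (fob G x)"
    "\<And>f u. \<lbrakk>f \<in> carr K; u \<in> fob F (cdom K f)\<rbrakk> \<Longrightarrow> a (ccod K f) (farr F f u) = farr G f (a (cdom K f) u)"
    using assms(2) unfolding functor_iso_def by blast
  obtain b where b: "\<And>x. x \<in> cobj K \<Longrightarrow> bij_betw (b x) (fob G x) (fob H x)"
    "\<And>f u. \<lbrakk>f \<in> carr K; u \<in> fob G (cdom K f)\<rbrakk> \<Longrightarrow> b (ccod K f) (farr G f u) = farr H f (b (cdom K f) u)"
    using assms(3) unfolding functor_iso_def by blast
  show ?thesis
    unfolding functor_iso_def
  proof (intro exI[of _ "\<lambda>x u. b x (a x u)"] conjI ballI)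
    fix x assume "x \<in> cobj K"
    then show "bij_betw (\<lambda>u. b x (a x u)) (fob F x) (fob H x)"
      using bij_betw_trans[OF a(1) b(1)] by (simp add: o_def)
  next
    fix f u assume fu: "f \<in> carr K" "u \<in> fob F (cdom K f)"
    then have "a (cdom K f) u \<in> fob G (cdom K f)"
      using bij_betwE[OF a(1)[OF K.dom_closed]] by blast
    then show "b (ccod K f) (a (ccod K f) (farr F f u)) = farr H f (b (cdom K f) (a (cdom K f) u))"
      using fu a(2) b(2) by simp
  qed
qed

lemma functor_iso_sym:
  assumes K: "finite_category K" and F: "set_functor K F" and "functor_iso K F G"
  shows "functor_iso K G F"
proof -
  interpret K: finite_category K by fact
  obtain a where a: "\<And>x. x \<in> cobj K \<Longrightarrow> bij_betw (a x) (fob F x) (fob G x)"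
    "\<And>f u. \<lbrakk>f \<in> carr K; u \<in> fob F (cdom K f)\<rbrakk> \<Longrightarrow> a (ccod K f) (farr F f u) = farr G f (a (cdom K f) u)"
    using assms(3) unfolding functor_iso_def by blast
  let ?b = "\<lambda>x. the_inv_into (fob F x) (a x)"
  show ?thesis
    unfolding functor_iso_def
  proof (intro exI[of _ ?b] conjI ballI)
    fix x assume "x \<in> cobj K"
    then show "bij_betw (?b x) (fob G x) (fob F x)"
      using bij_betw_the_inv_into[OF a(1)] by simp
  next
    fix f w assume f: "f \<in> carr K" and w: "w \<in> fob G (cdom K f)"
    obtain u where u: "u \<in> fob F (cdom K f)" "w = a (cdom K f) u"
      using w a(1)[OF K.dom_closed[OF f]] by (auto simp: bij_betw_def)
    \<comment> \<open>Functoriality of \<open>F\<close> enters here: the image has to lie in the set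
      on which the inverse bijection is a left inverse.\<close>
    have "farr F f u \<in> fob F (ccod K f)"
      using F f u unfolding set_functor_def by blast
    then show "?b (ccod K f) (farr G f w) = farr F f (?b (cdom K f) w)"
      using u a(2)[OF f u(1)] a(1)[OF K.dom_closed[OF f]] a(1)[OF K.cod_closed[OF f]]
      by (metis bij_betw_imp_inj_on the_inv_into_f_f)
  qed
qed

section \<open>Opposites and products of finite categories, and disjoint unions of functors\<close>

lemma finite_category_op: "finite_category C \<Longrightarrow> finite_category (op_cat C)"
  unfolding finite_category_def op_cat_def by simp

lemma elt_times_iff [simp]: "Pair a b \<in> elt_times A B \<longleftrightarrow> a \<in> A \<and> b \<in> B"
  unfolding elt_times_def by auto

lemma elt_timesE: assumes "w \<in> elt_times A B" obtains a b where "w = Pair a b" "a \<in> A" "b \<in> B"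
  using assms unfolding elt_times_def by auto

lemma ball_elt_times [simp]: "(\<forall>w\<in>elt_times A B. P w) \<longleftrightarrow> (\<forall>a\<in>A. \<forall>b\<in>B. P (Pair a b))"
  unfolding elt_times_def by auto

lemma finite_elt_times: "finite A \<Longrightarrow> finite B \<Longrightarrow> finite (elt_times A B)"
proof -
  assume "finite A" "finite B"
  moreover have "elt_times A B = (\<lambda>(a, b). Pair a b) ` (A \<times> B)"
    unfolding elt_times_def by auto
  ultimately show ?thesis by simp
qed

lemma finite_category_prod:
  assumes "finite_category C" "finite_category D"
  shows "finite_category (prod_cat C D)"
proof -
  interpret C: finite_category C by fact
  interpret D: finite_category D by fact
  show ?thesis
    by unfold_locales
      (auto simp: prod_cat_def C.comp_assoc D.comp_assoc elim!: elt_timesE intro: finite_elt_times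
        C.finite_objects D.finite_objects C.finite_arrows D.finite_arrows C.dom_closed D.dom_closed
        C.cod_closed D.cod_closed C.id_closed D.id_closed C.dom_id D.dom_id C.cod_id D.cod_id
        C.comp_closed D.comp_closed C.dom_comp D.dom_comp C.cod_comp D.cod_comp
        C.comp_id_left D.comp_id_left C.comp_id_right D.comp_id_right)
qed

lemma finite_category_unit: "finite_category unit_cat"
  by unfold_locales (auto simp: unit_cat_def)

lemma set_functor_sum:
  assumes F: "set_functor K F" and G: "set_functor K G"
  shows "set_functor K (biset_sum F G)"
  unfolding set_functor_def
proof (intro conjI ballI impI)
  fix x assume "x \<in> cobj K"
  then show "finite (fob (biset_sum F G) x)"
    using F G by (simp add: biset_sum_def set_functor_def)
next
  fix f assume "f \<in> carr K"
  then have "farr F f \<in> fob F (cdom K f) \<rightarrow> fob F (ccod K f)" "farr G f \<in> fob G (cdom K f) \<rightarrow> fob G (ccod K f)"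
    using F G by (simp_all add: set_functor_def)
  then show "farr (biset_sum F G) f \<in> fob (biset_sum F G) (cdom K f) \<rightarrow> fob (biset_sum F G) (ccod K f)"
    by (auto simp: biset_sum_def pt_def)
next
  fix x u assume x: "x \<in> cobj K" and u: "u \<in> fob (biset_sum F G) x"
  have "\<forall>u\<in>fob F x. farr F (cid K x) u = u" "\<forall>u\<in>fob G x. farr G (cid K x) u = u"
    using F G x by (simp_all add: set_functor_def)
  then show "farr (biset_sum F G) (cid K x) u = u"
    using u by (auto simp: biset_sum_def pt_def)
next
  fix f g u assume fg: "f \<in> carr K" "g \<in> carr K" "ccod K f = cdom K g"
    and u: "u \<in> fob (biset_sum F G) (cdom K f)"
  have "\<forall>u\<in>fob F (cdom K f). farr F (ccomp K g f) u = farr F g (farr F f u)"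
    "\<forall>u\<in>fob G (cdom K f). farr G (ccomp K g f) u = farr G g (farr G f u)"
    using F G fg by (simp_all add: set_functor_def)
  then show "farr (biset_sum F G) (ccomp K g f) u = farr (biset_sum F G) g (farr (biset_sum F G) f u)"
    using u by (auto simp: biset_sum_def pt_def)
qed

section \<open>The Grothendieck group of bisets and its universal property\<close>

lemma grothendieck_rels_additive: "additive_rels (iso_class C D ` Collect (biset C D)) (grothendieck_rels C D)"
  unfolding additive_rels_def grothendieck_rels_def using set_functor_sum by blast

lemma grothendieck_comm_group: "comm_group (grothendieck_group C D)"
  unfolding grothendieck_group_def biset_free_def
  by (rule presented_comm_group[OF grothendieck_rels_additive])

lemma grothendieck_class_eq:
  "grothendieck_class C D \<Omega> =
    presented_gen (iso_class C D ` Collect (biset C D)) (grothendieck_rels C D) (frag_of (iso_class C D \<Omega>))"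
  by (simp add: grothendieck_class_def biset_free_def)

lemma grothendieck_class_closed:
  "biset C D \<Omega> \<Longrightarrow> grothendieck_class C D \<Omega> \<in> carrier (grothendieck_group C D)"
  unfolding grothendieck_class_eq grothendieck_group_def biset_free_def
  by (rule presented_gen_closed) (simp add: keys_frag_of)

lemma grothendieck_class_sum:
  assumes "biset C D \<Omega>" "biset C D \<Psi>"
  shows "grothendieck_class C D (biset_sum \<Omega> \<Psi>) =
    grothendieck_class C D \<Omega> \<otimes>\<^bsub>grothendieck_group C D\<^esub> grothendieck_class C D \<Psi>"
  unfolding grothendieck_class_eq grothendieck_group_def biset_free_def
  by (rule presented_gen_eq[OF grothendieck_rels_additive])
    (use assms set_functor_sum in \<open>auto simp: grothendieck_rels_def\<close>)

lemma iso_class_eq: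
  assumes "finite_category C" "finite_category D" "biset C D \<Omega>" "biset_iso C D \<Omega> \<Psi>"
  shows "iso_class C D \<Omega> = iso_class C D \<Psi>"
proof -
  have K: "finite_category (prod_cat C (op_cat D))"
    using assms by (simp add: finite_category_prod finite_category_op)
  show ?thesis
    unfolding iso_class_def
    using functor_iso_trans[OF K] functor_iso_sym[OF K] assms(3,4) by blast
qed

lemma grothendieck_universal:
  assumes "comm_group H" "\<And>\<Omega>. biset C D \<Omega> \<Longrightarrow> f \<Omega> \<in> carrier H"
    and iso: "\<And>\<Omega> \<Psi>. \<lbrakk>biset C D \<Omega>; biset C D \<Psi>; biset_iso C D \<Omega> \<Psi>\<rbrakk> \<Longrightarrow> f \<Omega> = f \<Psi>"
    and sum: "\<And>\<Omega> \<Psi>. \<lbrakk>biset C D \<Omega>; biset C D \<Psi>\<rbrakk> \<Longrightarrow> f (biset_sum \<Omega> \<Psi>) = f \<Omega> \<otimes>\<^bsub>H\<^esub> f \<Psi>"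
  obtains h where "h \<in> hom (grothendieck_group C D) H"
    "\<And>\<Omega>. biset C D \<Omega> \<Longrightarrow> h (grothendieck_class C D \<Omega>) = f \<Omega>"
proof -
  let ?S = "iso_class C D ` Collect (biset C D)"
  \<comment> \<open>Generators are isomorphism classes, not bisets: \<open>F\<close> reads
    \<open>f\<close> off an arbitrary member, and invariance under isomorphism makes the choice
    immaterial.\<close>
  define F where "F c = f (SOME \<Omega>. \<Omega> \<in> c)" for c
  have F: "F (iso_class C D \<Omega>) = f \<Omega>" if "biset C D \<Omega>" for \<Omega>
  proof -
    have "\<Omega> \<in> iso_class C D \<Omega>"
      using that functor_iso_refl by (simp add: iso_class_def)
    then have "(SOME \<Psi>. \<Psi> \<in> iso_class C D \<Omega>) \<in> iso_class C D \<Omega>" by (rule someI)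
    then show ?thesis
      unfolding F_def iso_class_def using iso[OF that] by auto
  qed
  have closed: "F a \<in> carrier H" if "a \<in> ?S" for a
    using that F assms(2) by auto
  have rel: "\<exists>a\<in>?S. \<exists>b\<in>?S. \<exists>c\<in>?S. w = frag_of a - frag_of b - frag_of c \<and> F a = F b \<otimes>\<^bsub>H\<^esub> F c"
    if w: "w \<in> grothendieck_rels C D" for w
  proof -
    obtain \<Omega> \<Psi> where "biset C D \<Omega>" "biset C D \<Psi>"
      "w = frag_of (iso_class C D (biset_sum \<Omega> \<Psi>)) - frag_of (iso_class C D \<Omega>) - frag_of (iso_class C D \<Psi>)"
      using w unfolding grothendieck_rels_def by blast
    then show ?thesis
      using set_functor_sum F sum
      by (intro bexI[of _ "iso_class C D (biset_sum \<Omega> \<Psi>)"] bexI[of _ "iso_class C D \<Omega>"]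
        bexI[of _ "iso_class C D \<Psi>"]) auto
  qed
  obtain h where "h \<in> hom (presented_group ?S (grothendieck_rels C D)) H"
    "\<And>a. a \<in> ?S \<Longrightarrow> h (presented_gen ?S (grothendieck_rels C D) (frag_of a)) = F a"
    using presented_universal[OF grothendieck_rels_additive assms(1) closed rel] by blast
  then show thesis
    using that[of h] F by (auto simp: grothendieck_group_def biset_free_def grothendieck_class_eq)
qed

section \<open>The hom module of two categories: generation by bisets and universal property\<close>

locale biset_hom = R: cring R for R :: "('r, 'k) ring_scheme" +
  fixes C D :: "'u category"
begin

abbreviation "G \<equiv> grothendieck_group C D"
abbreviation "M \<equiv> biset_module R C D"

sublocale tensor: tensor_setting R G
  by (intro tensor_setting.intro grothendieck_comm_group) unfold_locales

lemma biset_module_module: "module R M"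
  unfolding biset_module_def by (rule tensor.scalar_extension_module)

sublocale M: module R M
  by (rule biset_module_module)

lemma biset_class_closed: "biset C D \<Omega> \<Longrightarrow> biset_class R C D \<Omega> \<in> carrier M"
  unfolding biset_class_def biset_module_def
  using tensor.pure_closed[OF R.one_closed grothendieck_class_closed] by simp

lemma biset_class_sum:
  assumes "biset C D \<Omega>" "biset C D \<Psi>"
  shows "biset_class R C D (biset_sum \<Omega> \<Psi>) = biset_class R C D \<Omega> \<oplus>\<^bsub>M\<^esub> biset_class R C D \<Psi>"
  using assms unfolding biset_class_def biset_module_def
  by (simp add: grothendieck_class_sum grothendieck_class_closed tensor.pure_add_right del: mult_FactGroup)

text \<open>Generation in two layers: the module by the tensors \<open>e g\<close> of 1 with
  elements of the Grothendieck group, and that group by classes of bisets. The map \<open>e\<close>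
  is additive, so the induction over the group can be carried out inside the module.\<close>

lemma biset_module_induct [consumes 1, case_names zero add smult gen]:
  assumes "x \<in> carrier M" and zero: "P \<zero>\<^bsub>M\<^esub>"
    and add: "\<And>x y. \<lbrakk>x \<in> carrier M; y \<in> carrier M; P x; P y\<rbrakk> \<Longrightarrow> P (x \<oplus>\<^bsub>M\<^esub> y)"
    and smult: "\<And>t x. \<lbrakk>t \<in> carrier R; x \<in> carrier M; P x\<rbrakk> \<Longrightarrow> P (t \<odot>\<^bsub>M\<^esub> x)"
    and cls: "\<And>\<Omega>. biset C D \<Omega> \<Longrightarrow> P (biset_class R C D \<Omega>)"
  shows "P x"
proof -
  define e where "e g = pure_tensor R G \<one>\<^bsub>R\<^esub> g" for g
  have e_closed: "g \<in> carrier G \<Longrightarrow> e g \<in> carrier M" for g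
    unfolding e_def biset_module_def using tensor.pure_closed[OF R.one_closed] by simp
  have e_mult: "\<lbrakk>g \<in> carrier G; h \<in> carrier G\<rbrakk> \<Longrightarrow> e (g \<otimes>\<^bsub>G\<^esub> h) = e g \<oplus>\<^bsub>M\<^esub> e h" for g h
    unfolding e_def biset_module_def using tensor.pure_add_right[OF R.one_closed]
    by (simp del: mult_FactGroup)
  have e_one: "e \<one>\<^bsub>G\<^esub> = \<zero>\<^bsub>M\<^esub>"
    using e_mult[of "\<one>\<^bsub>G\<^esub>" "\<one>\<^bsub>G\<^esub>"] e_closed[of "\<one>\<^bsub>G\<^esub>"] by (simp add: M.add.l_cancel_one')
  have e: "P (e g)" if "g \<in> carrier G" for g
  proof -
    have "g \<in> carrier (presented_group (iso_class C D ` Collect (biset C D)) (grothendieck_rels C D))"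
      using that by (simp add: grothendieck_group_def biset_free_def)
    then show ?thesis
    proof (induction rule: presented_induct[OF grothendieck_rels_additive, consumes 1, case_names one mult inv gen])
      case one
      show ?case using zero e_one by (simp add: grothendieck_group_def biset_free_def del: one_FactGroup)
    next
      case (mult x y)
      then show ?case
        using e_mult[of x y] add[of "e x" "e y"] e_closed
        by (simp add: grothendieck_group_def biset_free_def del: mult_FactGroup)
    next
      case (inv x)
      then have x: "x \<in> carrier G"
        by (simp add: grothendieck_group_def biset_free_def)
      have "(\<ominus>\<^bsub>R\<^esub> \<one>\<^bsub>R\<^esub>) \<odot>\<^bsub>M\<^esub> e x \<oplus>\<^bsub>M\<^esub> \<one>\<^bsub>R\<^esub> \<odot>\<^bsub>M\<^esub> e x = \<zero>\<^bsub>M\<^esub>"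
        using x e_closed M.smult_l_distr[of "\<ominus>\<^bsub>R\<^esub> \<one>\<^bsub>R\<^esub>" "\<one>\<^bsub>R\<^esub>" "e x"] by (simp add: R.l_neg)
      moreover have "e (inv\<^bsub>G\<^esub> x) \<oplus>\<^bsub>M\<^esub> e x = \<zero>\<^bsub>M\<^esub>"
        using e_mult[of "inv\<^bsub>G\<^esub> x" x] x e_one by simp
      \<comment> \<open>Both elements are additive inverses of \<open>e x\<close>, so cancellation
        identifies them; the inverse case of the group becomes a scalar multiple in the
        module.\<close>
      ultimately have "e (inv\<^bsub>G\<^esub> x) = (\<ominus>\<^bsub>R\<^esub> \<one>\<^bsub>R\<^esub>) \<odot>\<^bsub>M\<^esub> e x"
        using x e_closed
        by (metis tensor.G.inv_closed M.add.right_cancel M.smult_closed M.smult_one R.a_inv_closed R.one_closed)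
      then have "P (e (inv\<^bsub>G\<^esub> x))"
        using smult[of "\<ominus>\<^bsub>R\<^esub> \<one>\<^bsub>R\<^esub>" "e x"] x e_closed inv by simp
      then show ?case by (simp add: grothendieck_group_def biset_free_def)
    next
      case (gen a)
      then obtain \<Omega> where "biset C D \<Omega>" "a = iso_class C D \<Omega>" by blast
      then show ?case
        using cls[of \<Omega>] by (simp add: e_def biset_class_def grothendieck_class_eq)
    qed
  qed
  show ?thesis
    using assms(1) unfolding biset_module_def
  proof (induction rule: tensor.scalar_extension_induct)
    case (gen g)
    then show ?case using e by (simp add: e_def)
  qed (use zero add smult in \<open>auto simp: biset_module_def simp del: mult_FactGroup one_FactGroup\<close>)
qed

text \<open>Uniqueness of linear extensions, the device by which identities between morphisms are
  reduced to identities between classes of bisets.\<close>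

lemma linear_map_eqI:
  assumes "module R N" "linear_map R M N f" "linear_map R M N g" "x \<in> carrier M"
    and "\<And>\<Omega>. biset C D \<Omega> \<Longrightarrow> f (biset_class R C D \<Omega>) = g (biset_class R C D \<Omega>)"
  shows "f x = g x"
  using assms(4)
proof (induction rule: biset_module_induct)
  case zero
  then show ?case
    using linear_map_zero[OF biset_module_module assms(1)] assms(2,3) by metis
qed (use assms in \<open>auto simp: linear_map_def\<close>)

lemma biset_module_universal:
  assumes N: "module R N" and closed: "\<And>\<Omega>. biset C D \<Omega> \<Longrightarrow> f \<Omega> \<in> carrier N"
    and iso: "\<And>\<Omega> \<Psi>. \<lbrakk>biset C D \<Omega>; biset C D \<Psi>; biset_iso C D \<Omega> \<Psi>\<rbrakk> \<Longrightarrow> f \<Omega> = f \<Psi>"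
    and sum: "\<And>\<Omega> \<Psi>. \<lbrakk>biset C D \<Omega>; biset C D \<Psi>\<rbrakk> \<Longrightarrow> f (biset_sum \<Omega> \<Psi>) = f \<Omega> \<oplus>\<^bsub>N\<^esub> f \<Psi>"
  shows "\<exists>L. linear_map R M N L \<and> (\<forall>\<Omega>. biset C D \<Omega> \<longrightarrow> L (biset_class R C D \<Omega>) = f \<Omega>)"
proof -
  interpret N: module R N by fact
  obtain h where h: "h \<in> hom G (add_monoid N)"
    "\<And>\<Omega>. biset C D \<Omega> \<Longrightarrow> h (grothendieck_class C D \<Omega>) = f \<Omega>"
    using grothendieck_universal[OF N.a_comm_group, of C D f] closed iso sum by auto
  obtain L where "linear_map R M N L"
    "\<And>r g. \<lbrakk>r \<in> carrier R; g \<in> carrier G\<rbrakk> \<Longrightarrow> L (pure_tensor R G r g) = r \<odot>\<^bsub>N\<^esub> h g"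
    using tensor.scalar_extension_universal[OF N h(1)] unfolding biset_module_def by blast
  then show ?thesis
    using h(2) closed by (intro exI[of _ L]) (simp add: biset_class_def grothendieck_class_closed)
qed

end

text \<open>Here isomorphisms of bisets turn into equations, which is why no compatibility between
  chosen isomorphisms has to be tracked afterwards.\<close>

lemma biset_class_eqI:
  assumes "finite_category C" "finite_category D" "biset C D \<Omega>" "biset_iso C D \<Omega> \<Psi>"
  shows "biset_class R C D \<Omega> = biset_class R C D \<Psi>"
  unfolding biset_class_def grothendieck_class_def using iso_class_eq[OF assms] by simp

text \<open>Extension one variable at a time. With the left biset fixed, \<open>b\<close> extends to
  a linear map in the right argument; with a right argument fixed, the values so obtained are
  invariant and additive in the left biset, and extend once more. Linearity in the right argument
  survives the second extension by uniqueness.\<close>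

lemma bilinear_extension_ex:
  assumes R: "cring R" and N: "module R N"
    and closed: "\<And>\<Omega> \<Psi>. \<lbrakk>biset C D \<Omega>; biset C' D' \<Psi>\<rbrakk> \<Longrightarrow> b \<Omega> \<Psi> \<in> carrier N"
    and iso_left: "\<And>\<Omega> \<Omega>' \<Psi>. \<lbrakk>biset C D \<Omega>; biset C D \<Omega>'; biset_iso C D \<Omega> \<Omega>'; biset C' D' \<Psi>\<rbrakk>
      \<Longrightarrow> b \<Omega> \<Psi> = b \<Omega>' \<Psi>"
    and iso_right: "\<And>\<Omega> \<Psi> \<Psi>'. \<lbrakk>biset C D \<Omega>; biset C' D' \<Psi>; biset C' D' \<Psi>'; biset_iso C' D' \<Psi> \<Psi>'\<rbrakk>
      \<Longrightarrow> b \<Omega> \<Psi> = b \<Omega> \<Psi>'"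
    and sum_left: "\<And>\<Omega> \<Omega>' \<Psi>. \<lbrakk>biset C D \<Omega>; biset C D \<Omega>'; biset C' D' \<Psi>\<rbrakk>
      \<Longrightarrow> b (biset_sum \<Omega> \<Omega>') \<Psi> = b \<Omega> \<Psi> \<oplus>\<^bsub>N\<^esub> b \<Omega>' \<Psi>"
    and sum_right: "\<And>\<Omega> \<Psi> \<Psi>'. \<lbrakk>biset C D \<Omega>; biset C' D' \<Psi>; biset C' D' \<Psi>'\<rbrakk>
      \<Longrightarrow> b \<Omega> (biset_sum \<Psi> \<Psi>') = b \<Omega> \<Psi> \<oplus>\<^bsub>N\<^esub> b \<Omega> \<Psi>'"
  shows "\<exists>m. bilinear_map R (biset_module R C D) (biset_module R C' D') N m \<and>
    (\<forall>\<Omega> \<Psi>. biset C D \<Omega> \<longrightarrow> biset C' D' \<Psi> \<longrightarrow> m (biset_class R C D \<Omega>) (biset_class R C' D' \<Psi>) = b \<Omega> \<Psi>)"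
proof -
  interpret L: biset_hom R C D by (rule biset_hom.intro[OF R])
  interpret Q: biset_hom R C' D' by (rule biset_hom.intro[OF R])
  interpret N: module R N by fact
  have "\<exists>g. linear_map R Q.M N g \<and> (\<forall>\<Psi>. biset C' D' \<Psi> \<longrightarrow> g (biset_class R C' D' \<Psi>) = b \<Omega> \<Psi>)"
    if "biset C D \<Omega>" for \<Omega>
    by (rule Q.biset_module_universal[OF N]) (use that closed iso_right sum_right in auto)
  then obtain g where g: "\<And>\<Omega>. biset C D \<Omega> \<Longrightarrow> linear_map R Q.M N (g \<Omega>)"
    "\<And>\<Omega> \<Psi>. \<lbrakk>biset C D \<Omega>; biset C' D' \<Psi>\<rbrakk> \<Longrightarrow> g \<Omega> (biset_class R C' D' \<Psi>) = b \<Omega> \<Psi>"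
    by metis
  have g_closed: "\<lbrakk>biset C D \<Omega>; y \<in> carrier Q.M\<rbrakk> \<Longrightarrow> g \<Omega> y \<in> carrier N" for \<Omega> y
    using g(1) by (auto simp: linear_map_def)
  \<comment> \<open>The hypotheses on the left variable are known for bisets only; they pass to an
    arbitrary \<open>y\<close> because both sides are linear in \<open>y\<close>.\<close>
  have "\<exists>h. linear_map R L.M N h \<and> (\<forall>\<Omega>. biset C D \<Omega> \<longrightarrow> h (biset_class R C D \<Omega>) = g \<Omega> y)"
    if y: "y \<in> carrier Q.M" for y
  proof (rule L.biset_module_universal[OF N])
    show "g \<Omega> y \<in> carrier N" if "biset C D \<Omega>" for \<Omega>
      using g_closed that y by blast
    show "g \<Omega> y = g \<Omega>' y" if "biset C D \<Omega>" "biset C D \<Omega>'" "biset_iso C D \<Omega> \<Omega>'" for \<Omega> \<Omega>'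
      by (rule Q.linear_map_eqI[OF N g(1) g(1) y]) (use that g(2) iso_left in auto)
    show "g (biset_sum \<Omega> \<Omega>') y = g \<Omega> y \<oplus>\<^bsub>N\<^esub> g \<Omega>' y" if O: "biset C D \<Omega>" "biset C D \<Omega>'" for \<Omega> \<Omega>'
    proof (rule Q.linear_map_eqI[OF N g(1) _ y])
      show "linear_map R Q.M N (\<lambda>y. g \<Omega> y \<oplus>\<^bsub>N\<^esub> g \<Omega>' y)"
        using g(1)[OF O(1)] g(1)[OF O(2)]
        unfolding linear_map_def by (simp add: N.smult_r_distr N.add.m_ac)
      show "biset C D (biset_sum \<Omega> \<Omega>')"
        using O by (rule set_functor_sum)
      show "g (biset_sum \<Omega> \<Omega>') (biset_class R C' D' \<Psi>) =
          g \<Omega> (biset_class R C' D' \<Psi>) \<oplus>\<^bsub>N\<^esub> g \<Omega>' (biset_class R C' D' \<Psi>)" if "biset C' D' \<Psi>" for \<Psi>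
        using g(2)[OF set_functor_sum[OF O] that] g(2)[OF O(1) that] g(2)[OF O(2) that] sum_left[OF O that]
        by simp
    qed
  qed
  then obtain m where m: "\<And>y. y \<in> carrier Q.M \<Longrightarrow> linear_map R L.M N (m y)"
    "\<And>y \<Omega>. \<lbrakk>y \<in> carrier Q.M; biset C D \<Omega>\<rbrakk> \<Longrightarrow> m y (biset_class R C D \<Omega>) = g \<Omega> y"
    by metis
  \<comment> \<open>As functions of \<open>x\<close> both sides are linear, so it suffices to
    compare them on classes of bisets, where \<open>m\<close> reduces to the linear map
    \<open>g\<close>.\<close>
  have add: "m (y \<oplus>\<^bsub>Q.M\<^esub> y') x = m y x \<oplus>\<^bsub>N\<^esub> m y' x"
    if y: "y \<in> carrier Q.M" "y' \<in> carrier Q.M" and x: "x \<in> carrier L.M" for x y y'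
  proof (rule L.linear_map_eqI[OF N m(1) _ x])
    show "linear_map R L.M N (\<lambda>x. m y x \<oplus>\<^bsub>N\<^esub> m y' x)"
      using m(1)[OF y(1)] m(1)[OF y(2)]
      unfolding linear_map_def by (simp add: N.smult_r_distr N.add.m_ac)
    show "m (y \<oplus>\<^bsub>Q.M\<^esub> y') (biset_class R C D \<Omega>) =
        m y (biset_class R C D \<Omega>) \<oplus>\<^bsub>N\<^esub> m y' (biset_class R C D \<Omega>)" if "biset C D \<Omega>" for \<Omega>
      using y that g(1)[OF that] m(2) by (simp add: linear_map_def)
  qed (use y in simp)
  have smult: "m (r \<odot>\<^bsub>Q.M\<^esub> y) x = r \<odot>\<^bsub>N\<^esub> m y x"
    if r: "r \<in> carrier R" and y: "y \<in> carrier Q.M" and x: "x \<in> carrier L.M" for r x y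
  proof (rule L.linear_map_eqI[OF N m(1) _ x])
    show "linear_map R L.M N (\<lambda>x. r \<odot>\<^bsub>N\<^esub> m y x)"
      using m(1)[OF y] r unfolding linear_map_def
      by (simp add: N.smult_r_distr N.smult_assoc1[symmetric] L.R.m_comm)
    show "m (r \<odot>\<^bsub>Q.M\<^esub> y) (biset_class R C D \<Omega>) = r \<odot>\<^bsub>N\<^esub> m y (biset_class R C D \<Omega>)"
      if "biset C D \<Omega>" for \<Omega>
      using y r that g(1)[OF that] m(2) by (simp add: linear_map_def)
  qed (use r y in simp)
  have "bilinear_map R L.M Q.M N (\<lambda>x y. m y x)"
    unfolding bilinear_map_def using m(1) add smult by (simp add: linear_map_def)
  then show ?thesis
    using m(2) g(2) Q.biset_class_closed by (intro exI[of _ "\<lambda>x y. m y x"]) simp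
qed

section \<open>Bisets\<close>

lemma op_cat_simps [simp]:
  "cobj (op_cat C) = cobj C" "carr (op_cat C) = carr C" "cdom (op_cat C) = ccod C" "ccod (op_cat C) = cdom C"
  "cid (op_cat C) = cid C" "ccomp (op_cat C) g f = ccomp C f g"
  by (simp_all add: op_cat_def)

lemma prod_cat_simps [simp]:
  "cobj (prod_cat C D) = elt_times (cobj C) (cobj D)" "carr (prod_cat C D) = elt_times (carr C) (carr D)"
  "cdom (prod_cat C D) (Pair f g) = Pair (cdom C f) (cdom D g)"
  "ccod (prod_cat C D) (Pair f g) = Pair (ccod C f) (ccod D g)"
  "cid (prod_cat C D) (Pair x y) = Pair (cid C x) (cid D y)"
  "ccomp (prod_cat C D) (Pair f g) (Pair f' g') = Pair (ccomp C f f') (ccomp D g g')"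
  by (simp_all add: prod_cat_def)

lemma unit_cat_simps [simp]:
  "cobj unit_cat = {pt}" "carr unit_cat = {pt}" "cdom unit_cat f = pt" "ccod unit_cat f = pt"
  "cid unit_cat x = pt" "ccomp unit_cat g f = pt"
  by (simp_all add: unit_cat_def)

lemmas finite_category_intros = finite_category_prod finite_category_op finite_category_unit

context finite_category
begin

lemma comp_id_right' [simp]: "\<lbrakk>f \<in> carr C; cdom C f = x\<rbrakk> \<Longrightarrow> ccomp C f (cid C x) = f"
  using comp_id_right by blast

lemma comp_id_left' [simp]: "\<lbrakk>f \<in> carr C; ccod C f = x\<rbrakk> \<Longrightarrow> ccomp C (cid C x) f = f"
  using comp_id_left by blast

lemmas [simp] = dom_closed cod_closed id_closed dom_id cod_id comp_closed dom_comp cod_comp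

end

locale biset_on = C: finite_category C + D: finite_category D
  for C :: "'u category" and D :: "'u category" and \<Omega> :: "'u setfun" +
  assumes biset: "biset C D \<Omega>"
begin

lemma finite_fob: "\<lbrakk>x \<in> cobj C; y \<in> cobj D\<rbrakk> \<Longrightarrow> finite (fob \<Omega> (Pair x y))"
  using biset unfolding set_functor_def by simp

lemma act_closed:
  "\<lbrakk>u \<in> fob \<Omega> (Pair x y); f \<in> carr C; g \<in> carr D; cdom C f = x; ccod D g = y; ccod C f = x'; cdom D g = y'\<rbrakk>
    \<Longrightarrow> farr \<Omega> (Pair f g) u \<in> fob \<Omega> (Pair x' y')"
  using biset unfolding set_functor_def by (auto simp: Pi_iff)

lemma act_id: "\<lbrakk>u \<in> fob \<Omega> (Pair x y); x \<in> cobj C; y \<in> cobj D\<rbrakk> \<Longrightarrow> farr \<Omega> (Pair (cid C x) (cid D y)) u = u"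
  using biset unfolding set_functor_def by simp

lemma act_act:
  "\<lbrakk>u \<in> fob \<Omega> (Pair x y); f \<in> carr C; g \<in> carr D; f' \<in> carr C; g' \<in> carr D; cdom C f = x; ccod D g = y;
    ccod C f = cdom C f'; ccod D g' = cdom D g\<rbrakk>
    \<Longrightarrow> farr \<Omega> (Pair f' g') (farr \<Omega> (Pair f g) u) = farr \<Omega> (Pair (ccomp C f' f) (ccomp D g g')) u"
  using biset unfolding set_functor_def by auto

end

lemma bisetI:
  assumes "\<And>x y. \<lbrakk>x \<in> cobj C; y \<in> cobj D\<rbrakk> \<Longrightarrow> finite (fob \<Omega> (Pair x y))"
    and "\<And>f g u. \<lbrakk>f \<in> carr C; g \<in> carr D; u \<in> fob \<Omega> (Pair (cdom C f) (ccod D g))\<rbrakk>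
      \<Longrightarrow> farr \<Omega> (Pair f g) u \<in> fob \<Omega> (Pair (ccod C f) (cdom D g))"
    and "\<And>x y u. \<lbrakk>x \<in> cobj C; y \<in> cobj D; u \<in> fob \<Omega> (Pair x y)\<rbrakk>
      \<Longrightarrow> farr \<Omega> (Pair (cid C x) (cid D y)) u = u"
    and "\<And>f g f' g' u. \<lbrakk>f \<in> carr C; g \<in> carr D; f' \<in> carr C; g' \<in> carr D; ccod C f = cdom C f';
      ccod D g' = cdom D g; u \<in> fob \<Omega> (Pair (cdom C f) (ccod D g))\<rbrakk>
      \<Longrightarrow> farr \<Omega> (Pair (ccomp C f' f) (ccomp D g g')) u = farr \<Omega> (Pair f' g') (farr \<Omega> (Pair f g) u)"
  shows "biset C D \<Omega>"
  unfolding set_functor_def using assms by auto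

lemma biset_isoI:
  assumes "\<And>x y. \<lbrakk>x \<in> cobj C; y \<in> cobj D\<rbrakk> \<Longrightarrow> bij_betw (\<eta> x y) (fob \<Omega> (Pair x y)) (fob \<Psi> (Pair x y))"
    and "\<And>f g u. \<lbrakk>f \<in> carr C; g \<in> carr D; u \<in> fob \<Omega> (Pair (cdom C f) (ccod D g))\<rbrakk>
      \<Longrightarrow> \<eta> (ccod C f) (cdom D g) (farr \<Omega> (Pair f g) u) = farr \<Psi> (Pair f g) (\<eta> (cdom C f) (ccod D g) u)"
  shows "biset_iso C D \<Omega> \<Psi>"
  unfolding functor_iso_def using assms by (intro exI[of _ "\<lambda>p. \<eta> (p1 p) (p2 p)"]) auto

lemma biset_iso_inverseI:
  assumes "\<And>x y u. \<lbrakk>x \<in> cobj C; y \<in> cobj D; u \<in> fob \<Omega> (Pair x y)\<rbrakk> \<Longrightarrow> \<eta> x y u \<in> fob \<Psi> (Pair x y) \<and> \<theta> x y (\<eta> x y u) = u"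
    and "\<And>x y u. \<lbrakk>x \<in> cobj C; y \<in> cobj D; u \<in> fob \<Psi> (Pair x y)\<rbrakk> \<Longrightarrow> \<theta> x y u \<in> fob \<Omega> (Pair x y) \<and> \<eta> x y (\<theta> x y u) = u"
    and "\<And>f g u. \<lbrakk>f \<in> carr C; g \<in> carr D; u \<in> fob \<Omega> (Pair (cdom C f) (ccod D g))\<rbrakk>
      \<Longrightarrow> \<eta> (ccod C f) (cdom D g) (farr \<Omega> (Pair f g) u) = farr \<Psi> (Pair f g) (\<eta> (cdom C f) (ccod D g) u)"
  shows "biset_iso C D \<Omega> \<Psi>"
proof (rule biset_isoI[where \<eta> = \<eta>])
  fix x y assume "x \<in> cobj C" "y \<in> cobj D"
  then show "bij_betw (\<eta> x y) (fob \<Omega> (Pair x y)) (fob \<Psi> (Pair x y))"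
    using assms(1,2) by (intro bij_betw_byWitness[where f' = "\<theta> x y"]) auto
qed (rule assms(3))

text \<open>An isomorphism of bisets together with its inverse. The endpoints in the naturality laws
  are variables tied by equations, so that these laws work as rewrite rules also when an endpoint of
  an arrow has already been simplified.\<close>

locale iso_pair =
  fixes C D :: "'u category" and \<Omega> \<Psi> :: "'u setfun" and \<eta> \<theta> :: "'u elt \<Rightarrow> 'u elt \<Rightarrow> 'u elt \<Rightarrow> 'u elt"
  assumes to_closed: "\<lbrakk>x \<in> cobj C; y \<in> cobj D; u \<in> fob \<Omega> (Pair x y)\<rbrakk> \<Longrightarrow> \<eta> x y u \<in> fob \<Psi> (Pair x y)"
    and from_to: "\<lbrakk>x \<in> cobj C; y \<in> cobj D; u \<in> fob \<Omega> (Pair x y)\<rbrakk> \<Longrightarrow> \<theta> x y (\<eta> x y u) = u"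
    and from_closed: "\<lbrakk>x \<in> cobj C; y \<in> cobj D; w \<in> fob \<Psi> (Pair x y)\<rbrakk> \<Longrightarrow> \<theta> x y w \<in> fob \<Omega> (Pair x y)"
    and to_from: "\<lbrakk>x \<in> cobj C; y \<in> cobj D; w \<in> fob \<Psi> (Pair x y)\<rbrakk> \<Longrightarrow> \<eta> x y (\<theta> x y w) = w"
    and to_natural: "\<lbrakk>u \<in> fob \<Omega> (Pair x y); f \<in> carr C; g \<in> carr D; cdom C f = x; ccod D g = y; ccod C f = x'; cdom D g = y'\<rbrakk>
      \<Longrightarrow> \<eta> x' y' (farr \<Omega> (Pair f g) u) = farr \<Psi> (Pair f g) (\<eta> x y u)"
    and from_natural: "\<lbrakk>w \<in> fob \<Psi> (Pair x y); f \<in> carr C; g \<in> carr D; cdom C f = x; ccod D g = y; ccod C f = x'; cdom D g = y'\<rbrakk>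
      \<Longrightarrow> \<theta> x' y' (farr \<Psi> (Pair f g) w) = farr \<Omega> (Pair f g) (\<theta> x y w)"
begin

lemmas facts = to_closed from_to from_closed to_from to_natural from_natural

end

lemma biset_isoE:
  assumes C: "finite_category C" and D: "finite_category D" and "biset C D \<Omega>" "biset_iso C D \<Omega> \<Psi>"
  obtains \<eta> \<theta> where "iso_pair C D \<Omega> \<Psi> \<eta> \<theta>"
proof -
  interpret biset_on C D \<Omega> using assms by (simp add: biset_on_def biset_on_axioms_def)
  obtain e where e: "\<forall>p\<in>cobj (prod_cat C (op_cat D)). bij_betw (e p) (fob \<Omega> p) (fob \<Psi> p)"
    "\<forall>f\<in>carr (prod_cat C (op_cat D)). \<forall>u\<in>fob \<Omega> (cdom (prod_cat C (op_cat D)) f).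
      e (ccod (prod_cat C (op_cat D)) f) (farr \<Omega> f u) = farr \<Psi> f (e (cdom (prod_cat C (op_cat D)) f) u)"
    using assms(4) unfolding functor_iso_def by blast
  define \<eta> where "\<eta> x y = e (Pair x y)" for x y
  define \<theta> where "\<theta> x y = the_inv_into (fob \<Omega> (Pair x y)) (\<eta> x y)" for x y
  have bij: "bij_betw (\<eta> x y) (fob \<Omega> (Pair x y)) (fob \<Psi> (Pair x y))" if "x \<in> cobj C" "y \<in> cobj D" for x y
    using e(1) that by (simp add: \<eta>_def)
  have nat: "\<eta> (ccod C f) (cdom D g) (farr \<Omega> (Pair f g) u) = farr \<Psi> (Pair f g) (\<eta> (cdom C f) (ccod D g) u)"
    if "u \<in> fob \<Omega> (Pair (cdom C f) (ccod D g))" "f \<in> carr C" "g \<in> carr D" for f g u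
    using e(2) that by (simp add: \<eta>_def)
  have 1: "\<eta> x y u \<in> fob \<Psi> (Pair x y)" "\<theta> x y (\<eta> x y u) = u"
    if "x \<in> cobj C" "y \<in> cobj D" "u \<in> fob \<Omega> (Pair x y)" for x y u
    using bij[OF that(1,2)] that(3) by (auto simp: bij_betw_def \<theta>_def the_inv_into_f_f)
  have 2: "\<theta> x y w \<in> fob \<Omega> (Pair x y)" "\<eta> x y (\<theta> x y w) = w"
    if "x \<in> cobj C" "y \<in> cobj D" "w \<in> fob \<Psi> (Pair x y)" for x y w
    using bij[OF that(1,2)] that(3)
    by (auto simp: bij_betw_def \<theta>_def f_the_inv_into_f intro: the_inv_into_into)
  have 3: "\<theta> (ccod C f) (cdom D g) (farr \<Psi> (Pair f g) w) = farr \<Omega> (Pair f g) (\<theta> (cdom C f) (ccod D g) w)"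
    if w: "w \<in> fob \<Psi> (Pair (cdom C f) (ccod D g))" and fg: "f \<in> carr C" "g \<in> carr D" for f g w
  proof -
    let ?u = "\<theta> (cdom C f) (ccod D g) w"
    have u: "?u \<in> fob \<Omega> (Pair (cdom C f) (ccod D g))" "\<eta> (cdom C f) (ccod D g) ?u = w"
      using 2 w fg by simp_all
    have "farr \<Omega> (Pair f g) ?u \<in> fob \<Omega> (Pair (ccod C f) (cdom D g))"
      using u fg by (blast intro: act_closed)
    then have "\<theta> (ccod C f) (cdom D g) (\<eta> (ccod C f) (cdom D g) (farr \<Omega> (Pair f g) ?u)) = farr \<Omega> (Pair f g) ?u"
      using fg by (simp add: 1)
    then show ?thesis using nat[OF u(1) fg] u(2) by simp
  qed
  show thesis
    by (rule that[of \<eta> \<theta>], unfold_locales) (use 1 2 3 nat in \<open>blast+\<close>)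
qed


section \<open>Composition of bisets\<close>

text \<open>The element of the composite represented by a triple (y, u, v), in the encoding used by
  \<open>biset_comp\<close>.\<close>

definition comp_class :: "'u category \<Rightarrow> 'u category \<Rightarrow> 'u category \<Rightarrow> 'u setfun \<Rightarrow> 'u setfun \<Rightarrow>
    'u elt \<Rightarrow> 'u elt \<Rightarrow> 'u elt \<Rightarrow> 'u elt \<Rightarrow> 'u elt \<Rightarrow> 'u elt" where
  "comp_class C D E \<Omega> \<Psi> x z y u v = encode (slide_equiv C D E \<Omega> \<Psi> x z `` {Pair y (Pair u v)})"

text \<open>A function on triples is evaluated at an arbitrarily chosen representative of a class;
  this is the induced map on the quotient whenever the function is constant on classes.\<close>

definition comp_lift :: "('u elt \<Rightarrow> 'u elt \<Rightarrow> 'u elt \<Rightarrow> 'u elt) \<Rightarrow> 'u elt \<Rightarrow> 'u elt" where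
  "comp_lift \<phi> c = (let s = SOME s. s \<in> decode c in \<phi> (p1 s) (p1 (p2 s)) (p2 (p2 s)))"

lemma decode_encode: "finite A \<Longrightarrow> decode (encode A) = A"
  unfolding decode_def encode_def by (simp add: Abs_fset_inverse)

locale biset_pair = A: biset_on C D \<Omega> + B: biset_on D E \<Psi>
  for C :: "'u category" and D :: "'u category" and E :: "'u category" and \<Omega> :: "'u setfun" and \<Psi> :: "'u setfun"
begin

abbreviation "cls \<equiv> comp_class C D E \<Omega> \<Psi>"
abbreviation "cmp \<equiv> biset_comp C D E \<Omega> \<Psi>"
abbreviation "sl \<equiv> slide C D E \<Omega> \<Psi>"

lemma total_set_iff:
  "Pair y (Pair u v) \<in> total_set D \<Omega> \<Psi> x z \<longleftrightarrow> y \<in> cobj D \<and> u \<in> fob \<Omega> (Pair x y) \<and> v \<in> fob \<Psi> (Pair y z)"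
  unfolding total_set_def by auto

lemma total_setE:
  assumes "s \<in> total_set D \<Omega> \<Psi> x z"
  obtains y u v where "s = Pair y (Pair u v)" "y \<in> cobj D" "u \<in> fob \<Omega> (Pair x y)" "v \<in> fob \<Psi> (Pair y z)"
  using assms unfolding total_set_def by blast

lemma finite_total_set:
  assumes "x \<in> cobj C" "z \<in> cobj E"
  shows "finite (total_set D \<Omega> \<Psi> x z)"
proof -
  have "total_set D \<Omega> \<Psi> x z \<subseteq> (\<Union>y\<in>cobj D. elt_times {y} (elt_times (fob \<Omega> (Pair x y)) (fob \<Psi> (Pair y z))))"
    by (auto elim!: total_setE)
  then show ?thesis
    by (rule finite_subset)
      (use assms in \<open>auto intro!: finite_elt_times A.finite_fob B.finite_fob A.D.finite_objects\<close>)
qed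

lemma slide_total:
  assumes "sl x z s t" "x \<in> cobj C" "z \<in> cobj E"
  shows "s \<in> total_set D \<Omega> \<Psi> x z \<and> t \<in> total_set D \<Omega> \<Psi> x z"
  using assms(1)
proof cases
  case (1 \<beta> u v)
  then show ?thesis
    using assms(2,3) by (auto simp: total_set_iff intro: A.act_closed B.act_closed)
qed

text \<open>The generated equivalence lives on the whole type, where it relates every element to
  itself. Starting from a genuine triple it never leaves the set of triples.\<close>

lemma equivclp_slide_total:
  assumes "equivclp (sl x z) s t" "x \<in> cobj C" "z \<in> cobj E" "s \<in> total_set D \<Omega> \<Psi> x z"
  shows "t \<in> total_set D \<Omega> \<Psi> x z"
  using assms(1) by (induction rule: equivclp_induct) (use assms slide_total in blast)+

lemma class_subset:
  assumes "x \<in> cobj C" "z \<in> cobj E" "s \<in> total_set D \<Omega> \<Psi> x z"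
  shows "slide_equiv C D E \<Omega> \<Psi> x z `` {s} \<subseteq> total_set D \<Omega> \<Psi> x z"
  using equivclp_slide_total[OF _ assms] by (auto simp: slide_equiv_def)

text \<open>Encoding a set as an element is faithful for finite sets, and a class is finite because
  it is contained in the finite set of triples.\<close>

lemma decode_cls:
  assumes "x \<in> cobj C" "z \<in> cobj E" "y \<in> cobj D" "u \<in> fob \<Omega> (Pair x y)" "v \<in> fob \<Psi> (Pair y z)"
  shows "decode (cls x z y u v) = {t. equivclp (sl x z) (Pair y (Pair u v)) t}"
proof -
  have "finite (slide_equiv C D E \<Omega> \<Psi> x z `` {Pair y (Pair u v)})"
    using class_subset finite_total_set assms by (meson finite_subset total_set_iff)
  then show ?thesis
    unfolding comp_class_def by (simp add: decode_encode) (auto simp: slide_equiv_def)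
qed

lemma cls_closed:
  assumes "u \<in> fob \<Omega> (Pair x y)" "v \<in> fob \<Psi> (Pair y z)" "y \<in> cobj D"
  shows "cls x z y u v \<in> fob cmp (Pair x z)"
  using assms by (auto simp: biset_comp_def comp_class_def total_set_iff intro!: imageI quotientI)

lemma compE:
  assumes "c \<in> fob cmp (Pair x z)"
  obtains y u v where "c = cls x z y u v" "y \<in> cobj D" "u \<in> fob \<Omega> (Pair x y)" "v \<in> fob \<Psi> (Pair y z)"
  using assms by (auto simp: biset_comp_def comp_class_def quotient_def elim!: total_setE)

lemma equivclp_cls_eq:
  assumes "equivclp (sl x z) (Pair y (Pair u v)) (Pair y' (Pair u' v'))"
  shows "cls x z y u v = cls x z y' u' v'"
proof -
  have "slide_equiv C D E \<Omega> \<Psi> x z `` {Pair y (Pair u v)} = slide_equiv C D E \<Omega> \<Psi> x z `` {Pair y' (Pair u' v')}"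
    using assms by (auto simp: slide_equiv_def intro: equivclp_trans equivclp_sym)
  then show ?thesis by (simp add: comp_class_def)
qed

text \<open>The defining relation in its working form: an arrow of \<open>D\<close> acting on the
  left factor may be moved to the right factor. All computations in composites go through
  it.\<close>

lemma cls_slide:
  assumes "u \<in> fob \<Omega> (Pair x y')" "v \<in> fob \<Psi> (Pair y z)" "\<beta> \<in> carr D" "cdom D \<beta> = y" "ccod D \<beta> = y'"
  shows "cls x z y (farr \<Omega> (Pair (cid C x) \<beta>) u) v = cls x z y' u (farr \<Psi> (Pair \<beta> (cid E z)) v)"
proof -
  have "sl x z (Pair y (Pair (farr \<Omega> (Pair (cid C x) \<beta>) u) v)) (Pair y' (Pair u (farr \<Psi> (Pair \<beta> (cid E z)) v)))"
    using slide.intros[of \<beta> D u \<Omega> x v \<Psi> z C E] assms by simp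
  then show ?thesis by (intro equivclp_cls_eq r_into_equivclp)
qed

definition invariant :: "'u elt \<Rightarrow> 'u elt \<Rightarrow> ('u elt \<Rightarrow> 'u elt \<Rightarrow> 'u elt \<Rightarrow> 'u elt) \<Rightarrow> bool" where
  "invariant x z \<phi> \<longleftrightarrow> (\<forall>\<beta>\<in>carr D. \<forall>u\<in>fob \<Omega> (Pair x (ccod D \<beta>)). \<forall>v\<in>fob \<Psi> (Pair (cdom D \<beta>) z).
    \<phi> (cdom D \<beta>) (farr \<Omega> (Pair (cid C x) \<beta>) u) v = \<phi> (ccod D \<beta>) u (farr \<Psi> (Pair \<beta> (cid E z)) v))"

lemma invariantI:
  "(\<And>\<beta> u v. \<lbrakk>\<beta> \<in> carr D; u \<in> fob \<Omega> (Pair x (ccod D \<beta>)); v \<in> fob \<Psi> (Pair (cdom D \<beta>) z)\<rbrakk> \<Longrightarrow>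
    \<phi> (cdom D \<beta>) (farr \<Omega> (Pair (cid C x) \<beta>) u) v = \<phi> (ccod D \<beta>) u (farr \<Psi> (Pair \<beta> (cid E z)) v)) \<Longrightarrow> invariant x z \<phi>"
  unfolding invariant_def by blast

text \<open>Invariance is tested on single slides; induction over the generated equivalence makes
  the function constant on the class, so the chosen representative does not matter.\<close>

lemma lift_cls:
  assumes "x \<in> cobj C" "z \<in> cobj E" "y \<in> cobj D" "u \<in> fob \<Omega> (Pair x y)" "v \<in> fob \<Psi> (Pair y z)"
    and inv: "invariant x z \<phi>"
  shows "comp_lift \<phi> (cls x z y u v) = \<phi> y u v"
proof -
  let ?f = "\<lambda>s. \<phi> (p1 s) (p1 (p2 s)) (p2 (p2 s))"
  have step: "?f s = ?f t" if "sl x z s t" for s t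
    using that by cases (use inv in \<open>auto simp: invariant_def\<close>)
  have eq: "?f s = ?f t" if "equivclp (sl x z) s t" for s t
    using that by (induction rule: equivclp_induct) (use step in metis)+
  have "Pair y (Pair u v) \<in> decode (cls x z y u v)"
    using assms by (simp add: decode_cls)
  then have "(SOME s. s \<in> decode (cls x z y u v)) \<in> decode (cls x z y u v)" by (rule someI)
  then have "equivclp (sl x z) (Pair y (Pair u v)) (SOME s. s \<in> decode (cls x z y u v))"
    by (simp add: decode_cls[OF assms(1-5)])
  from eq[OF this] show ?thesis unfolding comp_lift_def Let_def by simp
qed

text \<open>The action is defined by saturating the image of a whole class. The map
  \<open>?h\<close> on triples sends slides to slides, hence equivalent triples to equivalent ones,
  and the saturation is the class of the image of any single representative.\<close>

lemma act_cls:
  assumes u: "u \<in> fob \<Omega> (Pair x y)" and v: "v \<in> fob \<Psi> (Pair y z)" and y: "y \<in> cobj D"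
    and f: "f \<in> carr C" "cdom C f = x" "ccod C f = x'" and g: "g \<in> carr E" "ccod E g = z" "cdom E g = z'"
  shows "farr cmp (Pair f g) (cls x z y u v) =
    cls x' z' y (farr \<Omega> (Pair f (cid D y)) u) (farr \<Psi> (Pair (cid D y) g) v)"
proof -
  let ?h = "\<lambda>s. Pair (p1 s) (Pair (farr \<Omega> (Pair f (cid D (p1 s))) (p1 (p2 s)))
    (farr \<Psi> (Pair (cid D (p1 s)) g) (p2 (p2 s))))"
  have xz: "x \<in> cobj C" "z \<in> cobj E" using f g by auto
  have step: "sl x' z' (?h s) (?h t)" if "sl x z s t" for s t
    using that
  proof cases
    case (1 \<beta> a b)
    have a: "farr \<Omega> (Pair f (cid D (ccod D \<beta>))) a \<in> fob \<Omega> (Pair x' (ccod D \<beta>))"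
      using 1 f by (auto intro!: A.act_closed)
    have b: "farr \<Psi> (Pair (cid D (cdom D \<beta>)) g) b \<in> fob \<Psi> (Pair (cdom D \<beta>) z')"
      using 1 g by (auto intro!: B.act_closed)
    \<comment> \<open>The arrow \<open>f\<close> acts in the left variable and \<beta> in the right
      one, so the two actions commute: both orders amount to the action of the pair.\<close>
    have "farr \<Omega> (Pair f (cid D (cdom D \<beta>))) (farr \<Omega> (Pair (cid C x) \<beta>) a) =
        farr \<Omega> (Pair (cid C x') \<beta>) (farr \<Omega> (Pair f (cid D (ccod D \<beta>))) a)"
      using 1 f by (auto simp: A.act_act)
    moreover have "farr \<Psi> (Pair (cid D (ccod D \<beta>)) g) (farr \<Psi> (Pair \<beta> (cid E z)) b) =
        farr \<Psi> (Pair \<beta> (cid E z')) (farr \<Psi> (Pair (cid D (cdom D \<beta>)) g) b)"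
      using 1 g by (auto simp: B.act_act)
    ultimately show ?thesis
      using slide.intros[OF 1(3) a b, of C E] 1 by simp
  qed
  have eq: "equivclp (sl x' z') (?h s) (?h t)" if "equivclp (sl x z) s t" for s t
    using that
  proof (induction rule: equivclp_induct)
    case (step t t')
    then show ?case using \<open>\<And>s t. sl x z s t \<Longrightarrow> sl x' z' (?h s) (?h t)\<close>
      by (meson equivclp_into_equivclp)
  qed simp
  let ?s = "Pair y (Pair u v)"
  have dec: "decode (cls x z y u v) = {t. equivclp (sl x z) ?s t}"
    using decode_cls xz u v y by simp
  have "slide_equiv C D E \<Omega> \<Psi> x' z' `` {Pair y' (Pair (farr \<Omega> (Pair f (cid D y')) u') (farr \<Psi> (Pair (cid D y') g) v')) |y' u' v'.
      Pair y' (Pair u' v') \<in> decode (cls x z y u v)} = slide_equiv C D E \<Omega> \<Psi> x' z' `` {?h ?s}" (is "?L = ?R")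
  proof
    show "?R \<subseteq> ?L"
      by (rule Image_mono[OF subset_refl])
        (simp add: dec, metis equivclp_refl)
    show "?L \<subseteq> ?R"
    proof
      fix w assume "w \<in> ?L"
      then obtain y' u' v' where t: "equivclp (sl x z) ?s (Pair y' (Pair u' v'))"
        "equivclp (sl x' z') (?h (Pair y' (Pair u' v'))) w"
        by (auto simp: dec slide_equiv_def)
      show "w \<in> ?R"
        using equivclp_trans[OF eq[OF t(1)] t(2)] by (simp add: slide_equiv_def)
    qed
  qed
  then show ?thesis
    using f g by (simp add: biset_comp_def comp_class_def)
qed

lemma biset_comp_closed: "biset C E cmp"
proof (rule bisetI)
  fix x z assume "x \<in> cobj C" "z \<in> cobj E"
  then have "total_set D \<Omega> \<Psi> x z // slide_equiv C D E \<Omega> \<Psi> x z \<subseteq> Pow (total_set D \<Omega> \<Psi> x z)"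
    using class_subset by (auto simp: quotient_def)
  then show "finite (fob cmp (Pair x z))"
    using finite_total_set[OF \<open>x \<in> cobj C\<close> \<open>z \<in> cobj E\<close>]
    by (simp add: biset_comp_def finite_subset)
next
  fix f g c assume fg: "f \<in> carr C" "g \<in> carr E" "c \<in> fob cmp (Pair (cdom C f) (ccod E g))"
  then show "farr cmp (Pair f g) c \<in> fob cmp (Pair (ccod C f) (cdom E g))"
    by (elim compE) (auto simp: act_cls intro!: cls_closed A.act_closed B.act_closed)
next
  fix x z c assume "x \<in> cobj C" "z \<in> cobj E" "c \<in> fob cmp (Pair x z)"
  then show "farr cmp (Pair (cid C x) (cid E z)) c = c"
    by (elim compE) (simp add: act_cls A.act_id B.act_id)
next
  fix f g f' g' c assume fg: "f \<in> carr C" "g \<in> carr E" "f' \<in> carr C" "g' \<in> carr E" "ccod C f = cdom C f'"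
    "ccod E g' = cdom E g" and c: "c \<in> fob cmp (Pair (cdom C f) (ccod E g))"
  from c obtain y u v where y: "c = cls (cdom C f) (ccod E g) y u v" "y \<in> cobj D"
    "u \<in> fob \<Omega> (Pair (cdom C f) y)" "v \<in> fob \<Psi> (Pair y (ccod E g))" by (rule compE)
  have "farr \<Omega> (Pair f (cid D y)) u \<in> fob \<Omega> (Pair (ccod C f) y)" "farr \<Psi> (Pair (cid D y) g) v \<in> fob \<Psi> (Pair y (cdom E g))"
    using fg y by (auto intro!: A.act_closed B.act_closed)
  then show "farr cmp (Pair (ccomp C f' f) (ccomp E g g')) c = farr cmp (Pair f' g') (farr cmp (Pair f g) c)"
    using fg y by (simp add: act_cls A.act_act B.act_act)
qed

lemma comp_isoI:
  assumes closed: "\<And>x z y u v. \<lbrakk>x \<in> cobj C; z \<in> cobj E; y \<in> cobj D; u \<in> fob \<Omega> (Pair x y); v \<in> fob \<Psi> (Pair y z)\<rbrakk>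
      \<Longrightarrow> \<phi> x z y u v \<in> fob \<Theta> (Pair x z)"
    and inv: "\<And>x z \<beta> u v. \<lbrakk>x \<in> cobj C; z \<in> cobj E; \<beta> \<in> carr D; u \<in> fob \<Omega> (Pair x (ccod D \<beta>)); v \<in> fob \<Psi> (Pair (cdom D \<beta>) z)\<rbrakk>
      \<Longrightarrow> \<phi> x z (cdom D \<beta>) (farr \<Omega> (Pair (cid C x) \<beta>) u) v = \<phi> x z (ccod D \<beta>) u (farr \<Psi> (Pair \<beta> (cid E z)) v)"
    and nat: "\<And>f g y u v. \<lbrakk>f \<in> carr C; g \<in> carr E; y \<in> cobj D; u \<in> fob \<Omega> (Pair (cdom C f) y); v \<in> fob \<Psi> (Pair y (ccod E g))\<rbrakk>
      \<Longrightarrow> \<phi> (ccod C f) (cdom E g) y (farr \<Omega> (Pair f (cid D y)) u) (farr \<Psi> (Pair (cid D y) g) v) =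
        farr \<Theta> (Pair f g) (\<phi> (cdom C f) (ccod E g) y u v)"
    and left: "\<And>x z y u v. \<lbrakk>x \<in> cobj C; z \<in> cobj E; y \<in> cobj D; u \<in> fob \<Omega> (Pair x y); v \<in> fob \<Psi> (Pair y z)\<rbrakk>
      \<Longrightarrow> \<psi> x z (\<phi> x z y u v) = cls x z y u v"
    and right: "\<And>x z w. \<lbrakk>x \<in> cobj C; z \<in> cobj E; w \<in> fob \<Theta> (Pair x z)\<rbrakk>
      \<Longrightarrow> \<exists>y\<in>cobj D. \<exists>u\<in>fob \<Omega> (Pair x y). \<exists>v\<in>fob \<Psi> (Pair y z). \<psi> x z w = cls x z y u v \<and> \<phi> x z y u v = w"
  shows "biset_iso C E cmp \<Theta>"
proof (rule biset_iso_inverseI[where \<eta> = "\<lambda>x z. comp_lift (\<phi> x z)" and \<theta> = \<psi>])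
  have I: "invariant x z (\<phi> x z)" if "x \<in> cobj C" "z \<in> cobj E" for x z
    by (rule invariantI) (use inv that in blast)
  have lift: "comp_lift (\<phi> x z) (cls x z y u v) = \<phi> x z y u v"
    if "x \<in> cobj C" "z \<in> cobj E" "y \<in> cobj D" "u \<in> fob \<Omega> (Pair x y)" "v \<in> fob \<Psi> (Pair y z)" for x z y u v
    using lift_cls[OF that I[OF that(1,2)]] .
  show "comp_lift (\<phi> x z) c \<in> fob \<Theta> (Pair x z) \<and> \<psi> x z (comp_lift (\<phi> x z) c) = c"
    if "x \<in> cobj C" "z \<in> cobj E" "c \<in> fob cmp (Pair x z)" for x z c
    using that by (elim compE) (simp add: lift closed left)
  show "\<psi> x z w \<in> fob cmp (Pair x z) \<and> comp_lift (\<phi> x z) (\<psi> x z w) = w"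
    if "x \<in> cobj C" "z \<in> cobj E" "w \<in> fob \<Theta> (Pair x z)" for x z w
    using right[OF that] that by (auto simp: lift cls_closed)
  show "comp_lift (\<phi> (ccod C f) (cdom E g)) (farr cmp (Pair f g) c) =
      farr \<Theta> (Pair f g) (comp_lift (\<phi> (cdom C f) (ccod E g)) c)"
    if fg: "f \<in> carr C" "g \<in> carr E" and c: "c \<in> fob cmp (Pair (cdom C f) (ccod E g))" for f g c
  proof -
    from c obtain y u v where y: "c = cls (cdom C f) (ccod E g) y u v" "y \<in> cobj D"
      "u \<in> fob \<Omega> (Pair (cdom C f) y)" "v \<in> fob \<Psi> (Pair y (ccod E g))" by (rule compE)
    have "farr \<Omega> (Pair f (cid D y)) u \<in> fob \<Omega> (Pair (ccod C f) y)" "farr \<Psi> (Pair (cid D y) g) v \<in> fob \<Psi> (Pair y (cdom E g))"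
      using fg y by (auto intro!: A.act_closed B.act_closed)
    then show ?thesis using fg y nat by (simp add: act_cls lift)
  qed
qed

end

lemma biset_onI: "\<lbrakk>finite_category C; finite_category D; biset C D \<Omega>\<rbrakk> \<Longrightarrow> biset_on C D \<Omega>"
  by (simp add: biset_on_def biset_on_axioms_def)

lemma biset_comp_biset:
  assumes "finite_category C" "finite_category D" "finite_category E" "biset C D \<Omega>" "biset D E \<Psi>"
  shows "biset C E (biset_comp C D E \<Omega> \<Psi>)"
  using biset_pair.biset_comp_closed[OF biset_pair.intro[OF biset_onI biset_onI]] assms by blast

text \<open>Triples are transported componentwise. Slides are respected by naturality of the two
  isomorphisms, and the inverse map by naturality of their inverses.\<close>

lemma biset_comp_cong:
  assumes cats: "finite_category C" "finite_category D" "finite_category E"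
    and bisets: "biset C D \<Omega>" "biset D E \<Psi>" "biset C D \<Omega>'" "biset D E \<Psi>'"
    and iso: "biset_iso C D \<Omega> \<Omega>'" "biset_iso D E \<Psi> \<Psi>'"
  shows "biset_iso C E (biset_comp C D E \<Omega> \<Psi>) (biset_comp C D E \<Omega>' \<Psi>')"
proof -
  interpret P: biset_pair C D E \<Omega> \<Psi>
    using assms by (intro biset_pair.intro biset_onI)
  interpret Q: biset_pair C D E \<Omega>' \<Psi>'
    using assms by (intro biset_pair.intro biset_onI)
  obtain a a' where "iso_pair C D \<Omega> \<Omega>' a a'"
    by (rule biset_isoE[OF cats(1,2) bisets(1) iso(1)])
  then interpret a: iso_pair C D \<Omega> \<Omega>' a a' .
  obtain b b' where "iso_pair D E \<Psi> \<Psi>' b b'"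
    by (rule biset_isoE[OF cats(2,3) bisets(2) iso(2)])
  then interpret b: iso_pair D E \<Psi> \<Psi>' b b' .
  define \<phi> where "\<phi> x z y u v = Q.cls x z y (a x y u) (b y z v)" for x z y u v
  define \<chi> where "\<chi> x z y u v = P.cls x z y (a' x y u) (b' y z v)" for x z y u v
  have I: "Q.invariant x z (\<chi> x z)" if "x \<in> cobj C" "z \<in> cobj E" for x z
  proof (rule Q.invariantI)
    fix \<beta> u v assume h: "\<beta> \<in> carr D" "u \<in> fob \<Omega>' (Pair x (ccod D \<beta>))" "v \<in> fob \<Psi>' (Pair (cdom D \<beta>) z)"
    then show "\<chi> x z (cdom D \<beta>) (farr \<Omega>' (Pair (cid C x) \<beta>) u) v = \<chi> x z (ccod D \<beta>) u (farr \<Psi>' (Pair \<beta> (cid E z)) v)"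
      using that by (simp add: \<chi>_def a.facts b.facts P.cls_slide)
  qed
  have lift: "comp_lift (\<chi> x z) (Q.cls x z y u v) = \<chi> x z y u v"
    if "x \<in> cobj C" "z \<in> cobj E" "y \<in> cobj D" "u \<in> fob \<Omega>' (Pair x y)" "v \<in> fob \<Psi>' (Pair y z)" for x z y u v
    using Q.lift_cls[OF that I[OF that(1,2)]] .
  show ?thesis
  proof (rule P.comp_isoI[where \<phi> = \<phi> and \<psi> = "\<lambda>x z. comp_lift (\<chi> x z)"])
    fix x z w assume h: "x \<in> cobj C" "z \<in> cobj E" "w \<in> fob Q.cmp (Pair x z)"
    from h(3) obtain y u v where w: "w = Q.cls x z y u v" "y \<in> cobj D" "u \<in> fob \<Omega>' (Pair x y)" "v \<in> fob \<Psi>' (Pair y z)"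
      by (rule Q.compE)
    with h show "\<exists>y\<in>cobj D. \<exists>u\<in>fob \<Omega> (Pair x y). \<exists>v\<in>fob \<Psi> (Pair y z).
        comp_lift (\<chi> x z) w = P.cls x z y u v \<and> \<phi> x z y u v = w"
      by (intro bexI[of _ y] bexI[of _ "a' x y u"] bexI[of _ "b' y z v"]) (simp_all add: lift \<chi>_def \<phi>_def a.facts b.facts)
  qed (simp_all add: \<phi>_def a.facts b.facts Q.cls_closed Q.cls_slide Q.act_cls lift \<chi>_def)
qed

section \<open>Composition distributes over disjoint unions and is associative\<close>

lemma biset_sum_simps:
  "fob (biset_sum F G) p = Pair pt ` fob F p \<union> Pair (Coll {|pt|}) ` fob G p"
  "farr (biset_sum F G) a (Pair pt u) = Pair pt (farr F a u)"
  "farr (biset_sum F G) a (Pair (Coll {|pt|}) v) = Pair (Coll {|pt|}) (farr G a v)"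
  by (simp_all add: biset_sum_def pt_def)

text \<open>The two tags that keep the summands of \<open>biset_sum\<close> apart are
  different.\<close>

lemma pt_neq [simp]: "pt \<noteq> Coll {|pt|}" "Coll {|pt|} \<noteq> pt"
  unfolding pt_def using finsert_not_fempty[of "Coll {||}" "{||}"] by auto

text \<open>Sliding acts inside one summand, so the tag of the left entry is constant on classes.
  The map \<phi> moves this tag to the outside, and \<open>\<chi> i\<close> puts the tag
  \<open>i\<close> back onto the left entry of a triple.\<close>

lemma biset_comp_sum_left:
  assumes cats: "finite_category C" "finite_category D" "finite_category E"
    and bisets: "biset C D \<Omega>" "biset C D \<Omega>'" "biset D E \<Psi>"
  shows "biset_iso C E (biset_comp C D E (biset_sum \<Omega> \<Omega>') \<Psi>) (biset_sum (biset_comp C D E \<Omega> \<Psi>) (biset_comp C D E \<Omega>' \<Psi>))"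
proof -
  interpret S: biset_pair C D E "biset_sum \<Omega> \<Omega>'" \<Psi>
    using assms by (intro biset_pair.intro biset_onI set_functor_sum)
  interpret P: biset_pair C D E \<Omega> \<Psi>
    using assms by (intro biset_pair.intro biset_onI)
  interpret Q: biset_pair C D E \<Omega>' \<Psi>
    using assms by (intro biset_pair.intro biset_onI)
  define \<phi> where "\<phi> x z y w v = (if p1 w = pt then Pair pt (P.cls x z y (p2 w) v)
    else Pair (Coll {|pt|}) (Q.cls x z y (p2 w) v))" for x z y w v
  define \<chi> where "\<chi> i x z y u v = S.cls x z y (Pair i u) v" for i x z y u v
  define \<psi> where "\<psi> x z w = comp_lift (\<chi> (p1 w) x z) (p2 w)" for x z w
  have I: "P.invariant x z (\<chi> pt x z)" "Q.invariant x z (\<chi> (Coll {|pt|}) x z)" if "x \<in> cobj C" "z \<in> cobj E" for x z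
  proof -
    show "P.invariant x z (\<chi> pt x z)"
    proof (rule P.invariantI)
      fix \<beta> u v assume "\<beta> \<in> carr D" "u \<in> fob \<Omega> (Pair x (ccod D \<beta>))" "v \<in> fob \<Psi> (Pair (cdom D \<beta>) z)"
      then show "\<chi> pt x z (cdom D \<beta>) (farr \<Omega> (Pair (cid C x) \<beta>) u) v =
          \<chi> pt x z (ccod D \<beta>) u (farr \<Psi> (Pair \<beta> (cid E z)) v)"
        using S.cls_slide[of "Pair pt u" x "ccod D \<beta>" v "cdom D \<beta>" z \<beta>]
        by (auto simp: \<chi>_def biset_sum_simps)
    qed
    show "Q.invariant x z (\<chi> (Coll {|pt|}) x z)"
    proof (rule Q.invariantI)
      fix \<beta> u v assume "\<beta> \<in> carr D" "u \<in> fob \<Omega>' (Pair x (ccod D \<beta>))" "v \<in> fob \<Psi> (Pair (cdom D \<beta>) z)"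
      then show "\<chi> (Coll {|pt|}) x z (cdom D \<beta>) (farr \<Omega>' (Pair (cid C x) \<beta>) u) v =
          \<chi> (Coll {|pt|}) x z (ccod D \<beta>) u (farr \<Psi> (Pair \<beta> (cid E z)) v)"
        using S.cls_slide[of "Pair (Coll {|pt|}) u" x "ccod D \<beta>" v "cdom D \<beta>" z \<beta>]
        by (auto simp: \<chi>_def biset_sum_simps)
    qed
  qed
  have lift: "comp_lift (\<chi> pt x z) (P.cls x z y u v) = \<chi> pt x z y u v"
    if "x \<in> cobj C" "z \<in> cobj E" "y \<in> cobj D" "u \<in> fob \<Omega> (Pair x y)" "v \<in> fob \<Psi> (Pair y z)" for x z y u v
    using P.lift_cls[OF that I(1)[OF that(1,2)]] .
  have lift': "comp_lift (\<chi> (Coll {|pt|}) x z) (Q.cls x z y u v) = \<chi> (Coll {|pt|}) x z y u v"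
    if "x \<in> cobj C" "z \<in> cobj E" "y \<in> cobj D" "u \<in> fob \<Omega>' (Pair x y)" "v \<in> fob \<Psi> (Pair y z)" for x z y u v
    using Q.lift_cls[OF that I(2)[OF that(1,2)]] .
  show ?thesis
  proof (rule S.comp_isoI[where \<phi> = \<phi> and \<psi> = \<psi>])
    fix x z w assume h: "x \<in> cobj C" "z \<in> cobj E" "w \<in> fob (biset_sum P.cmp Q.cmp) (Pair x z)"
    then consider c where "w = Pair pt c" "c \<in> fob P.cmp (Pair x z)"
      | c where "w = Pair (Coll {|pt|}) c" "c \<in> fob Q.cmp (Pair x z)"
      by (auto simp: biset_sum_simps)
    then show "\<exists>y\<in>cobj D. \<exists>u\<in>fob (biset_sum \<Omega> \<Omega>') (Pair x y). \<exists>v\<in>fob \<Psi> (Pair y z).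
        \<psi> x z w = S.cls x z y u v \<and> \<phi> x z y u v = w"
    proof cases
      case 1
      from 1(2) obtain y u v where "c = P.cls x z y u v" "y \<in> cobj D" "u \<in> fob \<Omega> (Pair x y)" "v \<in> fob \<Psi> (Pair y z)"
        by (rule P.compE)
      with 1 h show ?thesis
        by (intro bexI[of _ y] bexI[of _ "Pair pt u"] bexI[of _ v]) (auto simp: \<psi>_def \<phi>_def \<chi>_def lift biset_sum_simps)
    next
      case 2
      from 2(2) obtain y u v where "c = Q.cls x z y u v" "y \<in> cobj D" "u \<in> fob \<Omega>' (Pair x y)" "v \<in> fob \<Psi> (Pair y z)"
        by (rule Q.compE)
      with 2 h show ?thesis
        by (intro bexI[of _ y] bexI[of _ "Pair (Coll {|pt|}) u"] bexI[of _ v]) (auto simp: \<psi>_def \<phi>_def \<chi>_def lift' biset_sum_simps)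
    qed
  qed (auto simp: biset_sum_simps \<phi>_def \<psi>_def \<chi>_def lift lift' P.cls_closed Q.cls_closed P.cls_slide Q.cls_slide P.act_cls Q.act_cls)
qed

lemma biset_comp_sum_right:
  assumes cats: "finite_category C" "finite_category D" "finite_category E"
    and bisets: "biset C D \<Omega>" "biset D E \<Psi>" "biset D E \<Psi>'"
  shows "biset_iso C E (biset_comp C D E \<Omega> (biset_sum \<Psi> \<Psi>')) (biset_sum (biset_comp C D E \<Omega> \<Psi>) (biset_comp C D E \<Omega> \<Psi>'))"
proof -
  interpret S: biset_pair C D E \<Omega> "biset_sum \<Psi> \<Psi>'"
    using assms by (intro biset_pair.intro biset_onI set_functor_sum)
  interpret P: biset_pair C D E \<Omega> \<Psi>
    using assms by (intro biset_pair.intro biset_onI)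
  interpret Q: biset_pair C D E \<Omega> \<Psi>'
    using assms by (intro biset_pair.intro biset_onI)
  define \<phi> where "\<phi> x z y u w = (if p1 w = pt then Pair pt (P.cls x z y u (p2 w))
    else Pair (Coll {|pt|}) (Q.cls x z y u (p2 w)))" for x z y w u
  define \<chi> where "\<chi> i x z y u v = S.cls x z y u (Pair i v)" for i x z y u v
  define \<psi> where "\<psi> x z w = comp_lift (\<chi> (p1 w) x z) (p2 w)" for x z w
  have I: "P.invariant x z (\<chi> pt x z)" "Q.invariant x z (\<chi> (Coll {|pt|}) x z)" if "x \<in> cobj C" "z \<in> cobj E" for x z
  proof -
    show "P.invariant x z (\<chi> pt x z)"
    proof (rule P.invariantI)
      fix \<beta> u v assume "\<beta> \<in> carr D" "u \<in> fob \<Omega> (Pair x (ccod D \<beta>))" "v \<in> fob \<Psi> (Pair (cdom D \<beta>) z)"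
      then show "\<chi> pt x z (cdom D \<beta>) (farr \<Omega> (Pair (cid C x) \<beta>) u) v =
          \<chi> pt x z (ccod D \<beta>) u (farr \<Psi> (Pair \<beta> (cid E z)) v)"
        using S.cls_slide[of u x "ccod D \<beta>" "Pair pt v" "cdom D \<beta>" z \<beta>]
        by (auto simp: \<chi>_def biset_sum_simps)
    qed
    show "Q.invariant x z (\<chi> (Coll {|pt|}) x z)"
    proof (rule Q.invariantI)
      fix \<beta> u v assume "\<beta> \<in> carr D" "u \<in> fob \<Omega> (Pair x (ccod D \<beta>))" "v \<in> fob \<Psi>' (Pair (cdom D \<beta>) z)"
      then show "\<chi> (Coll {|pt|}) x z (cdom D \<beta>) (farr \<Omega> (Pair (cid C x) \<beta>) u) v =
          \<chi> (Coll {|pt|}) x z (ccod D \<beta>) u (farr \<Psi>' (Pair \<beta> (cid E z)) v)"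
        using S.cls_slide[of u x "ccod D \<beta>" "Pair (Coll {|pt|}) v" "cdom D \<beta>" z \<beta>]
        by (auto simp: \<chi>_def biset_sum_simps)
    qed
  qed
  have lift: "comp_lift (\<chi> pt x z) (P.cls x z y u v) = \<chi> pt x z y u v"
    if "x \<in> cobj C" "z \<in> cobj E" "y \<in> cobj D" "u \<in> fob \<Omega> (Pair x y)" "v \<in> fob \<Psi> (Pair y z)" for x z y u v
    using P.lift_cls[OF that I(1)[OF that(1,2)]] .
  have lift': "comp_lift (\<chi> (Coll {|pt|}) x z) (Q.cls x z y u v) = \<chi> (Coll {|pt|}) x z y u v"
    if "x \<in> cobj C" "z \<in> cobj E" "y \<in> cobj D" "u \<in> fob \<Omega> (Pair x y)" "v \<in> fob \<Psi>' (Pair y z)" for x z y u v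
    using Q.lift_cls[OF that I(2)[OF that(1,2)]] .
  show ?thesis
  proof (rule S.comp_isoI[where \<phi> = \<phi> and \<psi> = \<psi>])
    fix x z w assume h: "x \<in> cobj C" "z \<in> cobj E" "w \<in> fob (biset_sum P.cmp Q.cmp) (Pair x z)"
    then consider c where "w = Pair pt c" "c \<in> fob P.cmp (Pair x z)"
      | c where "w = Pair (Coll {|pt|}) c" "c \<in> fob Q.cmp (Pair x z)"
      by (auto simp: biset_sum_simps)
    then show "\<exists>y\<in>cobj D. \<exists>u\<in>fob \<Omega> (Pair x y). \<exists>v\<in>fob (biset_sum \<Psi> \<Psi>') (Pair y z).
        \<psi> x z w = S.cls x z y u v \<and> \<phi> x z y u v = w"
    proof cases
      case 1
      from 1(2) obtain y u v where "c = P.cls x z y u v" "y \<in> cobj D" "u \<in> fob \<Omega> (Pair x y)" "v \<in> fob \<Psi> (Pair y z)"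
        by (rule P.compE)
      with 1 h show ?thesis
        by (intro bexI[of _ y] bexI[of _ u] bexI[of _ "Pair pt v"]) (auto simp: \<psi>_def \<phi>_def \<chi>_def lift biset_sum_simps)
    next
      case 2
      from 2(2) obtain y u v where "c = Q.cls x z y u v" "y \<in> cobj D" "u \<in> fob \<Omega> (Pair x y)" "v \<in> fob \<Psi>' (Pair y z)"
        by (rule Q.compE)
      with 2 h show ?thesis
        by (intro bexI[of _ y] bexI[of _ u] bexI[of _ "Pair (Coll {|pt|}) v"]) (auto simp: \<psi>_def \<phi>_def \<chi>_def lift' biset_sum_simps)
    qed
  qed (auto simp: biset_sum_simps \<phi>_def \<psi>_def \<chi>_def lift lift' P.cls_closed Q.cls_closed P.cls_slide Q.cls_slide P.act_cls Q.act_cls)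
qed

text \<open>An element of a double composite is a class one of whose entries is again a class. Each
  direction therefore needs two lifts, one for the inner class with the outer data fixed and one for
  the outer class.\<close>

lemma biset_comp_assoc:
  assumes cats: "finite_category C" "finite_category D" "finite_category E" "finite_category F"
    and bisets: "biset C D \<Omega>" "biset D E \<Psi>" "biset E F \<Theta>"
  shows "biset_iso C F (biset_comp C E F (biset_comp C D E \<Omega> \<Psi>) \<Theta>) (biset_comp C D F \<Omega> (biset_comp D E F \<Psi> \<Theta>))"
proof -
  interpret P: biset_pair C D E \<Omega> \<Psi>
    using assms by (intro biset_pair.intro biset_onI)
  interpret Q: biset_pair D E F \<Psi> \<Theta>
    using assms by (intro biset_pair.intro biset_onI)
  interpret L: biset_pair C E F P.cmp \<Theta>
    using assms by (intro biset_pair.intro biset_onI P.biset_comp_closed)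
  interpret R: biset_pair C D F \<Omega> Q.cmp
    using assms by (intro biset_pair.intro biset_onI Q.biset_comp_closed)
  define \<chi> where "\<chi> x w z t y u v = R.cls x w y u (Q.cls y w z v t)" for x w z t y u v
  define \<phi> where "\<phi> x w z c t = comp_lift (\<chi> x w z t) c" for x w z c t
  \<comment> \<open>A slide in the inner composite on the left is a slide in the outer composite on
    the right: the arrow of \<open>D\<close> acts on the inner class there, and by
    \<open>act_cls\<close> on its entry \<open>v\<close>.\<close>
  have I: "P.invariant x z (\<chi> x w z t)" if "x \<in> cobj C" "w \<in> cobj F" "z \<in> cobj E" "t \<in> fob \<Theta> (Pair z w)" for x w z t
  proof (rule P.invariantI)
    fix \<beta> u v assume h: "\<beta> \<in> carr D" "u \<in> fob \<Omega> (Pair x (ccod D \<beta>))" "v \<in> fob \<Psi> (Pair (cdom D \<beta>) z)"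
    have "R.cls x w (cdom D \<beta>) (farr \<Omega> (Pair (cid C x) \<beta>) u) (Q.cls (cdom D \<beta>) w z v t) =
        R.cls x w (ccod D \<beta>) u (farr Q.cmp (Pair \<beta> (cid F w)) (Q.cls (cdom D \<beta>) w z v t))"
      using h that by (intro R.cls_slide Q.cls_closed) auto
    also have "farr Q.cmp (Pair \<beta> (cid F w)) (Q.cls (cdom D \<beta>) w z v t) =
        Q.cls (ccod D \<beta>) w z (farr \<Psi> (Pair \<beta> (cid E z)) v) t"
      using h that by (simp add: Q.act_cls Q.B.act_id)
    finally show "\<chi> x w z t (cdom D \<beta>) (farr \<Omega> (Pair (cid C x) \<beta>) u) v =
        \<chi> x w z t (ccod D \<beta>) u (farr \<Psi> (Pair \<beta> (cid E z)) v)"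
      by (simp add: \<chi>_def)
  qed
  have \<phi>: "\<phi> x w z (P.cls x z y u v) t = R.cls x w y u (Q.cls y w z v t)"
    if "x \<in> cobj C" "w \<in> cobj F" "z \<in> cobj E" "y \<in> cobj D" "u \<in> fob \<Omega> (Pair x y)" "v \<in> fob \<Psi> (Pair y z)"
      "t \<in> fob \<Theta> (Pair z w)" for x w z y u v t
    unfolding \<phi>_def using P.lift_cls[OF _ _ _ _ _ I] that by (simp add: \<chi>_def)
  define \<chi>' where "\<chi>' x w y u z v t = L.cls x w z (P.cls x z y u v) t" for x w z t y u v
  define \<phi>' where "\<phi>' x w y u c = comp_lift (\<chi>' x w y u) c" for x w y u c
  \<comment> \<open>The mirror image, for arrows of \<open>E\<close>.\<close>
  have I': "Q.invariant y w (\<chi>' x w y u)" if "x \<in> cobj C" "w \<in> cobj F" "y \<in> cobj D" "u \<in> fob \<Omega> (Pair x y)" for x w y u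
  proof (rule Q.invariantI)
    fix \<beta> v t assume h: "\<beta> \<in> carr E" "v \<in> fob \<Psi> (Pair y (ccod E \<beta>))" "t \<in> fob \<Theta> (Pair (cdom E \<beta>) w)"
    have "L.cls x w (cdom E \<beta>) (farr P.cmp (Pair (cid C x) \<beta>) (P.cls x (ccod E \<beta>) y u v)) t =
        L.cls x w (ccod E \<beta>) (P.cls x (ccod E \<beta>) y u v) (farr \<Theta> (Pair \<beta> (cid F w)) t)"
      using h that by (intro L.cls_slide P.cls_closed) auto
    moreover have "farr P.cmp (Pair (cid C x) \<beta>) (P.cls x (ccod E \<beta>) y u v) =
        P.cls x (cdom E \<beta>) y u (farr \<Psi> (Pair (cid D y) \<beta>) v)"
      using h that by (simp add: P.act_cls P.A.act_id)
    ultimately show "\<chi>' x w y u (cdom E \<beta>) (farr \<Psi> (Pair (cid D y) \<beta>) v) t =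
        \<chi>' x w y u (ccod E \<beta>) v (farr \<Theta> (Pair \<beta> (cid F w)) t)"
      by (simp add: \<chi>'_def)
  qed
  have \<phi>': "\<phi>' x w y u (Q.cls y w z v t) = L.cls x w z (P.cls x z y u v) t"
    if "x \<in> cobj C" "w \<in> cobj F" "z \<in> cobj E" "y \<in> cobj D" "u \<in> fob \<Omega> (Pair x y)" "v \<in> fob \<Psi> (Pair y z)"
      "t \<in> fob \<Theta> (Pair z w)" for x w z y u v t
    unfolding \<phi>'_def using Q.lift_cls[OF _ _ _ _ _ I'] that by (simp add: \<chi>'_def)
  \<comment> \<open>The outer lift of the inverse. The entry \<open>d\<close> is itself a class, so
    it is replaced by a representative before the arrow is moved.\<close>
  have J: "R.invariant x w (\<phi>' x w)" if "x \<in> cobj C" "w \<in> cobj F" for x w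
  proof (rule R.invariantI)
    fix \<beta> u d assume h: "\<beta> \<in> carr D" "u \<in> fob \<Omega> (Pair x (ccod D \<beta>))" "d \<in> fob Q.cmp (Pair (cdom D \<beta>) w)"
    from h(3) obtain z v t where d: "d = Q.cls (cdom D \<beta>) w z v t" "z \<in> cobj E"
      "v \<in> fob \<Psi> (Pair (cdom D \<beta>) z)" "t \<in> fob \<Theta> (Pair z w)"
      by (rule Q.compE)
    have "farr \<Omega> (Pair (cid C x) \<beta>) u \<in> fob \<Omega> (Pair x (cdom D \<beta>))"
      "farr \<Psi> (Pair \<beta> (cid E z)) v \<in> fob \<Psi> (Pair (ccod D \<beta>) z)"
      using h d that by (auto intro!: P.A.act_closed P.B.act_closed)
    then show "\<phi>' x w (cdom D \<beta>) (farr \<Omega> (Pair (cid C x) \<beta>) u) d =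
        \<phi>' x w (ccod D \<beta>) u (farr Q.cmp (Pair \<beta> (cid F w)) d)"
      using h d that by (simp add: \<phi>' Q.act_cls Q.B.act_id P.cls_slide)
  qed
  have lift: "comp_lift (\<phi>' x w) (R.cls x w y u d) = \<phi>' x w y u d"
    if "x \<in> cobj C" "w \<in> cobj F" "y \<in> cobj D" "u \<in> fob \<Omega> (Pair x y)" "d \<in> fob Q.cmp (Pair y w)" for x w y u d
    using R.lift_cls[OF that J[OF that(1,2)]] .
  show ?thesis
  proof (rule L.comp_isoI[where \<phi> = \<phi> and \<psi> = "\<lambda>x w. comp_lift (\<phi>' x w)"])
    fix x w z c t assume h: "x \<in> cobj C" "w \<in> cobj F" "z \<in> cobj E" "c \<in> fob P.cmp (Pair x z)" "t \<in> fob \<Theta> (Pair z w)"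
    from h(4) obtain y u v where c: "c = P.cls x z y u v" "y \<in> cobj D" "u \<in> fob \<Omega> (Pair x y)" "v \<in> fob \<Psi> (Pair y z)"
      by (rule P.compE)
    show "\<phi> x w z c t \<in> fob R.cmp (Pair x w)"
      using h c by (simp add: \<phi> R.cls_closed Q.cls_closed)
    show "comp_lift (\<phi>' x w) (\<phi> x w z c t) = L.cls x w z c t"
      using h c by (simp add: \<phi> lift Q.cls_closed \<phi>')
  next
    fix x w \<beta> c t assume h: "x \<in> cobj C" "w \<in> cobj F" "\<beta> \<in> carr E" "c \<in> fob P.cmp (Pair x (ccod E \<beta>))"
      "t \<in> fob \<Theta> (Pair (cdom E \<beta>) w)"
    from h(4) obtain y u v where c: "c = P.cls x (ccod E \<beta>) y u v" "y \<in> cobj D" "u \<in> fob \<Omega> (Pair x y)"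
      "v \<in> fob \<Psi> (Pair y (ccod E \<beta>))"
      by (rule P.compE)
    have "farr \<Psi> (Pair (cid D y) \<beta>) v \<in> fob \<Psi> (Pair y (cdom E \<beta>))"
      "farr \<Theta> (Pair \<beta> (cid F w)) t \<in> fob \<Theta> (Pair (ccod E \<beta>) w)"
      using h c by (auto intro!: P.B.act_closed Q.B.act_closed)
    then show "\<phi> x w (cdom E \<beta>) (farr P.cmp (Pair (cid C x) \<beta>) c) t =
        \<phi> x w (ccod E \<beta>) c (farr \<Theta> (Pair \<beta> (cid F w)) t)"
      using h c by (simp add: \<phi> P.act_cls P.A.act_id Q.cls_slide)
  next
    fix f g z c t assume h: "f \<in> carr C" "g \<in> carr F" "z \<in> cobj E" "c \<in> fob P.cmp (Pair (cdom C f) z)"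
      "t \<in> fob \<Theta> (Pair z (ccod F g))"
    from h(4) obtain y u v where c: "c = P.cls (cdom C f) z y u v" "y \<in> cobj D" "u \<in> fob \<Omega> (Pair (cdom C f) y)"
      "v \<in> fob \<Psi> (Pair y z)"
      by (rule P.compE)
    have "farr \<Omega> (Pair f (cid D y)) u \<in> fob \<Omega> (Pair (ccod C f) y)"
      "farr \<Theta> (Pair (cid E z) g) t \<in> fob \<Theta> (Pair z (cdom F g))"
      using h c by (auto intro!: P.A.act_closed Q.B.act_closed)
    then show "\<phi> (ccod C f) (cdom F g) z (farr P.cmp (Pair f (cid E z)) c) (farr \<Theta> (Pair (cid E z) g) t) =
        farr R.cmp (Pair f g) (\<phi> (cdom C f) (ccod F g) z c t)"
      using h c by (simp add: \<phi> P.act_cls P.B.act_id Q.cls_closed R.act_cls Q.act_cls)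
  next
    fix x w s assume h: "x \<in> cobj C" "w \<in> cobj F" "s \<in> fob R.cmp (Pair x w)"
    from h(3) obtain y u d where s: "s = R.cls x w y u d" "y \<in> cobj D" "u \<in> fob \<Omega> (Pair x y)" "d \<in> fob Q.cmp (Pair y w)"
      by (rule R.compE)
    from s(4) obtain z v t where d: "d = Q.cls y w z v t" "z \<in> cobj E" "v \<in> fob \<Psi> (Pair y z)" "t \<in> fob \<Theta> (Pair z w)"
      by (rule Q.compE)
    show "\<exists>z\<in>cobj E. \<exists>c\<in>fob P.cmp (Pair x z). \<exists>t\<in>fob \<Theta> (Pair z w).
        comp_lift (\<phi>' x w) s = L.cls x w z c t \<and> \<phi> x w z c t = s"
      using h s d
      by (intro bexI[of _ z] bexI[of _ "P.cls x z y u v"] bexI[of _ t]) (simp_all add: lift \<phi> \<phi>' P.cls_closed)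
  qed
qed

section \<open>Products of bisets and the interchange law\<close>

lemma biset_prod_simps [simp]:
  "fob (biset_prod \<Omega> \<Psi>) (Pair (Pair x x') (Pair y y')) = elt_times (fob \<Omega> (Pair x y)) (fob \<Psi> (Pair x' y'))"
  "farr (biset_prod \<Omega> \<Psi>) (Pair (Pair f f') (Pair g g')) (Pair u u') =
    Pair (farr \<Omega> (Pair f g) u) (farr \<Psi> (Pair f' g') u')"
  by (simp_all add: biset_prod_def)

lemma biset_prod_biset:
  assumes "finite_category C" "finite_category D" "finite_category C'" "finite_category D'"
    "biset C D \<Omega>" "biset C' D' \<Psi>"
  shows "biset (prod_cat C C') (prod_cat D D') (biset_prod \<Omega> \<Psi>)"
proof -
  interpret A: biset_on C D \<Omega> using assms by (intro biset_onI)
  interpret B: biset_on C' D' \<Psi> using assms by (intro biset_onI)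
  show ?thesis
    by (rule bisetI)
      (auto elim!: elt_timesE simp: A.act_id B.act_id A.act_act B.act_act
        intro!: finite_elt_times A.finite_fob B.finite_fob A.act_closed B.act_closed)
qed

lemma biset_prod_cong:
  assumes cats: "finite_category C" "finite_category D" "finite_category C'" "finite_category D'"
    and bisets: "biset C D \<Omega>" "biset C' D' \<Psi>"
    and iso: "biset_iso C D \<Omega> \<Omega>'" "biset_iso C' D' \<Psi> \<Psi>'"
  shows "biset_iso (prod_cat C C') (prod_cat D D') (biset_prod \<Omega> \<Psi>) (biset_prod \<Omega>' \<Psi>')"
proof -
  interpret C: finite_category C by fact
  interpret D: finite_category D by fact
  interpret C': finite_category C' by fact
  interpret D': finite_category D' by fact
  obtain a a' where "iso_pair C D \<Omega> \<Omega>' a a'"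
    by (rule biset_isoE[OF cats(1,2) bisets(1) iso(1)])
  then interpret a: iso_pair C D \<Omega> \<Omega>' a a' .
  obtain b b' where "iso_pair C' D' \<Psi> \<Psi>' b b'"
    by (rule biset_isoE[OF cats(3,4) bisets(2) iso(2)])
  then interpret b: iso_pair C' D' \<Psi> \<Psi>' b b' .
  show ?thesis
    by (rule biset_iso_inverseI[where \<eta> = "\<lambda>x y u. Pair (a (p1 x) (p1 y) (p1 u)) (b (p2 x) (p2 y) (p2 u))"
      and \<theta> = "\<lambda>x y u. Pair (a' (p1 x) (p1 y) (p1 u)) (b' (p2 x) (p2 y) (p2 u))"])
      (auto elim!: elt_timesE simp: a.facts b.facts)
qed

lemma biset_prod_sum_left:
  "biset_iso (prod_cat C C') (prod_cat D D') (biset_prod (biset_sum \<Omega> \<Omega>') \<Psi>)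
    (biset_sum (biset_prod \<Omega> \<Psi>) (biset_prod \<Omega>' \<Psi>))"
  by (rule biset_iso_inverseI[where \<eta> = "\<lambda>x y u. Pair (p1 (p1 u)) (Pair (p2 (p1 u)) (p2 u))"
      and \<theta> = "\<lambda>x y u. Pair (Pair (p1 u) (p1 (p2 u))) (p2 (p2 u))"])
    (auto elim!: elt_timesE simp: biset_sum_simps)

lemma biset_prod_sum_right:
  "biset_iso (prod_cat C C') (prod_cat D D') (biset_prod \<Omega> (biset_sum \<Psi> \<Psi>'))
    (biset_sum (biset_prod \<Omega> \<Psi>) (biset_prod \<Omega> \<Psi>'))"
  by (rule biset_iso_inverseI[where \<eta> = "\<lambda>x y u. Pair (p1 (p2 u)) (Pair (p1 u) (p2 (p2 u)))"
      and \<theta> = "\<lambda>x y u. Pair (p1 (p2 u)) (Pair (p1 u) (p2 (p2 u)))"])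
    (auto elim!: elt_timesE simp: biset_sum_simps)

text \<open>A class of pairs of triples has to be compared with a pair of classes. The map out of
  the pair of classes is lifted in the second factor first, with a triple of the first factor fixed,
  and then in the first factor.\<close>

lemma biset_interchange:
  assumes cats: "finite_category C" "finite_category D" "finite_category E"
      "finite_category C'" "finite_category D'" "finite_category E'"
    and bisets: "biset C D \<Omega>" "biset D E \<Psi>" "biset C' D' \<Omega>'" "biset D' E' \<Psi>'"
  shows "biset_iso (prod_cat C C') (prod_cat E E')
    (biset_comp (prod_cat C C') (prod_cat D D') (prod_cat E E') (biset_prod \<Omega> \<Omega>') (biset_prod \<Psi> \<Psi>'))
    (biset_prod (biset_comp C D E \<Omega> \<Psi>) (biset_comp C' D' E' \<Omega>' \<Psi>'))"
proof -
  interpret P: biset_pair C D E \<Omega> \<Psi>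
    using assms by (intro biset_pair.intro biset_onI)
  interpret P': biset_pair C' D' E' \<Omega>' \<Psi>'
    using assms by (intro biset_pair.intro biset_onI)
  interpret Q: biset_pair "prod_cat C C'" "prod_cat D D'" "prod_cat E E'" "biset_prod \<Omega> \<Omega>'" "biset_prod \<Psi> \<Psi>'"
    using assms by (intro biset_pair.intro biset_onI biset_prod_biset finite_category_prod)
  define \<phi> where "\<phi> x z y u v = Pair (P.cls (p1 x) (p1 z) (p1 y) (p1 u) (p1 v)) (P'.cls (p2 x) (p2 z) (p2 y) (p2 u) (p2 v))"
    for x z y u v
  define \<chi> where "\<chi> x z y u v y' u' v' = Q.cls x z (Pair y y') (Pair u u') (Pair v v')" for x z y u v y' u' v'
  define \<psi>' where "\<psi>' x z c' y u v = comp_lift (\<chi> x z y u v) c'" for x z c' y u v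
  define \<psi> where "\<psi> x z w = comp_lift (\<psi>' x z (p2 w)) (p1 w)" for x z w
  \<comment> \<open>A slide over the product category moves both coordinates at once. With an
    identity in one coordinate it moves the other alone, which gives the two separate invariances
    \<open>I\<close> and \<open>J\<close>.\<close>
  have slide: "Q.cls (Pair x x') (Pair z z') (Pair (cdom D \<beta>) (cdom D' \<beta>')) (Pair (farr \<Omega> (Pair (cid C x) \<beta>) u) (farr \<Omega>' (Pair (cid C' x') \<beta>') u')) (Pair v v') =
      Q.cls (Pair x x') (Pair z z') (Pair (ccod D \<beta>) (ccod D' \<beta>')) (Pair u u') (Pair (farr \<Psi> (Pair \<beta> (cid E z)) v) (farr \<Psi>' (Pair \<beta>' (cid E' z')) v'))"
    if "\<beta> \<in> carr D" "\<beta>' \<in> carr D'" "u \<in> fob \<Omega> (Pair x (ccod D \<beta>))" "u' \<in> fob \<Omega>' (Pair x' (ccod D' \<beta>'))"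
      "v \<in> fob \<Psi> (Pair (cdom D \<beta>) z)" "v' \<in> fob \<Psi>' (Pair (cdom D' \<beta>') z')" for x x' z z' \<beta> \<beta>' u u' v v'
    using Q.cls_slide[of "Pair u u'" "Pair x x'" "Pair (ccod D \<beta>) (ccod D' \<beta>')" "Pair v v'"
        "Pair (cdom D \<beta>) (cdom D' \<beta>')" "Pair z z'" "Pair \<beta> \<beta>'"] that by simp
  have I: "P'.invariant x' z' (\<chi> (Pair x x') (Pair z z') y u v)"
    if "x \<in> cobj C" "x' \<in> cobj C'" "z \<in> cobj E" "z' \<in> cobj E'" "y \<in> cobj D" "u \<in> fob \<Omega> (Pair x y)"
      "v \<in> fob \<Psi> (Pair y z)" for x x' z z' y u v
    by (rule P'.invariantI)
      (use that slide[of "cid D y" _ u x _ _ v z] in \<open>simp add: \<chi>_def P.A.act_id P.B.act_id\<close>)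
  have \<psi>': "\<psi>' (Pair x x') (Pair z z') (P'.cls x' z' y' u' v') y u v = Q.cls (Pair x x') (Pair z z') (Pair y y') (Pair u u') (Pair v v')"
    if "x \<in> cobj C" "x' \<in> cobj C'" "z \<in> cobj E" "z' \<in> cobj E'" "y \<in> cobj D" "u \<in> fob \<Omega> (Pair x y)"
      "v \<in> fob \<Psi> (Pair y z)" "y' \<in> cobj D'" "u' \<in> fob \<Omega>' (Pair x' y')" "v' \<in> fob \<Psi>' (Pair y' z')" for x x' z z' y u v y' u' v'
    unfolding \<psi>'_def using P'.lift_cls[OF _ _ _ _ _ I] that by (simp add: \<chi>_def)
  have J: "P.invariant x z (\<psi>' (Pair x x') (Pair z z') (P'.cls x' z' y' u' v'))"
    if "x \<in> cobj C" "x' \<in> cobj C'" "z \<in> cobj E" "z' \<in> cobj E'" "y' \<in> cobj D'" "u' \<in> fob \<Omega>' (Pair x' y')"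
      "v' \<in> fob \<Psi>' (Pair y' z')" for x x' z z' y' u' v'
  proof (rule P.invariantI)
    fix \<beta> u v assume h: "\<beta> \<in> carr D" "u \<in> fob \<Omega> (Pair x (ccod D \<beta>))" "v \<in> fob \<Psi> (Pair (cdom D \<beta>) z)"
    have "farr \<Omega> (Pair (cid C x) \<beta>) u \<in> fob \<Omega> (Pair x (cdom D \<beta>))"
      "farr \<Psi> (Pair \<beta> (cid E z)) v \<in> fob \<Psi> (Pair (ccod D \<beta>) z)"
      using h that by (auto intro!: P.A.act_closed P.B.act_closed)
    then show "\<psi>' (Pair x x') (Pair z z') (P'.cls x' z' y' u' v') (cdom D \<beta>) (farr \<Omega> (Pair (cid C x) \<beta>) u) v =
        \<psi>' (Pair x x') (Pair z z') (P'.cls x' z' y' u' v') (ccod D \<beta>) u (farr \<Psi> (Pair \<beta> (cid E z)) v)"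
      using h that slide[of \<beta> "cid D' y'" u x u' x' v z v' z'] by (simp add: \<psi>' P'.A.act_id P'.B.act_id)
  qed
  have \<psi>: "\<psi> (Pair x x') (Pair z z') (Pair (P.cls x z y u v) (P'.cls x' z' y' u' v')) = Q.cls (Pair x x') (Pair z z') (Pair y y') (Pair u u') (Pair v v')"
    if "x \<in> cobj C" "x' \<in> cobj C'" "z \<in> cobj E" "z' \<in> cobj E'" "y \<in> cobj D" "u \<in> fob \<Omega> (Pair x y)"
      "v \<in> fob \<Psi> (Pair y z)" "y' \<in> cobj D'" "u' \<in> fob \<Omega>' (Pair x' y')" "v' \<in> fob \<Psi>' (Pair y' z')" for x x' z z' y u v y' u' v'
    unfolding \<psi>_def using P.lift_cls[OF _ _ _ _ _ J] that by (simp add: \<psi>')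
  show ?thesis
  proof (rule Q.comp_isoI[where \<phi> = \<phi> and \<psi> = \<psi>])
    fix X Z w assume "X \<in> cobj (prod_cat C C')" "Z \<in> cobj (prod_cat E E')" "w \<in> fob (biset_prod P.cmp P'.cmp) (Pair X Z)"
    then obtain x x' z z' c c' where h: "X = Pair x x'" "Z = Pair z z'" "x \<in> cobj C" "x' \<in> cobj C'" "z \<in> cobj E" "z' \<in> cobj E'"
      "w = Pair c c'" "c \<in> fob P.cmp (Pair x z)" "c' \<in> fob P'.cmp (Pair x' z')"
      by (auto elim!: elt_timesE)
    from h(8) obtain y u v where c: "c = P.cls x z y u v" "y \<in> cobj D" "u \<in> fob \<Omega> (Pair x y)" "v \<in> fob \<Psi> (Pair y z)"
      by (rule P.compE)
    from h(9) obtain y' u' v' where c': "c' = P'.cls x' z' y' u' v'" "y' \<in> cobj D'" "u' \<in> fob \<Omega>' (Pair x' y')" "v' \<in> fob \<Psi>' (Pair y' z')"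
      by (rule P'.compE)
    show "\<exists>y\<in>cobj (prod_cat D D'). \<exists>u\<in>fob (biset_prod \<Omega> \<Omega>') (Pair X y). \<exists>v\<in>fob (biset_prod \<Psi> \<Psi>') (Pair y Z).
        \<psi> X Z w = Q.cls X Z y u v \<and> \<phi> X Z y u v = w"
      using h c c'
      by (intro bexI[of _ "Pair y y'"] bexI[of _ "Pair u u'"] bexI[of _ "Pair v v'"]) (simp_all add: \<psi> \<phi>_def)
  qed (auto elim!: elt_timesE simp: \<phi>_def \<psi> P.cls_closed P'.cls_closed P.cls_slide P'.cls_slide P.act_cls P'.act_cls)
qed

section \<open>Transport of structure along isomorphisms of bisets\<close>

lemma biset_iso_eqI:
  assumes "\<And>x y. \<lbrakk>x \<in> cobj C; y \<in> cobj D\<rbrakk> \<Longrightarrow> fob \<Omega> (Pair x y) = fob \<Psi> (Pair x y)"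
    and "\<And>f g u. \<lbrakk>f \<in> carr C; g \<in> carr D; u \<in> fob \<Omega> (Pair (cdom C f) (ccod D g))\<rbrakk>
      \<Longrightarrow> farr \<Omega> (Pair f g) u = farr \<Psi> (Pair f g) u"
  shows "biset_iso C D \<Omega> \<Psi>"
  by (rule biset_iso_inverseI[where \<eta> = "\<lambda>x y u. u" and \<theta> = "\<lambda>x y u. u"]) (use assms in auto)

text \<open>Spares a direct check of the functor laws for reindexed bisets: they are isomorphic to
  composites, which are already known to be bisets.\<close>

lemma set_functor_transfer:
  assumes K: "finite_category K" and F: "set_functor K F" and "functor_iso K F G"
  shows "set_functor K G"
proof -
  interpret K: finite_category K by fact
  obtain a where a: "\<And>x. x \<in> cobj K \<Longrightarrow> bij_betw (a x) (fob F x) (fob G x)"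
    "\<And>f u. \<lbrakk>f \<in> carr K; u \<in> fob F (cdom K f)\<rbrakk> \<Longrightarrow> a (ccod K f) (farr F f u) = farr G f (a (cdom K f) u)"
    using assms(3) unfolding functor_iso_def by blast
  have im: "fob G x = a x ` fob F x" if "x \<in> cobj K" for x
    using a(1)[OF that] by (simp add: bij_betw_def)
  have fin: "finite (fob F x)" if "x \<in> cobj K" for x
    using F that unfolding set_functor_def by blast
  have clo: "farr F f u \<in> fob F (ccod K f)" if "f \<in> carr K" "u \<in> fob F (cdom K f)" for f u
    using F that unfolding set_functor_def by blast
  have idF: "farr F (cid K x) u = u" if "x \<in> cobj K" "u \<in> fob F x" for x u
    using F that unfolding set_functor_def by blast
  have cmpF: "farr F (ccomp K g f) u = farr F g (farr F f u)"
    if "f \<in> carr K" "g \<in> carr K" "ccod K f = cdom K g" "u \<in> fob F (cdom K f)" for f g u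
    using F that unfolding set_functor_def by blast
  show ?thesis
    unfolding set_functor_def
  proof (intro conjI ballI impI)
    fix x assume "x \<in> cobj K"
    then show "finite (fob G x)" using im fin by simp
  next
    fix f assume "f \<in> carr K"
    then show "farr G f \<in> fob G (cdom K f) \<rightarrow> fob G (ccod K f)"
      using clo by (auto simp: im a(2)[symmetric])
  next
    fix x u assume x: "x \<in> cobj K" and "u \<in> fob G x"
    then obtain w where w: "w \<in> fob F x" "u = a x w" using im by auto
    show "farr G (cid K x) u = u"
      using a(2)[of "cid K x" w] x w idF by simp
  next
    fix f g u assume fg: "f \<in> carr K" "g \<in> carr K" "ccod K f = cdom K g" and "u \<in> fob G (cdom K f)"
    then obtain w where w: "w \<in> fob F (cdom K f)" "u = a (cdom K f) w" using im by auto
    show "farr G (ccomp K g f) u = farr G g (farr G f u)"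
      using a(2)[of "ccomp K g f" w] a(2)[of f w] a(2)[of g "farr F f w"] fg w cmpF clo[of f w] by simp
  qed
qed

lemma biset_transfer:
  assumes "finite_category C" "finite_category D" "biset C D \<Omega>" "biset_iso C D \<Omega> \<Psi>"
  shows "biset C D \<Psi>"
  using set_functor_transfer[OF _ assms(3,4)] assms(1,2) by (simp add: finite_category_intros)

lemma biset_iso_trans:
  assumes "finite_category C" "finite_category D" "biset_iso C D \<Omega> \<Psi>" "biset_iso C D \<Psi> \<Theta>"
  shows "biset_iso C D \<Omega> \<Theta>"
  using functor_iso_trans[OF _ assms(3,4)] assms(1,2) by (simp add: finite_category_intros)

section \<open>Bisets of functors\<close>

locale functor_between = C: finite_category C + D: finite_category D
  for C :: "'u category" and D :: "'u category" and Fo :: "'u elt \<Rightarrow> 'u elt" and Fa :: "'u elt \<Rightarrow> 'u elt" +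
  assumes Fo_closed [simp]: "x \<in> cobj C \<Longrightarrow> Fo x \<in> cobj D"
    and Fa_closed [simp]: "f \<in> carr C \<Longrightarrow> Fa f \<in> carr D"
    and dom_Fa [simp]: "f \<in> carr C \<Longrightarrow> cdom D (Fa f) = Fo (cdom C f)"
    and cod_Fa [simp]: "f \<in> carr C \<Longrightarrow> ccod D (Fa f) = Fo (ccod C f)"
    and Fa_id [simp]: "x \<in> cobj C \<Longrightarrow> Fa (cid C x) = cid D (Fo x)"
    and Fa_comp [simp]: "\<lbrakk>f \<in> carr C; g \<in> carr C; ccod C f = cdom C g\<rbrakk> \<Longrightarrow> Fa (ccomp C g f) = ccomp D (Fa g) (Fa f)"

lemma functor_biset_simps [simp]:
  "fob (functor_biset D Fo Fa) (Pair y x) = {h \<in> carr D. cdom D h = Fo x \<and> ccod D h = y}"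
  "farr (functor_biset D Fo Fa) (Pair g f) h = ccomp D g (ccomp D h (Fa f))"
  by (simp_all add: functor_biset_def)

definition reindex :: "('u elt \<Rightarrow> 'u elt) \<Rightarrow> ('u elt \<Rightarrow> 'u elt) \<Rightarrow> ('u elt \<Rightarrow> 'u elt) \<Rightarrow> ('u elt \<Rightarrow> 'u elt) \<Rightarrow>
    'u setfun \<Rightarrow> 'u setfun" where
  "reindex Fo Fa Go Ga \<Omega> = \<lparr>fob = (\<lambda>p. fob \<Omega> (Pair (Fo (p1 p)) (Go (p2 p)))),
    farr = (\<lambda>a. farr \<Omega> (Pair (Fa (p1 a)) (Ga (p2 a))))\<rparr>"

lemma reindex_simps [simp]:
  "fob (reindex Fo Fa Go Ga \<Omega>) (Pair x y) = fob \<Omega> (Pair (Fo x) (Go y))"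
  "farr (reindex Fo Fa Go Ga \<Omega>) (Pair f g) = farr \<Omega> (Pair (Fa f) (Ga g))"
  by (simp_all add: reindex_def)

lemma functor_biset_biset:
  assumes "functor_between C D Fo Fa"
  shows "biset D C (functor_biset D Fo Fa)"
proof -
  interpret functor_between C D Fo Fa by fact
  show ?thesis
    by (rule bisetI) (auto simp: D.finite_arrows D.comp_assoc)
qed

lemma functor_between_id: "finite_category C \<Longrightarrow> functor_between C C (\<lambda>x. x) (\<lambda>f. f)"
  by (simp add: functor_between_def functor_between_axioms_def)

lemma functor_between_comp:
  assumes "functor_between C D Fo Fa" "functor_between D E Go Ga"
  shows "functor_between C E (\<lambda>x. Go (Fo x)) (\<lambda>f. Ga (Fa f))"
proof -
  interpret F: functor_between C D Fo Fa by fact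
  interpret G: functor_between D E Go Ga by fact
  show ?thesis by unfold_locales simp_all
qed

lemma functor_between_prod:
  assumes "functor_between C D Fo Fa" "functor_between C' D' Fo' Fa'"
  shows "functor_between (prod_cat C C') (prod_cat D D') (\<lambda>p. Pair (Fo (p1 p)) (Fo' (p2 p))) (\<lambda>p. Pair (Fa (p1 p)) (Fa' (p2 p)))"
proof -
  interpret F: functor_between C D Fo Fa by fact
  interpret G: functor_between C' D' Fo' Fa' by fact
  interpret P: finite_category "prod_cat C C'" by (intro finite_category_prod) unfold_locales
  interpret Q: finite_category "prod_cat D D'" by (intro finite_category_prod) unfold_locales
  show ?thesis by unfold_locales (auto elim!: elt_timesE)
qed

lemma functor_biset_prod:
  "biset_iso (prod_cat D D') (prod_cat C C') (biset_prod (functor_biset D Fo Fa) (functor_biset D' Fo' Fa'))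
    (functor_biset (prod_cat D D') (\<lambda>p. Pair (Fo (p1 p)) (Fo' (p2 p))) (\<lambda>p. Pair (Fa (p1 p)) (Fa' (p2 p))))"
  by (rule biset_iso_eqI) (auto elim!: elt_timesE)

lemma functor_biset_cong:
  assumes "finite_category C" "\<And>x. x \<in> cobj C \<Longrightarrow> Fo x = Fo' x" "\<And>f. f \<in> carr C \<Longrightarrow> Fa f = Fa' f"
  shows "biset_iso D C (functor_biset D Fo Fa) (functor_biset D Fo' Fa')"
  by (rule biset_iso_eqI) (auto simp: assms)

text \<open>The Yoneda lemma in its colimit form: a triple (y, u, h) with h from F x to y is
  equivalent to one whose last entry is the identity of F x, and the left entry of that normal form
  is u acted on by h.\<close>

lemma comp_functor_biset_right:
  assumes "functor_between C D Fo Fa" "finite_category E" "biset E D \<Omega>"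
  shows "biset_iso E C (biset_comp E D C \<Omega> (functor_biset D Fo Fa)) (reindex (\<lambda>z. z) (\<lambda>f. f) Fo Fa \<Omega>)"
proof -
  interpret F: functor_between C D Fo Fa by fact
  interpret P: biset_pair E D C \<Omega> "functor_biset D Fo Fa"
    using assms functor_biset_biset[OF assms(1)] F.C.finite_category_axioms F.D.finite_category_axioms
    by (intro biset_pair.intro biset_onI)
  show ?thesis
  proof (rule P.comp_isoI[where \<phi> = "\<lambda>z x y u h. farr \<Omega> (Pair (cid E z) h) u"
        and \<psi> = "\<lambda>z x w. P.cls z x (Fo x) w (cid D (Fo x))"])
    fix z x y u h assume h: "z \<in> cobj E" "x \<in> cobj C" "y \<in> cobj D" "u \<in> fob \<Omega> (Pair z y)"
      "h \<in> fob (functor_biset D Fo Fa) (Pair y x)"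
    show "farr \<Omega> (Pair (cid E z) h) u \<in> fob (reindex (\<lambda>z. z) (\<lambda>f. f) Fo Fa \<Omega>) (Pair z x)"
      using h by (auto intro!: P.A.act_closed)
    \<comment> \<open>Slide along \<open>h\<close> itself; acting on the identity of F x it gives
      \<open>h\<close> back.\<close>
    show "P.cls z x (Fo x) (farr \<Omega> (Pair (cid E z) h) u) (cid D (Fo x)) = P.cls z x y u h"
      using h P.cls_slide[of u z y "cid D (Fo x)" "Fo x" x h] by simp
  next
    fix z x w assume h: "z \<in> cobj E" "x \<in> cobj C" "w \<in> fob (reindex (\<lambda>z. z) (\<lambda>f. f) Fo Fa \<Omega>) (Pair z x)"
    then show "\<exists>y\<in>cobj D. \<exists>u\<in>fob \<Omega> (Pair z y). \<exists>v\<in>fob (functor_biset D Fo Fa) (Pair y x).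
        P.cls z x (Fo x) w (cid D (Fo x)) = P.cls z x y u v \<and> farr \<Omega> (Pair (cid E z) v) u = w"
      by (intro bexI[of _ "Fo x"] bexI[of _ w] bexI[of _ "cid D (Fo x)"]) (auto simp: P.A.act_id)
  qed (auto simp: P.A.act_act)
qed

text \<open>In general this composite is a left Kan extension along F. With an inverse G at hand, an
  arrow from F x to y corresponds to one from x to G y, and letting the latter act brings every
  triple to one whose first entry is the identity of y.\<close>

lemma comp_functor_biset_left:
  assumes "functor_between C D Fo Fa" "functor_between D C Go Ga" "finite_category E" "biset C E \<Omega>"
    and inv: "\<And>x. x \<in> cobj C \<Longrightarrow> Go (Fo x) = x" "\<And>f. f \<in> carr C \<Longrightarrow> Ga (Fa f) = f"
      "\<And>y. y \<in> cobj D \<Longrightarrow> Fo (Go y) = y" "\<And>g. g \<in> carr D \<Longrightarrow> Fa (Ga g) = g"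
  shows "biset_iso D E (biset_comp D C E (functor_biset D Fo Fa) \<Omega>) (reindex Go Ga (\<lambda>z. z) (\<lambda>f. f) \<Omega>)"
proof -
  interpret F: functor_between C D Fo Fa by fact
  interpret G: functor_between D C Go Ga by fact
  interpret P: biset_pair D C E "functor_biset D Fo Fa" \<Omega>
    using assms functor_biset_biset[OF assms(1)] F.C.finite_category_axioms F.D.finite_category_axioms
    by (intro biset_pair.intro biset_onI)
  show ?thesis
  proof (rule P.comp_isoI[where \<phi> = "\<lambda>y z x h v. farr \<Omega> (Pair (Ga h) (cid E z)) v"
        and \<psi> = "\<lambda>y z w. P.cls y z (Go y) (cid D y) w"])
    fix y z x h v assume h: "y \<in> cobj D" "z \<in> cobj E" "x \<in> cobj C"
      "h \<in> fob (functor_biset D Fo Fa) (Pair y x)" "v \<in> fob \<Omega> (Pair x z)"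
    show "farr \<Omega> (Pair (Ga h) (cid E z)) v \<in> fob (reindex Go Ga (\<lambda>z. z) (\<lambda>f. f) \<Omega>) (Pair y z)"
      using h by (auto intro!: P.B.act_closed simp: inv)
    \<comment> \<open>Slide along \<open>Ga h\<close>; since \<open>Fa (Ga h) = h\<close>, the
      identity of y turns into \<open>h\<close>.\<close>
    show "P.cls y z (Go y) (cid D y) (farr \<Omega> (Pair (Ga h) (cid E z)) v) = P.cls y z x h v"
      using h P.cls_slide[of "cid D y" y "Go y" v x z "Ga h"] by (auto simp: inv)
  next
    fix y z w assume h: "y \<in> cobj D" "z \<in> cobj E" "w \<in> fob (reindex Go Ga (\<lambda>z. z) (\<lambda>f. f) \<Omega>) (Pair y z)"
    then show "\<exists>x\<in>cobj C. \<exists>u\<in>fob (functor_biset D Fo Fa) (Pair y x). \<exists>v\<in>fob \<Omega> (Pair x z).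
        P.cls y z (Go y) (cid D y) w = P.cls y z x u v \<and> farr \<Omega> (Pair (Ga u) (cid E z)) v = w"
      by (intro bexI[of _ "Go y"] bexI[of _ "cid D y"] bexI[of _ w]) (auto simp: P.B.act_id inv)
  qed (auto simp: P.B.act_act inv)
qed

text \<open>Restricting the biset of G along F on the right gives the biset of the composite functor
  on the nose, so after the Yoneda step only an identity isomorphism remains.\<close>

lemma comp_functor_bisets:
  assumes "functor_between C D Fo Fa" "functor_between D E Go Ga"
  shows "biset_iso E C (biset_comp E D C (functor_biset E Go Ga) (functor_biset D Fo Fa))
    (functor_biset E (\<lambda>x. Go (Fo x)) (\<lambda>f. Ga (Fa f)))"
proof -
  interpret F: functor_between C D Fo Fa by fact
  interpret G: functor_between D E Go Ga by fact
  show ?thesis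
    by (rule biset_iso_trans[OF _ _ comp_functor_biset_right[OF assms(1)]])
      (use G.D.finite_category_axioms F.C.finite_category_axioms functor_biset_biset[OF assms(2)] in
        \<open>auto intro!: biset_iso_eqI\<close>)
qed

lemma comp_id_biset_right:
  assumes "finite_category C" "finite_category D" "biset C D \<Omega>"
  shows "biset_iso C D (biset_comp C D D \<Omega> (functor_biset D (\<lambda>x. x) (\<lambda>f. f))) \<Omega>"
  using biset_iso_trans[OF assms(1,2) comp_functor_biset_right[OF functor_between_id[OF assms(2)] assms(1,3)]]
  by (simp add: biset_iso_eqI)

lemma comp_id_biset_left:
  assumes "finite_category C" "finite_category D" "biset C D \<Omega>"
  shows "biset_iso C D (biset_comp C C D (functor_biset C (\<lambda>x. x) (\<lambda>f. f)) \<Omega>) \<Omega>"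
  using biset_iso_trans[OF assms(1,2) comp_functor_biset_left[OF functor_between_id[OF assms(1)] functor_between_id[OF assms(1)] assms(2,3)]]
  by (simp add: biset_iso_eqI)


section \<open>Evaluation and coevaluation\<close>

text \<open>The hom functor with both variables on the left, the contravariant one as a variable of
  \<open>op_cat C\<close>; the unit category on the right carries no information. The evaluation
  biset is the same functor with both variables on the right.\<close>

definition coev_biset :: "'u category \<Rightarrow> 'u setfun" where
  "coev_biset C = \<lparr>fob = (\<lambda>p. {h \<in> carr C. cdom C h = p2 (p1 p) \<and> ccod C h = p1 (p1 p)}),
    farr = (\<lambda>a h. ccomp C (p1 (p1 a)) (ccomp C h (p2 (p1 a))))\<rparr>"

definition ev_biset :: "'u category \<Rightarrow> 'u setfun" where
  "ev_biset C = \<lparr>fob = (\<lambda>p. {h \<in> carr C. cdom C h = p2 (p2 p) \<and> ccod C h = p1 (p2 p)}),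
    farr = (\<lambda>a h. ccomp C (p1 (p2 a)) (ccomp C h (p2 (p2 a))))\<rparr>"

lemma coev_biset_simps [simp]:
  "fob (coev_biset C) (Pair (Pair x x') e) = {h \<in> carr C. cdom C h = x' \<and> ccod C h = x}"
  "farr (coev_biset C) (Pair (Pair f f') e) h = ccomp C f (ccomp C h f')"
  by (simp_all add: coev_biset_def)

lemma ev_biset_simps [simp]:
  "fob (ev_biset C) (Pair e (Pair x' x)) = {h \<in> carr C. cdom C h = x \<and> ccod C h = x'}"
  "farr (ev_biset C) (Pair e (Pair f' f)) h = ccomp C f' (ccomp C h f)"
  by (simp_all add: ev_biset_def)

lemma coev_biset_biset:
  assumes "finite_category C"
  shows "biset (prod_cat C (op_cat C)) unit_cat (coev_biset C)"
proof -
  interpret finite_category C by fact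
  show ?thesis
    by (rule bisetI) (auto elim!: elt_timesE simp: finite_arrows comp_assoc)
qed

lemma ev_biset_biset:
  assumes "finite_category C"
  shows "biset unit_cat (prod_cat (op_cat C) C) (ev_biset C)"
proof -
  interpret finite_category C by fact
  show ?thesis
    by (rule bisetI) (auto elim!: elt_timesE simp: finite_arrows comp_assoc)
qed

abbreviation "id_biset C \<equiv> functor_biset C (\<lambda>x. x) (\<lambda>f. f)"

text \<open>The two halves of the first triangle composite, after the structure functors have been absorbed by reindexing.\<close>

definition zig_left :: "'u category \<Rightarrow> 'u setfun" where
  "zig_left C = reindex (\<lambda>x. Pair x pt) (\<lambda>f. Pair f pt) (\<lambda>x. x) (\<lambda>f. f) (biset_prod (id_biset C) (ev_biset C))"

definition zig_right :: "'u category \<Rightarrow> 'u setfun" where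
  "zig_right C = reindex (\<lambda>q. Pair (Pair (p1 q) (p1 (p2 q))) (p2 (p2 q))) (\<lambda>q. Pair (Pair (p1 q) (p1 (p2 q))) (p2 (p2 q)))
    (\<lambda>x. Pair pt x) (\<lambda>f. Pair pt f) (biset_prod (coev_biset C) (id_biset C))"

text \<open>An element over (x, y) is a chain d, b, c, a of composable arrows running from y to x,
  with d and c taken from the right factor and b and a from the left one. Composition of the chain
  is invariant under sliding, and the steps below bring each chain to the normal form w, id, id,
  id.\<close>

lemma zig_iso:
  fixes C :: "'u category"
  defines "Q \<equiv> prod_cat C (prod_cat (op_cat C) C)"
  assumes C: "finite_category C" and bisets: "biset C Q (zig_left C)" "biset Q C (zig_right C)"
  shows "biset_iso C C (biset_comp C Q C (zig_left C) (zig_right C)) (id_biset C)"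
proof -
  interpret C: finite_category C by fact
  interpret P: biset_pair C Q C "zig_left C" "zig_right C"
    using assms by (intro biset_pair.intro biset_onI) (simp_all add: finite_category_intros)
  \<comment> \<open>Slide along c and d in the outer two coordinates: everything from the right
    factor is composed into the left one.\<close>
  have move: "P.cls x y (Pair x1 (Pair x2 x3)) (Pair a b) (Pair c d) =
      P.cls x y (Pair x2 (Pair x2 y)) (Pair (ccomp C a c) (ccomp C b d)) (Pair (cid C x2) (cid C y))"
    if "x \<in> cobj C" "y \<in> cobj C" "x1 \<in> cobj C" "x2 \<in> cobj C" "x3 \<in> cobj C"
      "a \<in> carr C" "cdom C a = x1" "ccod C a = x" "b \<in> carr C" "cdom C b = x3" "ccod C b = x2"
      "c \<in> carr C" "cdom C c = x2" "ccod C c = x1" "d \<in> carr C" "cdom C d = y" "ccod C d = x3"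
    for x y x1 x2 x3 a b c d
    using P.cls_slide[of "Pair a b" x "Pair x1 (Pair x2 x3)" "Pair (cid C x2) (cid C y)" "Pair x2 (Pair x2 y)" y
        "Pair c (Pair (cid C x2) d)"] that
    by (simp add: zig_left_def zig_right_def Q_def)
  \<comment> \<open>Slide along e in the middle coordinate, a variable of \<open>op_cat C\<close>:
    the arrow leaves the evaluation entry and reappears in the coevaluation entry.\<close>
  have turn: "P.cls x y (Pair x2 (Pair x2 y)) (Pair a e) (Pair (cid C x2) (cid C y)) =
      P.cls x y (Pair x2 (Pair y y)) (Pair a (cid C y)) (Pair e (cid C y))"
    if "x \<in> cobj C" "y \<in> cobj C" "x2 \<in> cobj C" "a \<in> carr C" "cdom C a = x2" "ccod C a = x"
      "e \<in> carr C" "cdom C e = y" "ccod C e = x2" for x y x2 a e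
    using P.cls_slide[of "Pair a (cid C y)" x "Pair x2 (Pair y y)" "Pair (cid C x2) (cid C y)" "Pair x2 (Pair x2 y)" y
        "Pair (cid C x2) (Pair e (cid C y))"] that
    by (simp add: zig_left_def zig_right_def Q_def)
  show ?thesis
  proof (rule P.comp_isoI[where \<phi> = "\<lambda>x y q u v. ccomp C (ccomp C (p1 u) (p1 v)) (ccomp C (p2 u) (p2 v))"
        and \<psi> = "\<lambda>x y w. P.cls x y (Pair y (Pair y y)) (Pair w (cid C y)) (Pair (cid C y) (cid C y))"])
    fix x y q u v assume "x \<in> cobj C" "y \<in> cobj C" "q \<in> cobj Q" "u \<in> fob (zig_left C) (Pair x q)" "v \<in> fob (zig_right C) (Pair q y)"
    then obtain x1 x2 x3 a b c d where h: "q = Pair x1 (Pair x2 x3)" "u = Pair a b" "v = Pair c d"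
      "x \<in> cobj C" "y \<in> cobj C" "x1 \<in> cobj C" "x2 \<in> cobj C" "x3 \<in> cobj C"
      "a \<in> carr C" "cdom C a = x1" "ccod C a = x" "b \<in> carr C" "cdom C b = x3" "ccod C b = x2"
      "c \<in> carr C" "cdom C c = x2" "ccod C c = x1" "d \<in> carr C" "cdom C d = y" "ccod C d = x3"
      by (auto simp: Q_def zig_left_def zig_right_def elim!: elt_timesE)
    then show "P.cls x y (Pair y (Pair y y)) (Pair (ccomp C (ccomp C (p1 u) (p1 v)) (ccomp C (p2 u) (p2 v))) (cid C y))
        (Pair (cid C y) (cid C y)) = P.cls x y q u v"
      \<comment> \<open>After \<open>turn\<close> the arrow sits in the right factor again, where a
        second \<open>move\<close> composes it with \<open>a\<close>. Only identities remain beside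
        the total composite.\<close>
      using move[OF h(4-)] turn[of x y x2 "ccomp C a c" "ccomp C b d"]
        move[of x y x2 y y "ccomp C a c" "cid C y" "ccomp C b d" "cid C y"] by simp
  next
    fix x y w assume h: "x \<in> cobj C" "y \<in> cobj C" "w \<in> fob (id_biset C) (Pair x y)"
    then show "\<exists>q\<in>cobj Q. \<exists>u\<in>fob (zig_left C) (Pair x q). \<exists>v\<in>fob (zig_right C) (Pair q y).
        P.cls x y (Pair y (Pair y y)) (Pair w (cid C y)) (Pair (cid C y) (cid C y)) = P.cls x y q u v \<and>
        ccomp C (ccomp C (p1 u) (p1 v)) (ccomp C (p2 u) (p2 v)) = w"
      by (intro bexI[of _ "Pair y (Pair y y)"] bexI[of _ "Pair w (cid C y)"] bexI[of _ "Pair (cid C y) (cid C y)"])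
        (auto simp: Q_def zig_left_def zig_right_def)
  qed (auto simp: Q_def zig_left_def zig_right_def C.comp_assoc elim!: elt_timesE)
qed

definition zag_left :: "'u category \<Rightarrow> 'u setfun" where
  "zag_left C = reindex (\<lambda>x. Pair pt x) (\<lambda>f. Pair pt f) (\<lambda>x. x) (\<lambda>f. f) (biset_prod (ev_biset C) (id_biset (op_cat C)))"

definition zag_right :: "'u category \<Rightarrow> 'u setfun" where
  "zag_right C = reindex (\<lambda>q. Pair (p1 (p1 q)) (Pair (p2 (p1 q)) (p2 q))) (\<lambda>q. Pair (p1 (p1 q)) (Pair (p2 (p1 q)) (p2 q)))
    (\<lambda>x. Pair x pt) (\<lambda>f. Pair f pt) (biset_prod (id_biset (op_cat C)) (coev_biset C))"

text \<open>The same argument over \<open>op_cat C\<close>. In terms of \<open>C\<close> the chain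
  is a, c, b, d from x to y, and the identity biset of the opposite category consists of arrows in
  this direction.\<close>

lemma zag_iso:
  fixes C :: "'u category"
  defines "Q \<equiv> prod_cat (prod_cat (op_cat C) C) (op_cat C)"
  assumes C: "finite_category C" and bisets: "biset (op_cat C) Q (zag_left C)" "biset Q (op_cat C) (zag_right C)"
  shows "biset_iso (op_cat C) (op_cat C) (biset_comp (op_cat C) Q (op_cat C) (zag_left C) (zag_right C)) (id_biset (op_cat C))"
proof -
  interpret C: finite_category C by fact
  interpret P: biset_pair "op_cat C" Q "op_cat C" "zag_left C" "zag_right C"
    using assms by (intro biset_pair.intro biset_onI) (simp_all add: finite_category_intros)
  \<comment> \<open>The slide involves d and c only, both of which end up around b; the entry a
    stays where it is.\<close>
  have move: "P.cls x y (Pair (Pair x1 x2) x3) (Pair b a) (Pair d c) =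
      P.cls x y (Pair (Pair y x3) x3) (Pair (ccomp C d (ccomp C b c)) a) (Pair (cid C y) (cid C x3))"
    if "x \<in> cobj C" "y \<in> cobj C" "x1 \<in> cobj C" "x2 \<in> cobj C" "x3 \<in> cobj C"
      "a \<in> carr C" "cdom C a = x" "ccod C a = x3" "b \<in> carr C" "cdom C b = x2" "ccod C b = x1"
      "c \<in> carr C" "cdom C c = x3" "ccod C c = x2" "d \<in> carr C" "cdom C d = x1" "ccod C d = y"
    for x y x1 x2 x3 a b c d
    using P.cls_slide[of "Pair b a" x "Pair (Pair x1 x2) x3" "Pair (cid C y) (cid C x3)" "Pair (Pair y x3) x3" y
        "Pair (Pair d c) (cid C x3)"] that
    by (simp add: zag_left_def zag_right_def Q_def)
  \<comment> \<open>Again the middle coordinate, now a variable of \<open>C\<close>, carries the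
    arrow from evaluation to coevaluation.\<close>
  have turn: "P.cls x y (Pair (Pair y x3) x3) (Pair e a) (Pair (cid C y) (cid C x3)) =
      P.cls x y (Pair (Pair y y) x3) (Pair (cid C y) a) (Pair (cid C y) e)"
    if "x \<in> cobj C" "y \<in> cobj C" "x3 \<in> cobj C" "a \<in> carr C" "cdom C a = x" "ccod C a = x3"
      "e \<in> carr C" "cdom C e = x3" "ccod C e = y" for x y x3 a e
    using P.cls_slide[of "Pair (cid C y) a" x "Pair (Pair y y) x3" "Pair (cid C y) (cid C x3)" "Pair (Pair y x3) x3" y
        "Pair (Pair (cid C y) e) (cid C x3)"] that
    by (simp add: zag_left_def zag_right_def Q_def)
  \<comment> \<open>The last coordinate brings e back to the left factor, this time into the entry a
    of the identity biset.\<close>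
  have absorb: "P.cls x y (Pair (Pair y y) x3) (Pair (cid C y) a) (Pair (cid C y) e) =
      P.cls x y (Pair (Pair y y) y) (Pair (cid C y) (ccomp C e a)) (Pair (cid C y) (cid C y))"
    if "x \<in> cobj C" "y \<in> cobj C" "x3 \<in> cobj C" "a \<in> carr C" "cdom C a = x" "ccod C a = x3"
      "e \<in> carr C" "cdom C e = x3" "ccod C e = y" for x y x3 a e
    using P.cls_slide[of "Pair (cid C y) a" x "Pair (Pair y y) x3" "Pair (cid C y) (cid C y)" "Pair (Pair y y) y" y
        "Pair (Pair (cid C y) (cid C y)) e"] that
    by (simp add: zag_left_def zag_right_def Q_def)
  show ?thesis
  proof (rule P.comp_isoI[where \<phi> = "\<lambda>x y q u v. ccomp C (ccomp C (p1 v) (ccomp C (p1 u) (p2 v))) (p2 u)"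
        and \<psi> = "\<lambda>x y w. P.cls x y (Pair (Pair y y) y) (Pair (cid C y) w) (Pair (cid C y) (cid C y))"])
    fix x y q u v assume "x \<in> cobj (op_cat C)" "y \<in> cobj (op_cat C)" "q \<in> cobj Q" "u \<in> fob (zag_left C) (Pair x q)" "v \<in> fob (zag_right C) (Pair q y)"
    then obtain x1 x2 x3 a b c d where h: "q = Pair (Pair x1 x2) x3" "u = Pair b a" "v = Pair d c"
      "x \<in> cobj C" "y \<in> cobj C" "x1 \<in> cobj C" "x2 \<in> cobj C" "x3 \<in> cobj C"
      "a \<in> carr C" "cdom C a = x" "ccod C a = x3" "b \<in> carr C" "cdom C b = x2" "ccod C b = x1"
      "c \<in> carr C" "cdom C c = x3" "ccod C c = x2" "d \<in> carr C" "cdom C d = x1" "ccod C d = y"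
      by (auto simp: Q_def zag_left_def zag_right_def elim!: elt_timesE)
    then show "P.cls x y (Pair (Pair y y) y) (Pair (cid C y) (ccomp C (ccomp C (p1 v) (ccomp C (p1 u) (p2 v))) (p2 u)))
        (Pair (cid C y) (cid C y)) = P.cls x y q u v"
      using move[OF h(4-)] turn[of x y x3 a "ccomp C d (ccomp C b c)"] absorb[of x y x3 a "ccomp C d (ccomp C b c)"] by simp
  next
    fix x y w assume h: "x \<in> cobj (op_cat C)" "y \<in> cobj (op_cat C)" "w \<in> fob (id_biset (op_cat C)) (Pair x y)"
    then show "\<exists>q\<in>cobj Q. \<exists>u\<in>fob (zag_left C) (Pair x q). \<exists>v\<in>fob (zag_right C) (Pair q y).
        P.cls x y (Pair (Pair y y) y) (Pair (cid C y) w) (Pair (cid C y) (cid C y)) = P.cls x y q u v \<and>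
        ccomp C (ccomp C (p1 v) (ccomp C (p1 u) (p2 v))) (p2 u) = w"
      by (intro bexI[of _ "Pair (Pair y y) y"] bexI[of _ "Pair (cid C y) w"] bexI[of _ "Pair (cid C y) (cid C y)"])
        (auto simp: Q_def zag_left_def zag_right_def)
  qed (auto simp: Q_def zag_left_def zag_right_def C.comp_assoc elim!: elt_timesE)
qed

section \<open>The biset category is a tensor category\<close>

text \<open>Named so that structure morphisms can be composed and tensored by rewriting with
  symbols; the definitions are opened only for the final comparison on pairs.\<close>

definition prod_fun :: "('u elt \<Rightarrow> 'u elt) \<Rightarrow> ('u elt \<Rightarrow> 'u elt) \<Rightarrow> 'u elt \<Rightarrow> 'u elt" where
  "prod_fun F G p = Pair (F (p1 p)) (G (p2 p))"

definition assoc_fun :: "'u elt \<Rightarrow> 'u elt" where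
  "assoc_fun p = Pair (p1 (p1 p)) (Pair (p2 (p1 p)) (p2 p))"

definition unassoc_fun :: "'u elt \<Rightarrow> 'u elt" where
  "unassoc_fun p = Pair (Pair (p1 p) (p1 (p2 p))) (p2 (p2 p))"

definition swap_fun :: "'u elt \<Rightarrow> 'u elt" where
  "swap_fun p = Pair (p2 p) (p1 p)"

lemmas fun_defs = prod_fun_def assoc_fun_def unassoc_fun_def swap_fun_def

lemma functor_between_prod_fun:
  assumes "functor_between C D Fo Fa" "functor_between C' D' Fo' Fa'"
  shows "functor_between (prod_cat C C') (prod_cat D D') (prod_fun Fo Fo') (prod_fun Fa Fa')"
  using functor_between_prod[OF assms] by (simp add: prod_fun_def[abs_def])

lemma functor_betweenI:
  assumes "finite_category C" "finite_category D"
    "\<And>x. x \<in> cobj C \<Longrightarrow> Fo x \<in> cobj D" "\<And>f. f \<in> carr C \<Longrightarrow> Fa f \<in> carr D"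
    "\<And>f. f \<in> carr C \<Longrightarrow> cdom D (Fa f) = Fo (cdom C f)" "\<And>f. f \<in> carr C \<Longrightarrow> ccod D (Fa f) = Fo (ccod C f)"
    "\<And>x. x \<in> cobj C \<Longrightarrow> Fa (cid C x) = cid D (Fo x)"
    "\<And>f g. \<lbrakk>f \<in> carr C; g \<in> carr C; ccod C f = cdom C g\<rbrakk> \<Longrightarrow> Fa (ccomp C g f) = ccomp D (Fa g) (Fa f)"
  shows "functor_between C D Fo Fa"
  using assms by (simp add: functor_between_def functor_between_axioms_def)

lemma functor_between_assoc:
  assumes "finite_category C" "finite_category D" "finite_category E"
  shows "functor_between (prod_cat (prod_cat C D) E) (prod_cat C (prod_cat D E)) assoc_fun assoc_fun"
  by (rule functor_betweenI) (use assms in \<open>auto simp: finite_category_prod assoc_fun_def elim!: elt_timesE\<close>)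

lemma functor_between_unassoc:
  assumes "finite_category C" "finite_category D" "finite_category E"
  shows "functor_between (prod_cat C (prod_cat D E)) (prod_cat (prod_cat C D) E) unassoc_fun unassoc_fun"
  by (rule functor_betweenI) (use assms in \<open>auto simp: finite_category_prod unassoc_fun_def elim!: elt_timesE\<close>)

lemma functor_between_swap:
  assumes "finite_category C" "finite_category D"
  shows "functor_between (prod_cat C D) (prod_cat D C) swap_fun swap_fun"
  by (rule functor_betweenI) (use assms in \<open>auto simp: finite_category_prod swap_fun_def elim!: elt_timesE\<close>)

lemma functor_between_unit:
  assumes "finite_category C"
  shows "functor_between (prod_cat unit_cat C) C p2 p2" "functor_between (prod_cat C unit_cat) C p1 p1"
    "functor_between C (prod_cat unit_cat C) (Pair pt) (Pair pt)"
    "functor_between C (prod_cat C unit_cat) (\<lambda>x. Pair x pt) (\<lambda>f. Pair f pt)"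
  by (rule functor_betweenI; use assms in \<open>auto simp: finite_category_intros elim!: elt_timesE\<close>)+

locale biset_linear = cring R for R :: "('r, 'k) ring_scheme"
begin

abbreviation "M \<equiv> biset_module R"
abbreviation "cl \<equiv> biset_class R"
abbreviation "cm \<equiv> biset_mor_comp R"
abbreviation "pm \<equiv> biset_mor_prod R"

lemma biset_hom: "biset_hom R"
  by (intro biset_hom.intro) unfold_locales

lemmas M_module = biset_hom.biset_module_module[OF biset_hom]
lemmas cl_closed [simp] = biset_hom.biset_class_closed[OF biset_hom]
lemmas cl_sum = biset_hom.biset_class_sum[OF biset_hom]
lemmas M_linear_map_eqI = biset_hom.linear_map_eqI[OF biset_hom]

text \<open>Justifies the choice made in the definition of \<open>biset_mor_comp\<close>:
  composition of bisets respects isomorphisms and disjoint unions in each variable, so a bilinear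
  extension exists.\<close>

lemma comp_extension:
  assumes "finite_category C" "finite_category D" "finite_category E"
  shows "bilinear_map R (M C D) (M D E) (M C E) (cm C D E) \<and>
    (\<forall>\<Omega> \<Psi>. biset C D \<Omega> \<longrightarrow> biset D E \<Psi> \<longrightarrow> cm C D E (cl C D \<Omega>) (cl D E \<Psi>) = cl C E (biset_comp C D E \<Omega> \<Psi>))"
proof -
  have "\<exists>m. bilinear_map R (M C D) (M D E) (M C E) m \<and>
    (\<forall>\<Omega> \<Psi>. biset C D \<Omega> \<longrightarrow> biset D E \<Psi> \<longrightarrow> m (cl C D \<Omega>) (cl D E \<Psi>) = cl C E (biset_comp C D E \<Omega> \<Psi>))"
  proof (rule bilinear_extension_ex[where b = "\<lambda>\<Omega> \<Psi>. cl C E (biset_comp C D E \<Omega> \<Psi>)"])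
    show "cl C E (biset_comp C D E \<Omega> \<Psi>) = cl C E (biset_comp C D E \<Omega>' \<Psi>)"
      if "biset C D \<Omega>" "biset C D \<Omega>'" "biset_iso C D \<Omega> \<Omega>'" "biset D E \<Psi>" for \<Omega> \<Omega>' \<Psi>
      by (intro biset_class_eqI biset_comp_biset biset_comp_cong functor_iso_refl assms that)
    show "cl C E (biset_comp C D E \<Omega> \<Psi>) = cl C E (biset_comp C D E \<Omega> \<Psi>')"
      if "biset C D \<Omega>" "biset D E \<Psi>" "biset D E \<Psi>'" "biset_iso D E \<Psi> \<Psi>'" for \<Omega> \<Psi> \<Psi>'
      by (intro biset_class_eqI biset_comp_biset biset_comp_cong functor_iso_refl assms that)
    show "cl C E (biset_comp C D E (biset_sum \<Omega> \<Omega>') \<Psi>) =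
        cl C E (biset_comp C D E \<Omega> \<Psi>) \<oplus>\<^bsub>M C E\<^esub> cl C E (biset_comp C D E \<Omega>' \<Psi>)"
      if "biset C D \<Omega>" "biset C D \<Omega>'" "biset D E \<Psi>" for \<Omega> \<Omega>' \<Psi>
      \<comment> \<open>The sum of two classes is folded into the class of a disjoint union, which
        reduces the goal to an isomorphism of bisets.\<close>
      unfolding cl_sum[OF biset_comp_biset[OF assms that(1,3)] biset_comp_biset[OF assms that(2,3)], symmetric]
      by (intro biset_class_eqI biset_comp_biset biset_comp_sum_left set_functor_sum assms that)
    show "cl C E (biset_comp C D E \<Omega> (biset_sum \<Psi> \<Psi>')) =
        cl C E (biset_comp C D E \<Omega> \<Psi>) \<oplus>\<^bsub>M C E\<^esub> cl C E (biset_comp C D E \<Omega> \<Psi>')"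
      if "biset C D \<Omega>" "biset D E \<Psi>" "biset D E \<Psi>'" for \<Omega> \<Psi> \<Psi>'
      unfolding cl_sum[OF biset_comp_biset[OF assms that(1,2)] biset_comp_biset[OF assms that(1,3)], symmetric]
      by (intro biset_class_eqI biset_comp_biset biset_comp_sum_right set_functor_sum assms that)
  qed (use assms in \<open>simp_all add: is_cring M_module biset_comp_biset\<close>)
  then show ?thesis unfolding biset_mor_comp_def by (rule someI_ex)
qed

lemma prod_extension:
  assumes "finite_category C" "finite_category D" "finite_category C'" "finite_category D'"
  shows "bilinear_map R (M C D) (M C' D') (M (prod_cat C C') (prod_cat D D')) (pm C D C' D') \<and>
    (\<forall>\<Omega> \<Psi>. biset C D \<Omega> \<longrightarrow> biset C' D' \<Psi> \<longrightarrow> pm C D C' D' (cl C D \<Omega>) (cl C' D' \<Psi>) =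
      cl (prod_cat C C') (prod_cat D D') (biset_prod \<Omega> \<Psi>))"
proof -
  have "\<exists>m. bilinear_map R (M C D) (M C' D') (M (prod_cat C C') (prod_cat D D')) m \<and>
    (\<forall>\<Omega> \<Psi>. biset C D \<Omega> \<longrightarrow> biset C' D' \<Psi> \<longrightarrow> m (cl C D \<Omega>) (cl C' D' \<Psi>) =
      cl (prod_cat C C') (prod_cat D D') (biset_prod \<Omega> \<Psi>))"
  proof (rule bilinear_extension_ex[where b = "\<lambda>\<Omega> \<Psi>. cl (prod_cat C C') (prod_cat D D') (biset_prod \<Omega> \<Psi>)"])
    let ?cl = "cl (prod_cat C C') (prod_cat D D')"
    show "?cl (biset_prod \<Omega> \<Psi>) = ?cl (biset_prod \<Omega>' \<Psi>)"
      if "biset C D \<Omega>" "biset C D \<Omega>'" "biset_iso C D \<Omega> \<Omega>'" "biset C' D' \<Psi>" for \<Omega> \<Omega>' \<Psi>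
      by (intro biset_class_eqI biset_prod_biset biset_prod_cong functor_iso_refl finite_category_prod assms that)
    show "?cl (biset_prod \<Omega> \<Psi>) = ?cl (biset_prod \<Omega> \<Psi>')"
      if "biset C D \<Omega>" "biset C' D' \<Psi>" "biset C' D' \<Psi>'" "biset_iso C' D' \<Psi> \<Psi>'" for \<Omega> \<Psi> \<Psi>'
      by (intro biset_class_eqI biset_prod_biset biset_prod_cong functor_iso_refl finite_category_prod assms that)
    show "?cl (biset_prod (biset_sum \<Omega> \<Omega>') \<Psi>) =
        ?cl (biset_prod \<Omega> \<Psi>) \<oplus>\<^bsub>M (prod_cat C C') (prod_cat D D')\<^esub> ?cl (biset_prod \<Omega>' \<Psi>)"
      if "biset C D \<Omega>" "biset C D \<Omega>'" "biset C' D' \<Psi>" for \<Omega> \<Omega>' \<Psi>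
      unfolding cl_sum[OF biset_prod_biset[OF assms that(1,3)] biset_prod_biset[OF assms that(2,3)], symmetric]
      by (intro biset_class_eqI biset_prod_biset biset_prod_sum_left set_functor_sum finite_category_prod assms that)
    show "?cl (biset_prod \<Omega> (biset_sum \<Psi> \<Psi>')) =
        ?cl (biset_prod \<Omega> \<Psi>) \<oplus>\<^bsub>M (prod_cat C C') (prod_cat D D')\<^esub> ?cl (biset_prod \<Omega> \<Psi>')"
      if "biset C D \<Omega>" "biset C' D' \<Psi>" "biset C' D' \<Psi>'" for \<Omega> \<Psi> \<Psi>'
      unfolding cl_sum[OF biset_prod_biset[OF assms that(1,2)] biset_prod_biset[OF assms that(1,3)], symmetric]
      by (intro biset_class_eqI biset_prod_biset biset_prod_sum_right set_functor_sum finite_category_prod assms that)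
  qed (use assms in \<open>simp_all add: is_cring M_module biset_prod_biset\<close>)
  then show ?thesis unfolding biset_mor_prod_def by (rule someI_ex)
qed

lemma cm_bilinear:
  "\<lbrakk>finite_category C; finite_category D; finite_category E\<rbrakk> \<Longrightarrow> bilinear_map R (M C D) (M D E) (M C E) (cm C D E)"
  using comp_extension by blast

lemma cm_class:
  "\<lbrakk>finite_category C; finite_category D; finite_category E; biset C D \<Omega>; biset D E \<Psi>\<rbrakk>
    \<Longrightarrow> cm C D E (cl C D \<Omega>) (cl D E \<Psi>) = cl C E (biset_comp C D E \<Omega> \<Psi>)"
  using comp_extension by blast

lemma pm_bilinear:
  "\<lbrakk>finite_category C; finite_category D; finite_category C'; finite_category D'\<rbrakk>
    \<Longrightarrow> bilinear_map R (M C D) (M C' D') (M (prod_cat C C') (prod_cat D D')) (pm C D C' D')"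
  using prod_extension by blast

lemma pm_class:
  "\<lbrakk>finite_category C; finite_category D; finite_category C'; finite_category D'; biset C D \<Omega>; biset C' D' \<Psi>\<rbrakk>
    \<Longrightarrow> pm C D C' D' (cl C D \<Omega>) (cl C' D' \<Psi>) = cl (prod_cat C C') (prod_cat D D') (biset_prod \<Omega> \<Psi>)"
  using prod_extension by blast

lemma cm_closed [simp]:
  "\<lbrakk>finite_category C; finite_category D; finite_category E; x \<in> carrier (M C D); y \<in> carrier (M D E)\<rbrakk>
    \<Longrightarrow> cm C D E x y \<in> carrier (M C E)"
  using bilinear_map_closed[OF cm_bilinear] by blast

lemma pm_closed [simp]:
  "\<lbrakk>finite_category C; finite_category D; finite_category C'; finite_category D'; x \<in> carrier (M C D);
    y \<in> carrier (M C' D')\<rbrakk> \<Longrightarrow> pm C D C' D' x y \<in> carrier (M (prod_cat C C') (prod_cat D D'))"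
  using bilinear_map_closed[OF pm_bilinear] by blast

text \<open>These rules carry an inner linear map \<open>f\<close>, so that linearity of a nested
  expression in one of its arguments follows by applying them from the outside in.\<close>

lemma linear_cm_left:
  "\<lbrakk>linear_map R P (M C D) f; finite_category C; finite_category D; finite_category E; y \<in> carrier (M D E)\<rbrakk>
    \<Longrightarrow> linear_map R P (M C E) (\<lambda>x. cm C D E (f x) y)"
  using linear_map_comp[OF bilinear_map_left[OF cm_bilinear]] by blast

lemma linear_cm_right:
  "\<lbrakk>linear_map R P (M D E) f; finite_category C; finite_category D; finite_category E; y \<in> carrier (M C D)\<rbrakk>
    \<Longrightarrow> linear_map R P (M C E) (\<lambda>x. cm C D E y (f x))"
  using linear_map_comp[OF bilinear_map_right[OF cm_bilinear]] by blast

lemma linear_pm_left: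
  "\<lbrakk>linear_map R P (M C D) f; finite_category C; finite_category D; finite_category C'; finite_category D';
    y \<in> carrier (M C' D')\<rbrakk> \<Longrightarrow> linear_map R P (M (prod_cat C C') (prod_cat D D')) (\<lambda>x. pm C D C' D' (f x) y)"
  using linear_map_comp[OF bilinear_map_left[OF pm_bilinear]] by blast

lemma linear_pm_right:
  "\<lbrakk>linear_map R P (M C' D') f; finite_category C; finite_category D; finite_category C'; finite_category D';
    y \<in> carrier (M C D)\<rbrakk> \<Longrightarrow> linear_map R P (M (prod_cat C C') (prod_cat D D')) (\<lambda>x. pm C D C' D' y (f x))"
  using linear_map_comp[OF bilinear_map_right[OF pm_bilinear]] by blast

lemmas linear_intros = linear_map_id linear_cm_left linear_cm_right linear_pm_left linear_pm_right

text \<open>Identities in two variables. Those in three or four variables are reached by nesting,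
  with the variables already treated replaced by classes.\<close>

lemma linear_eq2:
  assumes N: "module R N" and x: "x \<in> carrier (M A B)" and y: "y \<in> carrier (M C D)"
    and f: "\<And>y. y \<in> carrier (M C D) \<Longrightarrow> linear_map R (M A B) N (\<lambda>x. f x y)"
      "\<And>x. x \<in> carrier (M A B) \<Longrightarrow> linear_map R (M C D) N (\<lambda>y. f x y)"
    and g: "\<And>y. y \<in> carrier (M C D) \<Longrightarrow> linear_map R (M A B) N (\<lambda>x. g x y)"
      "\<And>x. x \<in> carrier (M A B) \<Longrightarrow> linear_map R (M C D) N (\<lambda>y. g x y)"
    and eq: "\<And>\<Omega> \<Psi>. \<lbrakk>biset A B \<Omega>; biset C D \<Psi>\<rbrakk> \<Longrightarrow> f (cl A B \<Omega>) (cl C D \<Psi>) = g (cl A B \<Omega>) (cl C D \<Psi>)"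
  shows "f x y = g x y"
proof (rule M_linear_map_eqI[OF N f(1)[OF y] g(1)[OF y] x])
  fix \<Omega> assume O: "biset A B \<Omega>"
  then have c: "cl A B \<Omega> \<in> carrier (M A B)" by simp
  show "f (cl A B \<Omega>) y = g (cl A B \<Omega>) y"
    using M_linear_map_eqI[OF N f(2)[OF c] g(2)[OF c] y] eq[OF O] by blast
qed

lemma cm_assoc:
  assumes cats: "finite_category C" "finite_category D" "finite_category E" "finite_category F"
    and "x \<in> carrier (M C D)" "y \<in> carrier (M D E)" "z \<in> carrier (M E F)"
  shows "cm C E F (cm C D E x y) z = cm C D F x (cm D E F y z)"
proof (rule linear_eq2[OF M_module[of C F] assms(5,6)])
  fix \<Omega> \<Psi> assume b: "biset C D \<Omega>" "biset D E \<Psi>"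
  show "cm C E F (cm C D E (cl C D \<Omega>) (cl D E \<Psi>)) z = cm C D F (cl C D \<Omega>) (cm D E F (cl D E \<Psi>) z)"
  proof (rule M_linear_map_eqI[OF M_module[of C F] _ _ assms(7)])
    fix \<Theta> assume b': "biset E F \<Theta>"
    have "cl C F (biset_comp C E F (biset_comp C D E \<Omega> \<Psi>) \<Theta>) = cl C F (biset_comp C D F \<Omega> (biset_comp D E F \<Psi> \<Theta>))"
      by (intro biset_class_eqI biset_comp_biset biset_comp_assoc cats b b')
    then show "cm C E F (cm C D E (cl C D \<Omega>) (cl D E \<Psi>)) (cl E F \<Theta>) = cm C D F (cl C D \<Omega>) (cm D E F (cl D E \<Psi>) (cl E F \<Theta>))"
      using cats b b' by (simp add: cm_class biset_comp_biset)
  qed (intro linear_intros cats cm_closed cl_closed b)+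
qed (intro linear_intros cats cm_closed assms(7); assumption)+

lemma cm_id_left:
  assumes cats: "finite_category C" "finite_category D" and x: "x \<in> carrier (M C D)"
  shows "cm C C D (cl C C (id_biset C)) x = x"
proof (rule M_linear_map_eqI[OF M_module[of C D] _ linear_map_id x])
  note i = functor_biset_biset[OF functor_between_id[OF cats(1)]]
  fix \<Omega> assume b: "biset C D \<Omega>"
  have "cl C D (biset_comp C C D (id_biset C) \<Omega>) = cl C D \<Omega>"
    by (intro biset_class_eqI biset_comp_biset comp_id_biset_left cats b i)
  then show "cm C C D (cl C C (id_biset C)) (cl C D \<Omega>) = cl C D \<Omega>"
    using cats b i by (simp add: cm_class)
qed (intro linear_intros cats cl_closed functor_biset_biset functor_between_id)

lemma cm_id_right:
  assumes cats: "finite_category C" "finite_category D" and x: "x \<in> carrier (M C D)"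
  shows "cm C D D x (cl D D (id_biset D)) = x"
proof (rule M_linear_map_eqI[OF M_module[of C D] _ linear_map_id x])
  note i = functor_biset_biset[OF functor_between_id[OF cats(2)]]
  fix \<Omega> assume b: "biset C D \<Omega>"
  have "cl C D (biset_comp C D D \<Omega> (id_biset D)) = cl C D \<Omega>"
    by (intro biset_class_eqI biset_comp_biset comp_id_biset_right cats b i)
  then show "cm C D D (cl C D \<Omega>) (cl D D (id_biset D)) = cl C D \<Omega>"
    using cats b i by (simp add: cm_class)
qed (intro linear_intros cats cl_closed functor_biset_biset functor_between_id)

lemma pm_cm:
  assumes cats: "finite_category C" "finite_category D" "finite_category E"
      "finite_category C'" "finite_category D'" "finite_category E'"
    and x: "x \<in> carrier (M C D)" "y \<in> carrier (M D E)" "x' \<in> carrier (M C' D')" "y' \<in> carrier (M D' E')"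
  shows "pm C E C' E' (cm C D E x y) (cm C' D' E' x' y') =
    cm (prod_cat C C') (prod_cat D D') (prod_cat E E') (pm C D C' D' x x') (pm D E D' E' y y')"
proof (rule linear_eq2[OF M_module[of "prod_cat C C'" "prod_cat E E'"] x(1,2)])
  fix \<Omega> \<Psi> assume b: "biset C D \<Omega>" "biset D E \<Psi>"
  show "pm C E C' E' (cm C D E (cl C D \<Omega>) (cl D E \<Psi>)) (cm C' D' E' x' y') =
    cm (prod_cat C C') (prod_cat D D') (prod_cat E E') (pm C D C' D' (cl C D \<Omega>) x') (pm D E D' E' (cl D E \<Psi>) y')"
  proof (rule linear_eq2[OF M_module[of "prod_cat C C'" "prod_cat E E'"] x(3,4)])
    fix \<Omega>' \<Psi>' assume b': "biset C' D' \<Omega>'" "biset D' E' \<Psi>'"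
    have "cl (prod_cat C C') (prod_cat E E')
        (biset_comp (prod_cat C C') (prod_cat D D') (prod_cat E E') (biset_prod \<Omega> \<Omega>') (biset_prod \<Psi> \<Psi>')) =
      cl (prod_cat C C') (prod_cat E E') (biset_prod (biset_comp C D E \<Omega> \<Psi>) (biset_comp C' D' E' \<Omega>' \<Psi>'))"
      by (intro biset_class_eqI biset_comp_biset biset_prod_biset biset_interchange finite_category_prod cats b b')
    then show "pm C E C' E' (cm C D E (cl C D \<Omega>) (cl D E \<Psi>)) (cm C' D' E' (cl C' D' \<Omega>') (cl D' E' \<Psi>')) =
      cm (prod_cat C C') (prod_cat D D') (prod_cat E E') (pm C D C' D' (cl C D \<Omega>) (cl C' D' \<Omega>'))
        (pm D E D' E' (cl D E \<Psi>) (cl D' E' \<Psi>'))"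
      using cats b b' by (simp add: cm_class pm_class biset_comp_biset biset_prod_biset finite_category_prod)
  qed (intro linear_intros finite_category_prod cats cm_closed pm_closed cl_closed b; assumption)+
qed (intro linear_intros finite_category_prod cats cm_closed pm_closed x(3,4); assumption)+

section \<open>Morphisms induced by functors\<close>

abbreviation fc :: "'u category \<Rightarrow> 'u category \<Rightarrow> ('u elt \<Rightarrow> 'u elt) \<Rightarrow> ('u elt \<Rightarrow> 'u elt) \<Rightarrow> ('u, 'r) biset_mor" where
  "fc C D Fo Fa \<equiv> cl D C (functor_biset D Fo Fa)"

lemma functor_between_cats: "functor_between C D Fo Fa \<Longrightarrow> finite_category C \<and> finite_category D"
  by (simp add: functor_between_def)

text \<open>Together with \<open>fc_prod\<close> this says that functors embed compatibly with
  composition and products, so coherence conditions become equations between functors.\<close>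

lemma fc_comp:
  assumes "functor_between C D Fo Fa" "functor_between D E Go Ga"
  shows "cm E D C (fc D E Go Ga) (fc C D Fo Fa) = fc C E (Go \<circ> Fo) (Ga \<circ> Fa)"
proof -
  have cats: "finite_category C" "finite_category D" "finite_category E"
    using assms functor_between_cats by blast+
  note b = functor_biset_biset[OF assms(1)] functor_biset_biset[OF assms(2)]
  have "cm E D C (fc D E Go Ga) (fc C D Fo Fa) = cl E C (biset_comp E D C (functor_biset E Go Ga) (functor_biset D Fo Fa))"
    using cats b by (simp add: cm_class)
  also have "\<dots> = fc C E (Go \<circ> Fo) (Ga \<circ> Fa)"
    using cats b comp_functor_bisets[OF assms] by (intro biset_class_eqI biset_comp_biset) (simp_all add: o_def)
  finally show ?thesis .
qed

lemma fc_prod: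
  assumes "functor_between C D Fo Fa" "functor_between C' D' Fo' Fa'"
  shows "pm D C D' C' (fc C D Fo Fa) (fc C' D' Fo' Fa') = fc (prod_cat C C') (prod_cat D D') (prod_fun Fo Fo') (prod_fun Fa Fa')"
proof -
  have cats: "finite_category C" "finite_category D" "finite_category C'" "finite_category D'"
    using assms functor_between_cats by blast+
  note b = functor_biset_biset[OF assms(1)] functor_biset_biset[OF assms(2)]
  have "pm D C D' C' (fc C D Fo Fa) (fc C' D' Fo' Fa') =
      cl (prod_cat D D') (prod_cat C C') (biset_prod (functor_biset D Fo Fa) (functor_biset D' Fo' Fa'))"
    using cats b by (simp add: pm_class)
  also have "\<dots> = fc (prod_cat C C') (prod_cat D D') (prod_fun Fo Fo') (prod_fun Fa Fa')"
    using cats b functor_biset_prod[of D D' C C' Fo Fa Fo' Fa']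
    by (intro biset_class_eqI biset_prod_biset finite_category_prod) (simp_all add: prod_fun_def[abs_def])
  finally show ?thesis .
qed

text \<open>Agreement on the source category is all that can be expected: swapping twice, for
  instance, is the identity on pairs but not on every \<open>elt\<close>.\<close>

lemma fc_cong:
  assumes "functor_between C D Fo Fa" "\<And>x. x \<in> cobj C \<Longrightarrow> Fo x = Fo' x" "\<And>f. f \<in> carr C \<Longrightarrow> Fa f = Fa' f"
  shows "fc C D Fo Fa = fc C D Fo' Fa'"
  using functor_between_cats[OF assms(1)] assms
  by (intro biset_class_eqI functor_biset_biset functor_biset_cong) auto

lemma fc_closed: "functor_between C D Fo Fa \<Longrightarrow> fc C D Fo Fa \<in> carrier (M D C)"
  by (simp add: functor_biset_biset)

text \<open>The second conclusion, that the reindexed biset is a biset, is transported from the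
  composite and allows further morphisms to be composed.\<close>

lemma cm_fc_left:
  assumes "functor_between C D Fo Fa" "functor_between D C Go Ga" "finite_category E" "biset C E \<Omega>"
    and "\<And>x. x \<in> cobj C \<Longrightarrow> Go (Fo x) = x" "\<And>f. f \<in> carr C \<Longrightarrow> Ga (Fa f) = f"
      "\<And>y. y \<in> cobj D \<Longrightarrow> Fo (Go y) = y" "\<And>g. g \<in> carr D \<Longrightarrow> Fa (Ga g) = g"
  shows "cm D C E (fc C D Fo Fa) (cl C E \<Omega>) = cl D E (reindex Go Ga (\<lambda>z. z) (\<lambda>f. f) \<Omega>)"
    and "biset D E (reindex Go Ga (\<lambda>z. z) (\<lambda>f. f) \<Omega>)"
proof -
  have cats: "finite_category C" "finite_category D"
    using assms functor_between_cats by blast+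
  have b: "biset D E (biset_comp D C E (functor_biset D Fo Fa) \<Omega>)"
    using cats assms by (intro biset_comp_biset functor_biset_biset)
  have iso: "biset_iso D E (biset_comp D C E (functor_biset D Fo Fa) \<Omega>) (reindex Go Ga (\<lambda>z. z) (\<lambda>f. f) \<Omega>)"
    using assms by (rule comp_functor_biset_left)
  show "cm D C E (fc C D Fo Fa) (cl C E \<Omega>) = cl D E (reindex Go Ga (\<lambda>z. z) (\<lambda>f. f) \<Omega>)"
    using cats assms(3,4) b functor_biset_biset[OF assms(1)] biset_class_eqI[OF _ _ b iso]
    by (simp add: cm_class)
  show "biset D E (reindex Go Ga (\<lambda>z. z) (\<lambda>f. f) \<Omega>)"
    using biset_transfer[OF cats(2) assms(3) b iso] .
qed

lemma cm_fc_right: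
  assumes "functor_between C D Fo Fa" "finite_category E" "biset E D \<Omega>"
  shows "cm E D C (cl E D \<Omega>) (fc C D Fo Fa) = cl E C (reindex (\<lambda>z. z) (\<lambda>f. f) Fo Fa \<Omega>)"
    and "biset E C (reindex (\<lambda>z. z) (\<lambda>f. f) Fo Fa \<Omega>)"
proof -
  have cats: "finite_category C" "finite_category D"
    using assms functor_between_cats by blast+
  have b: "biset E C (biset_comp E D C \<Omega> (functor_biset D Fo Fa))"
    using cats assms by (intro biset_comp_biset functor_biset_biset)
  have iso: "biset_iso E C (biset_comp E D C \<Omega> (functor_biset D Fo Fa)) (reindex (\<lambda>z. z) (\<lambda>f. f) Fo Fa \<Omega>)"
    using assms by (rule comp_functor_biset_right)
  show "cm E D C (cl E D \<Omega>) (fc C D Fo Fa) = cl E C (reindex (\<lambda>z. z) (\<lambda>f. f) Fo Fa \<Omega>)"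
    using cats assms(2,3) b functor_biset_biset[OF assms(1)] biset_class_eqI[OF _ _ b iso]
    by (simp add: cm_class)
  show "biset E C (reindex (\<lambda>z. z) (\<lambda>f. f) Fo Fa \<Omega>)"
    using biset_transfer[OF assms(2) cats(1) b iso] .
qed

section \<open>Naturality of the structure isomorphisms\<close>

lemma assoc_natural_classes:
  assumes cats: "finite_category X" "finite_category Y" "finite_category Z"
      "finite_category X'" "finite_category Y'" "finite_category Z'"
    and fgh: "f \<in> carrier (M X' X)" "g \<in> carrier (M Y' Y)" "h \<in> carrier (M Z' Z)"
  shows "cm (prod_cat X' (prod_cat Y' Z')) (prod_cat (prod_cat X' Y') Z') (prod_cat (prod_cat X Y) Z)
      (fc (prod_cat (prod_cat X' Y') Z') (prod_cat X' (prod_cat Y' Z')) assoc_fun assoc_fun)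
      (pm (prod_cat X' Y') (prod_cat X Y) Z' Z (pm X' X Y' Y f g) h) =
    cm (prod_cat X' (prod_cat Y' Z')) (prod_cat X (prod_cat Y Z)) (prod_cat (prod_cat X Y) Z)
      (pm X' X (prod_cat Y' Z') (prod_cat Y Z) f (pm Y' Y Z' Z g h))
      (fc (prod_cat (prod_cat X Y) Z) (prod_cat X (prod_cat Y Z)) assoc_fun assoc_fun)"
    (is "?l f g h = ?r f g h")
proof -
  let ?K = "prod_cat X' (prod_cat Y' Z')" and ?J = "prod_cat (prod_cat X Y) Z"
  have classes: "?l (cl X' X \<Omega>) (cl Y' Y \<Psi>) (cl Z' Z \<Theta>) = ?r (cl X' X \<Omega>) (cl Y' Y \<Psi>) (cl Z' Z \<Theta>)"
    if b: "biset X' X \<Omega>" "biset Y' Y \<Psi>" "biset Z' Z \<Theta>" for \<Omega> \<Psi> \<Theta>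
  proof -
    note P = biset_prod_biset[OF _ _ _ _ biset_prod_biset[OF _ _ _ _ b(1,2)] b(3)]
      biset_prod_biset[OF _ _ _ _ b(1) biset_prod_biset[OF _ _ _ _ b(2,3)]]
    note F = functor_between_assoc[OF cats(4-6)] functor_between_unassoc[OF cats(4-6)]
    let ?L = "reindex unassoc_fun unassoc_fun (\<lambda>z. z) (\<lambda>f. f) (biset_prod (biset_prod \<Omega> \<Psi>) \<Theta>)"
    \<comment> \<open>The associator on the left reindexes along its inverse, and the one on the
      right along itself. Both sides become triple products of bisets that differ in bracketing
      only.\<close>
    have l: "cm ?K (prod_cat (prod_cat X' Y') Z') ?J (fc (prod_cat (prod_cat X' Y') Z') ?K assoc_fun assoc_fun)
        (cl (prod_cat (prod_cat X' Y') Z') ?J (biset_prod (biset_prod \<Omega> \<Psi>) \<Theta>)) = cl ?K ?J ?L" "biset ?K ?J ?L"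
      by (rule cm_fc_left[OF F]; use cats P in \<open>auto simp: finite_category_prod fun_defs elim!: elt_timesE\<close>)+
    have r: "cm ?K (prod_cat X (prod_cat Y Z)) ?J (cl ?K (prod_cat X (prod_cat Y Z)) (biset_prod \<Omega> (biset_prod \<Psi> \<Theta>)))
        (fc ?J (prod_cat X (prod_cat Y Z)) assoc_fun assoc_fun) =
        cl ?K ?J (reindex (\<lambda>z. z) (\<lambda>f. f) assoc_fun assoc_fun (biset_prod \<Omega> (biset_prod \<Psi> \<Theta>)))"
      by (rule cm_fc_right[OF functor_between_assoc]) (use cats P in \<open>auto simp: finite_category_prod\<close>)
    have "cl ?K ?J ?L = cl ?K ?J (reindex (\<lambda>z. z) (\<lambda>f. f) assoc_fun assoc_fun (biset_prod \<Omega> (biset_prod \<Psi> \<Theta>)))"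
    proof (rule biset_class_eqI[OF _ _ l(2)])
      show "biset_iso ?K ?J ?L (reindex (\<lambda>z. z) (\<lambda>f. f) assoc_fun assoc_fun (biset_prod \<Omega> (biset_prod \<Psi> \<Theta>)))"
        by (rule biset_iso_inverseI[where \<eta> = "\<lambda>x y. assoc_fun" and \<theta> = "\<lambda>x y. unassoc_fun"])
          (auto simp: fun_defs elim!: elt_timesE)
    qed (use cats in \<open>simp_all add: finite_category_prod\<close>)
    then show ?thesis
      using l r cats b by (simp add: pm_class biset_prod_biset finite_category_prod)
  qed
  note lin = linear_intros finite_category_prod cats pm_closed cl_closed functor_biset_biset functor_between_assoc
  show ?thesis
  proof (rule linear_eq2[OF M_module[of ?K ?J] fgh(1,2)])
    fix \<Omega> \<Psi> assume "biset X' X \<Omega>" "biset Y' Y \<Psi>"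
    then show "?l (cl X' X \<Omega>) (cl Y' Y \<Psi>) h = ?r (cl X' X \<Omega>) (cl Y' Y \<Psi>) h"
      by (intro M_linear_map_eqI[OF M_module[of ?K ?J] _ _ fgh(3), where f = "?l (cl X' X \<Omega>) (cl Y' Y \<Psi>)"
        and g = "?r (cl X' X \<Omega>) (cl Y' Y \<Psi>)"] lin classes)
  qed (intro lin fgh(3); assumption)+
qed

lemma lunit_natural_classes:
  assumes cats: "finite_category X" "finite_category Y" and f: "f \<in> carrier (M Y X)"
  shows "cm Y (prod_cat unit_cat Y) (prod_cat unit_cat X) (fc (prod_cat unit_cat Y) Y p2 p2)
      (pm unit_cat unit_cat Y X (cl unit_cat unit_cat (id_biset unit_cat)) f) =
    cm Y X (prod_cat unit_cat X) f (fc (prod_cat unit_cat X) X p2 p2)"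
proof (rule M_linear_map_eqI[OF M_module[of Y "prod_cat unit_cat X"] _ _ f])
  fix \<Omega> assume b: "biset Y X \<Omega>"
  note i = functor_biset_biset[OF functor_between_id[OF finite_category_unit]]
  note P = biset_prod_biset[OF finite_category_unit finite_category_unit cats(2,1) i b]
  let ?L = "reindex (Pair pt) (Pair pt) (\<lambda>z. z) (\<lambda>f. f) (biset_prod (id_biset unit_cat) \<Omega>)"
  let ?J = "prod_cat unit_cat X"
  have l: "cm Y (prod_cat unit_cat Y) ?J (fc (prod_cat unit_cat Y) Y p2 p2)
      (cl (prod_cat unit_cat Y) ?J (biset_prod (id_biset unit_cat) \<Omega>)) = cl Y ?J ?L" "biset Y ?J ?L"
    by (rule cm_fc_left[OF functor_between_unit(1,3)]; use cats P in \<open>auto simp: finite_category_intros elim!: elt_timesE\<close>)+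
  \<comment> \<open>The identity biset of the unit category has a single element, so the left side
    is \<Omega> paired with a point.\<close>
  have "cl Y ?J ?L = cl Y ?J (reindex (\<lambda>z. z) (\<lambda>f. f) p2 p2 \<Omega>)"
  proof (rule biset_class_eqI[OF _ _ l(2)])
    show "biset_iso Y ?J ?L (reindex (\<lambda>z. z) (\<lambda>f. f) p2 p2 \<Omega>)"
      by (rule biset_iso_inverseI[where \<eta> = "\<lambda>x y. p2" and \<theta> = "\<lambda>x y. Pair pt"]) (auto elim!: elt_timesE)
  qed (use cats in \<open>simp_all add: finite_category_intros\<close>)
  then show "cm Y (prod_cat unit_cat Y) ?J (fc (prod_cat unit_cat Y) Y p2 p2)
      (pm unit_cat unit_cat Y X (cl unit_cat unit_cat (id_biset unit_cat)) (cl Y X \<Omega>)) =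
    cm Y X ?J (cl Y X \<Omega>) (fc ?J X p2 p2)"
    using l cm_fc_right(1)[OF functor_between_unit(1)[OF cats(1)] cats(2) b]
    by (simp add: pm_class[OF finite_category_unit finite_category_unit cats(2,1) i b])
qed (use cats in \<open>auto intro!: linear_intros cl_closed functor_biset_biset functor_between_unit functor_between_id
  simp: finite_category_intros\<close>)

lemma runit_natural_classes:
  assumes cats: "finite_category X" "finite_category Y" and f: "f \<in> carrier (M Y X)"
  shows "cm Y (prod_cat Y unit_cat) (prod_cat X unit_cat) (fc (prod_cat Y unit_cat) Y p1 p1)
      (pm Y X unit_cat unit_cat f (cl unit_cat unit_cat (id_biset unit_cat))) =
    cm Y X (prod_cat X unit_cat) f (fc (prod_cat X unit_cat) X p1 p1)"
proof (rule M_linear_map_eqI[OF M_module[of Y "prod_cat X unit_cat"] _ _ f])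
  fix \<Omega> assume b: "biset Y X \<Omega>"
  note i = functor_biset_biset[OF functor_between_id[OF finite_category_unit]]
  note P = biset_prod_biset[OF cats(2,1) finite_category_unit finite_category_unit b i]
  let ?L = "reindex (\<lambda>x. Pair x pt) (\<lambda>f. Pair f pt) (\<lambda>z. z) (\<lambda>f. f) (biset_prod \<Omega> (id_biset unit_cat))"
  let ?J = "prod_cat X unit_cat"
  have l: "cm Y (prod_cat Y unit_cat) ?J (fc (prod_cat Y unit_cat) Y p1 p1)
      (cl (prod_cat Y unit_cat) ?J (biset_prod \<Omega> (id_biset unit_cat))) = cl Y ?J ?L" "biset Y ?J ?L"
    by (rule cm_fc_left[OF functor_between_unit(2,4)]; use cats P in \<open>auto simp: finite_category_intros elim!: elt_timesE\<close>)+
  have "cl Y ?J ?L = cl Y ?J (reindex (\<lambda>z. z) (\<lambda>f. f) p1 p1 \<Omega>)"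
  proof (rule biset_class_eqI[OF _ _ l(2)])
    show "biset_iso Y ?J ?L (reindex (\<lambda>z. z) (\<lambda>f. f) p1 p1 \<Omega>)"
      by (rule biset_iso_inverseI[where \<eta> = "\<lambda>x y. p1" and \<theta> = "\<lambda>x y u. Pair u pt"]) (auto elim!: elt_timesE)
  qed (use cats in \<open>simp_all add: finite_category_intros\<close>)
  then show "cm Y (prod_cat Y unit_cat) ?J (fc (prod_cat Y unit_cat) Y p1 p1)
      (pm Y X unit_cat unit_cat (cl Y X \<Omega>) (cl unit_cat unit_cat (id_biset unit_cat))) =
    cm Y X ?J (cl Y X \<Omega>) (fc ?J X p1 p1)"
    using l cm_fc_right(1)[OF functor_between_unit(2)[OF cats(1)] cats(2) b]
    by (simp add: pm_class[OF cats(2,1) finite_category_unit finite_category_unit b i])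
qed (use cats in \<open>auto intro!: linear_intros cl_closed functor_biset_biset functor_between_unit functor_between_id
  simp: finite_category_intros\<close>)

lemma braid_natural_classes:
  assumes cats: "finite_category X" "finite_category Y" "finite_category X'" "finite_category Y'"
    and fg: "f \<in> carrier (M X' X)" "g \<in> carrier (M Y' Y)"
  shows "cm (prod_cat Y' X') (prod_cat X' Y') (prod_cat X Y) (fc (prod_cat X' Y') (prod_cat Y' X') swap_fun swap_fun)
      (pm X' X Y' Y f g) =
    cm (prod_cat Y' X') (prod_cat Y X) (prod_cat X Y) (pm Y' Y X' X g f) (fc (prod_cat X Y) (prod_cat Y X) swap_fun swap_fun)"
proof (rule linear_eq2[OF M_module[of "prod_cat Y' X'" "prod_cat X Y"] fg])
  fix \<Omega> \<Psi> assume b: "biset X' X \<Omega>" "biset Y' Y \<Psi>"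
  note P = biset_prod_biset[OF cats(3,1,4,2) b(1,2)] biset_prod_biset[OF cats(4,2,3,1) b(2,1)]
  let ?L = "reindex swap_fun swap_fun (\<lambda>z. z) (\<lambda>f. f) (biset_prod \<Omega> \<Psi>)"
  let ?K = "prod_cat Y' X'" and ?J = "prod_cat X Y"
  have l: "cm ?K (prod_cat X' Y') ?J (fc (prod_cat X' Y') ?K swap_fun swap_fun)
      (cl (prod_cat X' Y') ?J (biset_prod \<Omega> \<Psi>)) = cl ?K ?J ?L" "biset ?K ?J ?L"
    by (rule cm_fc_left[OF functor_between_swap functor_between_swap];
      use cats P in \<open>auto simp: finite_category_prod fun_defs elim!: elt_timesE\<close>)+
  have r: "cm ?K (prod_cat Y X) ?J (cl ?K (prod_cat Y X) (biset_prod \<Psi> \<Omega>)) (fc ?J (prod_cat Y X) swap_fun swap_fun) =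
      cl ?K ?J (reindex (\<lambda>z. z) (\<lambda>f. f) swap_fun swap_fun (biset_prod \<Psi> \<Omega>))"
    by (rule cm_fc_right[OF functor_between_swap]) (use cats P in \<open>auto simp: finite_category_prod\<close>)
  have "cl ?K ?J ?L = cl ?K ?J (reindex (\<lambda>z. z) (\<lambda>f. f) swap_fun swap_fun (biset_prod \<Psi> \<Omega>))"
  proof (rule biset_class_eqI[OF _ _ l(2)])
    show "biset_iso ?K ?J ?L (reindex (\<lambda>z. z) (\<lambda>f. f) swap_fun swap_fun (biset_prod \<Psi> \<Omega>))"
      by (rule biset_iso_inverseI[where \<eta> = "\<lambda>x y. swap_fun" and \<theta> = "\<lambda>x y. swap_fun"])
        (auto simp: fun_defs elim!: elt_timesE)
  qed (use cats in \<open>simp_all add: finite_category_prod\<close>)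
  then show "cm ?K (prod_cat X' Y') ?J (fc (prod_cat X' Y') ?K swap_fun swap_fun) (pm X' X Y' Y (cl X' X \<Omega>) (cl Y' Y \<Psi>)) =
    cm ?K (prod_cat Y X) ?J (pm Y' Y X' X (cl Y' Y \<Psi>) (cl X' X \<Omega>)) (fc ?J (prod_cat Y X) swap_fun swap_fun)"
    using l r cats b by (simp add: pm_class)
qed (use cats in \<open>auto intro!: linear_intros simp: finite_category_prod functor_between_swap functor_biset_biset\<close>)

lemma biset_category_simps:
  "Ob (biset_category R) = Collect finite_category"
  "Hom (biset_category R) X Y = M Y X"
  "Cmp (biset_category R) X Y Z = cm Z Y X"
  "Idn (biset_category R) X = fc X X (\<lambda>x. x) (\<lambda>f. f)"
  "Ten (biset_category R) = prod_cat"
  "TenMor (biset_category R) X Y X' Y' = pm Y X Y' X'"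
  "Unt (biset_category R) = unit_cat"
  "Assoc (biset_category R) X Y Z = fc (prod_cat (prod_cat X Y) Z) (prod_cat X (prod_cat Y Z)) assoc_fun assoc_fun"
  "LUnit (biset_category R) X = fc (prod_cat unit_cat X) X p2 p2"
  "RUnit (biset_category R) X = fc (prod_cat X unit_cat) X p1 p1"
  "Braid (biset_category R) X Y = fc (prod_cat X Y) (prod_cat Y X) swap_fun swap_fun"
  by (simp_all add: biset_category_def Let_def assoc_fun_def[abs_def] swap_fun_def[abs_def])

section \<open>Invertibility of the structure morphisms and coherence\<close>

lemma fc_inverse:
  assumes F: "functor_between C D Fo Fa" and G: "functor_between D C Go Ga"
    and "\<And>x. x \<in> cobj C \<Longrightarrow> Go (Fo x) = x" "\<And>f. f \<in> carr C \<Longrightarrow> Ga (Fa f) = f"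
  shows "cm C D C (fc D C Go Ga) (fc C D Fo Fa) = fc C C (\<lambda>x. x) (\<lambda>f. f)"
proof -
  have "functor_between C C (Go \<circ> Fo) (Ga \<circ> Fa)"
    using functor_between_comp[OF F G] by (simp add: o_def)
  then show ?thesis
    using assms by (simp add: fc_comp[OF F G]) (rule fc_cong; simp)
qed

lemma fc_is_inverse:
  assumes F: "functor_between C D Fo Fa" and G: "functor_between D C Go Ga"
    and "\<And>x. x \<in> cobj C \<Longrightarrow> Go (Fo x) = x" "\<And>f. f \<in> carr C \<Longrightarrow> Ga (Fa f) = f"
      "\<And>y. y \<in> cobj D \<Longrightarrow> Fo (Go y) = y" "\<And>g. g \<in> carr D \<Longrightarrow> Fa (Ga g) = g"
  shows "is_inverse (biset_category R) C D (fc C D Fo Fa) (fc D C Go Ga)"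
  unfolding is_inverse_def biset_category_simps
  using fc_closed[OF F] fc_closed[OF G] fc_inverse[OF F G] fc_inverse[OF G F] assms by simp

lemma assoc_is_inverse:
  assumes "finite_category X" "finite_category Y" "finite_category Z"
  shows "is_inverse (biset_category R) (prod_cat (prod_cat X Y) Z) (prod_cat X (prod_cat Y Z))
    (fc (prod_cat (prod_cat X Y) Z) (prod_cat X (prod_cat Y Z)) assoc_fun assoc_fun)
    (fc (prod_cat X (prod_cat Y Z)) (prod_cat (prod_cat X Y) Z) unassoc_fun unassoc_fun)"
  by (rule fc_is_inverse[OF functor_between_assoc functor_between_unassoc])
    (use assms in \<open>auto simp: fun_defs elim!: elt_timesE\<close>)

lemma unit_is_inverse:
  assumes "finite_category X"
  shows "is_inverse (biset_category R) (prod_cat unit_cat X) X (fc (prod_cat unit_cat X) X p2 p2)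
      (fc X (prod_cat unit_cat X) (Pair pt) (Pair pt))"
    and "is_inverse (biset_category R) (prod_cat X unit_cat) X (fc (prod_cat X unit_cat) X p1 p1)
      (fc X (prod_cat X unit_cat) (\<lambda>x. Pair x pt) (\<lambda>f. Pair f pt))"
  by (rule fc_is_inverse[OF functor_between_unit(1,3)] fc_is_inverse[OF functor_between_unit(2,4)];
    use assms in \<open>auto elim!: elt_timesE\<close>)+

lemma functor_between_o:
  "\<lbrakk>functor_between C D Fo Fa; functor_between D E Go Ga\<rbrakk> \<Longrightarrow> functor_between C E (Go \<circ> Fo) (Ga \<circ> Fa)"
  using functor_between_comp by (simp add: o_def)

text \<open>Every factor comes from a functor, so each side collapses to the class of one functor,
  and the two functors rebracket a quadruple in the same way. The triangle and the hexagon are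
  treated alike.\<close>

lemma pentagon_classes:
  assumes cats: "finite_category W" "finite_category X" "finite_category Y" "finite_category Z"
  defines "T \<equiv> biset_category R :: ('u category, 'r, ('u, 'r) biset_mor) tensor_data"
  shows "Cmp T (Ten T (Ten T (Ten T W X) Y) Z) (Ten T (Ten T W X) (Ten T Y Z))
          (Ten T W (Ten T X (Ten T Y Z)))
          (Assoc T W X (Ten T Y Z)) (Assoc T (Ten T W X) Y Z) =
        Cmp T (Ten T (Ten T (Ten T W X) Y) Z) (Ten T W (Ten T (Ten T X Y) Z))
          (Ten T W (Ten T X (Ten T Y Z)))
          (TenMor T W W (Ten T (Ten T X Y) Z) (Ten T X (Ten T Y Z)) (Idn T W) (Assoc T X Y Z))
          (Cmp T (Ten T (Ten T (Ten T W X) Y) Z) (Ten T (Ten T W (Ten T X Y)) Z)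
            (Ten T W (Ten T (Ten T X Y) Z))
            (Assoc T W (Ten T X Y) Z)
            (TenMor T (Ten T (Ten T W X) Y) (Ten T W (Ten T X Y)) Z Z (Assoc T W X Y) (Idn T Z)))"
proof -
  note a1 = functor_between_assoc[OF cats(1,2) finite_category_prod[OF cats(3,4)]]
    and a2 = functor_between_assoc[OF finite_category_prod[OF cats(1,2)] cats(3,4)]
    and a3 = functor_between_assoc[OF cats(2-4)]
    and a4 = functor_between_assoc[OF cats(1) finite_category_prod[OF cats(2,3)] cats(4)]
    and a5 = functor_between_assoc[OF cats(1-3)]
    and i1 = functor_between_id[OF cats(1)] and i4 = functor_between_id[OF cats(4)]
  note p1 = functor_between_prod_fun[OF i1 a3] and p2 = functor_between_prod_fun[OF a5 i4]
  note q = functor_between_o[OF p2 a4]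
  show ?thesis
    unfolding T_def biset_category_simps
    unfolding fc_comp[OF a2 a1] fc_prod[OF i1 a3] fc_prod[OF a5 i4] fc_comp[OF p2 a4] fc_comp[OF q p1]
    by (rule fc_cong[OF functor_between_o[OF a2 a1]]) (auto simp: fun_defs elim!: elt_timesE)
qed

lemma triangle_classes:
  assumes cats: "finite_category X" "finite_category Y"
  defines "T \<equiv> biset_category R :: ('u category, 'r, ('u, 'r) biset_mor) tensor_data"
  shows "Cmp T (Ten T (Ten T X (Unt T)) Y) (Ten T X (Ten T (Unt T) Y)) (Ten T X Y)
          (TenMor T X X (Ten T (Unt T) Y) Y (Idn T X) (LUnit T Y)) (Assoc T X (Unt T) Y) =
        TenMor T (Ten T X (Unt T)) X Y Y (RUnit T X) (Idn T Y)"
proof -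
  note a = functor_between_assoc[OF cats(1) finite_category_unit cats(2)]
    and l = functor_between_unit(1)[OF cats(2)] and r = functor_between_unit(2)[OF cats(1)]
    and i1 = functor_between_id[OF cats(1)] and i2 = functor_between_id[OF cats(2)]
  note p = functor_between_prod_fun[OF i1 l]
  show ?thesis
    unfolding T_def biset_category_simps
    unfolding fc_prod[OF i1 l] fc_prod[OF r i2] fc_comp[OF a p]
    by (rule fc_cong[OF functor_between_o[OF a p]]) (auto simp: fun_defs elim!: elt_timesE)
qed

lemma hexagon_classes:
  assumes cats: "finite_category X" "finite_category Y" "finite_category Z"
  defines "T \<equiv> biset_category R :: ('u category, 'r, ('u, 'r) biset_mor) tensor_data"
  shows "Cmp T (Ten T (Ten T X Y) Z) (Ten T (Ten T Y Z) X) (Ten T Y (Ten T Z X))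
          (Assoc T Y Z X)
          (Cmp T (Ten T (Ten T X Y) Z) (Ten T X (Ten T Y Z)) (Ten T (Ten T Y Z) X)
            (Braid T X (Ten T Y Z)) (Assoc T X Y Z)) =
        Cmp T (Ten T (Ten T X Y) Z) (Ten T Y (Ten T X Z)) (Ten T Y (Ten T Z X))
          (TenMor T Y Y (Ten T X Z) (Ten T Z X) (Idn T Y) (Braid T X Z))
          (Cmp T (Ten T (Ten T X Y) Z) (Ten T (Ten T Y X) Z) (Ten T Y (Ten T X Z))
            (Assoc T Y X Z)
            (TenMor T (Ten T X Y) (Ten T Y X) Z Z (Braid T X Y) (Idn T Z)))"
proof -
  note a1 = functor_between_assoc[OF cats(2,3,1)] and a2 = functor_between_assoc[OF cats(1-3)]
    and a3 = functor_between_assoc[OF cats(2,1,3)]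
    and s1 = functor_between_swap[OF cats(1) finite_category_prod[OF cats(2,3)]]
    and s2 = functor_between_swap[OF cats(1,3)] and s3 = functor_between_swap[OF cats(1,2)]
    and i2 = functor_between_id[OF cats(2)] and i3 = functor_between_id[OF cats(3)]
  note p1 = functor_between_prod_fun[OF i2 s2] and p2 = functor_between_prod_fun[OF s3 i3]
  note q1 = functor_between_o[OF a2 s1] and q2 = functor_between_o[OF p2 a3]
  show ?thesis
    unfolding T_def biset_category_simps
    unfolding fc_comp[OF a2 s1] fc_comp[OF q1 a1] fc_prod[OF i2 s2] fc_prod[OF s3 i3] fc_comp[OF p2 a3] fc_comp[OF q2 p1]
    by (rule fc_cong[OF functor_between_o[OF q1 a1]]) (auto simp: fun_defs elim!: elt_timesE)
qed

lemma biset_tensor_category: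
  "tensor_category R (biset_category R :: ('u category, 'r, ('u, 'r) biset_mor) tensor_data)" (is "tensor_category R ?T")
proof (rule tensor_category.intro)
  fix X Y assume "X \<in> Ob ?T" "Y \<in> Ob ?T"
  then have c: "finite_category X" "finite_category Y" by (simp_all add: biset_category_simps)
  show "TenMor ?T X X Y Y (Idn ?T X) (Idn ?T Y) = Idn ?T (Ten ?T X Y)"
    unfolding biset_category_simps fc_prod[OF functor_between_id[OF c(1)] functor_between_id[OF c(2)]]
    by (rule fc_cong[OF functor_between_prod_fun[OF functor_between_id[OF c(1)] functor_between_id[OF c(2)]]])
      (auto simp: fun_defs elim!: elt_timesE)
  show "Braid ?T X Y \<in> Mor ?T (Ten ?T X Y) (Ten ?T Y X)"
    unfolding biset_category_simps by (intro fc_closed functor_between_swap c)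
  show "Cmp ?T (Ten ?T X Y) (Ten ?T Y X) (Ten ?T X Y) (Braid ?T Y X) (Braid ?T X Y) = Idn ?T (Ten ?T X Y)"
    unfolding biset_category_simps
    by (rule fc_inverse[OF functor_between_swap[OF c] functor_between_swap[OF c(2,1)]])
      (auto simp: fun_defs elim!: elt_timesE)
next
  fix X assume "X \<in> Ob ?T"
  then have c: "finite_category X" by (simp add: biset_category_simps)
  show "Idn ?T X \<in> Mor ?T X X"
    unfolding biset_category_simps by (intro fc_closed functor_between_id c)
  show "iso_mor ?T (Ten ?T (Unt ?T) X) X (LUnit ?T X)" "iso_mor ?T (Ten ?T X (Unt ?T)) X (RUnit ?T X)"
    unfolding iso_mor_def biset_category_simps using unit_is_inverse[OF c] by blast+
next
  fix X Y Z assume "X \<in> Ob ?T" "Y \<in> Ob ?T" "Z \<in> Ob ?T"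
  then show "iso_mor ?T (Ten ?T (Ten ?T X Y) Z) (Ten ?T X (Ten ?T Y Z)) (Assoc ?T X Y Z)"
    unfolding iso_mor_def biset_category_simps using assoc_is_inverse by blast
\<comment> \<open>Once the structure is unfolded, each remaining axiom is one of the lemmas above.
  Associativity is reversed because the axiom has the right-nested composite on its left.\<close>
qed (unfold biset_category_simps mem_Collect_eq,
  (rule M_module finite_category_unit finite_category_prod cm_bilinear pm_bilinear cm_id_left cm_id_right
    cm_assoc[symmetric] pm_cm lunit_natural_classes runit_natural_classes braid_natural_classes assoc_natural_classes
    triangle_classes[unfolded biset_category_simps] pentagon_classes[unfolded biset_category_simps]
    hexagon_classes[unfolded biset_category_simps]; assumption)+)

end

text \<open>The definite description in \<open>inv_mor\<close> is resolved by uniqueness of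
  inverses: h = h(fg) = (hf)g = g.\<close>

lemma (in tensor_category) inv_mor_eq:
  assumes "X \<in> Ob T" "Y \<in> Ob T" "is_inverse T X Y f g"
  shows "inv_mor T X Y f = g"
  unfolding inv_mor_def
proof (rule the_equality)
  fix h assume "is_inverse T X Y f h"
  then show "h = g"
    using assms cmp_assoc[of Y X Y X g f h] cmp_idn_left[of Y X g] cmp_idn_right[of Y X h]
    unfolding is_inverse_def by simp
qed (rule assms(3))

section \<open>The triangle identities and duality\<close>

context biset_linear
begin

text \<open>The unit inverse and the associator around the coevaluation are absorbed into
  \<open>zig_right\<close>, the right unit after the evaluation into \<open>zig_left\<close>. One
  composite over the triple product remains, and \<open>zig_iso\<close> identifies it.\<close>

lemma zigzag_classes:
  fixes X :: "'u category"
  assumes X: "finite_category X"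
  defines "T \<equiv> biset_category R :: ('u category, 'r, ('u, 'r) biset_mor) tensor_data"
  shows "zigzag T X (op_cat X) (cl (prod_cat X (op_cat X)) unit_cat (coev_biset X))
    (cl unit_cat (prod_cat (op_cat X) X) (ev_biset X)) = Idn T X"
proof -
  interpret T: tensor_category R T unfolding T_def by (rule biset_tensor_category)
  let ?O = "op_cat X"
  let ?Q = "prod_cat X (prod_cat ?O X)" and ?P = "prod_cat (prod_cat X ?O) X"
  let ?I = "unit_cat :: 'u category"
  note O = finite_category_op[OF X]
  note c = X O finite_category_unit finite_category_prod
  have id: "biset X X (id_biset X)" by (rule functor_biset_biset[OF functor_between_id[OF X]])
  have inv: "inv_mor T (prod_cat ?I X) X (fc (prod_cat ?I X) X p2 p2) = fc X (prod_cat ?I X) (Pair pt) (Pair pt)"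
    using unit_is_inverse(1)[OF X] by (intro T.inv_mor_eq) (simp_all add: T_def biset_category_simps c)
  let ?B = "biset_prod (coev_biset X) (id_biset X)" and ?A = "biset_prod (id_biset X) (ev_biset X)"
  have bB: "biset ?P (prod_cat ?I X) ?B"
    by (intro biset_prod_biset coev_biset_biset id c)
  have bA: "biset (prod_cat X ?I) ?Q ?A"
    by (intro biset_prod_biset ev_biset_biset id c)
  let ?B1 = "reindex (\<lambda>z. z) (\<lambda>f. f) (Pair pt) (Pair pt) ?B"
  let ?B2 = "reindex unassoc_fun unassoc_fun (\<lambda>z. z) (\<lambda>f. f) ?B1"
  have B1: "cm ?P (prod_cat ?I X) X (cl ?P (prod_cat ?I X) ?B) (fc X (prod_cat ?I X) (Pair pt) (Pair pt)) = cl ?P X ?B1"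
    "biset ?P X ?B1"
    by (rule cm_fc_right[OF functor_between_unit(3) _ bB]; intro c)+
  \<comment> \<open>Composing with the associator on the left reindexes along its inverse, hence
    \<open>unassoc_fun\<close>.\<close>
  have B2: "cm ?Q ?P X (fc ?P ?Q assoc_fun assoc_fun) (cl ?P X ?B1) = cl ?Q X ?B2" "biset ?Q X ?B2"
    by (rule cm_fc_left[OF functor_between_assoc functor_between_unassoc _ B1(2)];
      auto simp: c fun_defs elim!: elt_timesE)+
  have zr: "zig_right X = ?B2"
    by (simp add: zig_right_def reindex_def unassoc_fun_def[abs_def])
  have A1: "cm X (prod_cat X ?I) ?Q (fc (prod_cat X ?I) X p1 p1) (cl (prod_cat X ?I) ?Q ?A) = cl X ?Q (zig_left X)"
    "biset X ?Q (zig_left X)"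
    unfolding zig_left_def
    by (rule cm_fc_left[OF functor_between_unit(2,4) _ bA]; auto simp: c elim!: elt_timesE)+
  have "zigzag T X ?O (cl (prod_cat X ?O) ?I (coev_biset X)) (cl ?I (prod_cat ?O X) (ev_biset X)) =
    cm X (prod_cat X ?I) X (fc (prod_cat X ?I) X p1 p1) (cm (prod_cat X ?I) ?Q X (cl (prod_cat X ?I) ?Q ?A) (cl ?Q X ?B2))"
    unfolding zigzag_def Let_def
    by (simp add: T_def biset_category_simps inv[unfolded T_def]
      pm_class[OF _ _ _ _ coev_biset_biset[OF X] id] pm_class[OF _ _ _ _ id ev_biset_biset[OF X]] c B1 B2)
  also have "\<dots> = cm X ?Q X (cl X ?Q (zig_left X)) (cl ?Q X (zig_right X))"
    unfolding zr A1(1)[symmetric]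
    \<comment> \<open>Regrouping frees the unit morphism to act on the evaluation half, which is how
      \<open>zig_left\<close> arises.\<close>
    by (rule cm_assoc[symmetric]) (use bA B2 in \<open>simp_all add: c fc_closed functor_between_unit\<close>)
  also have "\<dots> = cl X X (biset_comp X ?Q X (zig_left X) (zig_right X))"
    using A1 B2 by (simp add: cm_class c zr)
  also have "\<dots> = cl X X (id_biset X)"
    by (rule biset_class_eqI[OF X X _ zig_iso[OF X]]) (use A1 B2 in \<open>simp_all add: biset_comp_biset c zr\<close>)
  finally show ?thesis by (simp add: T_def biset_category_simps)
qed

lemma zagzig_classes:
  fixes X :: "'u category"
  assumes X: "finite_category X"
  defines "T \<equiv> biset_category R :: ('u category, 'r, ('u, 'r) biset_mor) tensor_data"
  shows "zagzig T X (op_cat X) (cl (prod_cat X (op_cat X)) unit_cat (coev_biset X))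
    (cl unit_cat (prod_cat (op_cat X) X) (ev_biset X)) = Idn T (op_cat X)"
proof -
  interpret T: tensor_category R T unfolding T_def by (rule biset_tensor_category)
  let ?O = "op_cat X"
  let ?Q = "prod_cat (prod_cat ?O X) ?O" and ?P = "prod_cat ?O (prod_cat X ?O)"
  let ?I = "unit_cat :: 'u category"
  note O = finite_category_op[OF X]
  note c = X O finite_category_unit finite_category_prod
  have id: "biset ?O ?O (id_biset ?O)" by (rule functor_biset_biset[OF functor_between_id[OF O]])
  have inv: "inv_mor T (prod_cat ?O ?I) ?O (fc (prod_cat ?O ?I) ?O p1 p1) =
      fc ?O (prod_cat ?O ?I) (\<lambda>x. Pair x pt) (\<lambda>f. Pair f pt)"
    using unit_is_inverse(2)[OF O] by (intro T.inv_mor_eq) (simp_all add: T_def biset_category_simps c)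
  have inv': "inv_mor T ?Q ?P (fc ?Q ?P assoc_fun assoc_fun) = fc ?P ?Q unassoc_fun unassoc_fun"
    using assoc_is_inverse[OF O X O] by (intro T.inv_mor_eq) (simp_all add: T_def biset_category_simps c)
  let ?B = "biset_prod (id_biset ?O) (coev_biset X)" and ?A = "biset_prod (ev_biset X) (id_biset ?O)"
  have bB: "biset ?P (prod_cat ?O ?I) ?B"
    by (intro biset_prod_biset coev_biset_biset id c)
  have bA: "biset (prod_cat ?I ?O) ?Q ?A"
    by (intro biset_prod_biset ev_biset_biset id c)
  let ?B1 = "reindex (\<lambda>z. z) (\<lambda>f. f) (\<lambda>x. Pair x pt) (\<lambda>f. Pair f pt) ?B"
  let ?B2 = "reindex assoc_fun assoc_fun (\<lambda>z. z) (\<lambda>f. f) ?B1"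
  have B1: "cm ?P (prod_cat ?O ?I) ?O (cl ?P (prod_cat ?O ?I) ?B) (fc ?O (prod_cat ?O ?I) (\<lambda>x. Pair x pt) (\<lambda>f. Pair f pt)) =
      cl ?P ?O ?B1"
    "biset ?P ?O ?B1"
    by (rule cm_fc_right[OF functor_between_unit(4) _ bB]; intro c)+
  \<comment> \<open>This composite contains the inverse associator, so the reindexing is along
    \<open>assoc_fun\<close>.\<close>
  have B2: "cm ?Q ?P ?O (fc ?P ?Q unassoc_fun unassoc_fun) (cl ?P ?O ?B1) = cl ?Q ?O ?B2" "biset ?Q ?O ?B2"
    by (rule cm_fc_left[OF functor_between_unassoc functor_between_assoc _ B1(2)];
      auto simp: c fun_defs elim!: elt_timesE)+
  have zr: "zag_right X = ?B2"
    by (simp add: zag_right_def reindex_def assoc_fun_def[abs_def])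
  have A1: "cm ?O (prod_cat ?I ?O) ?Q (fc (prod_cat ?I ?O) ?O p2 p2) (cl (prod_cat ?I ?O) ?Q ?A) = cl ?O ?Q (zag_left X)"
    "biset ?O ?Q (zag_left X)"
    unfolding zag_left_def
    by (rule cm_fc_left[OF functor_between_unit(1,3) _ bA]; auto simp: c elim!: elt_timesE)+
  have "zagzig T X ?O (cl (prod_cat X ?O) ?I (coev_biset X)) (cl ?I (prod_cat ?O X) (ev_biset X)) =
    cm ?O (prod_cat ?I ?O) ?O (fc (prod_cat ?I ?O) ?O p2 p2) (cm (prod_cat ?I ?O) ?Q ?O (cl (prod_cat ?I ?O) ?Q ?A) (cl ?Q ?O ?B2))"
    unfolding zagzig_def Let_def
    by (simp add: T_def biset_category_simps inv[unfolded T_def] inv'[unfolded T_def]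
      pm_class[OF _ _ _ _ id coev_biset_biset[OF X]] pm_class[OF _ _ _ _ ev_biset_biset[OF X] id] c B1 B2)
  also have "\<dots> = cm ?O ?Q ?O (cl ?O ?Q (zag_left X)) (cl ?Q ?O (zag_right X))"
    unfolding zr A1(1)[symmetric]
    by (rule cm_assoc[symmetric]) (use bA B2 in \<open>simp_all add: c fc_closed functor_between_unit\<close>)
  also have "\<dots> = cl ?O ?O (biset_comp ?O ?Q ?O (zag_left X) (zag_right X))"
    using A1 B2 by (simp add: cm_class c zr)
  also have "\<dots> = cl ?O ?O (id_biset ?O)"
    by (rule biset_class_eqI[OF O O _ zag_iso[OF X]]) (use A1 B2 in \<open>simp_all add: biset_comp_biset c zr\<close>)
  finally show ?thesis by (simp add: T_def biset_category_simps)
qed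

lemma op_cat_is_dual:
  assumes X: "finite_category X"
  shows "is_dual (biset_category R) X (op_cat X)"
proof -
  have "cl (prod_cat X (op_cat X)) unit_cat (coev_biset X) \<in> carrier (M (prod_cat X (op_cat X)) unit_cat)"
    "cl unit_cat (prod_cat (op_cat X) X) (ev_biset X) \<in> carrier (M unit_cat (prod_cat (op_cat X) X))"
    using coev_biset_biset[OF X] ev_biset_biset[OF X] by simp_all
  then show ?thesis
    unfolding is_dual_def
    using zigzag_classes[OF X] zagzig_classes[OF X] finite_category_op[OF X]
    \<comment> \<open>Only objects, homs, tensor product and unit are unfolded;
      \<open>zigzag\<close>, \<open>zagzig\<close> and the identities stay folded to match the
      triangle lemmas.\<close>
    unfolding biset_category_simps(1,2,5,7) by blast
qed

end

theorem theorem9p2: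
  fixes R :: "('r, 'k) ring_scheme"
  assumes "cring R"
  shows "(\<forall>C :: 'u category. finite_category C \<longrightarrow> is_dual (biset_category R) C (op_cat C)) \<and>
    rigid_tensor_category R (biset_category R :: ('u category, 'r, ('u, 'r) biset_mor) tensor_data)"
proof -
  interpret biset_linear R by (rule biset_linear.intro) fact
  have dual: "is_dual (biset_category R) C (op_cat C)" if "finite_category C" for C :: "'u category"
    using that by (rule op_cat_is_dual)
  moreover have "rigid_tensor_category R (biset_category R :: ('u category, 'r, ('u, 'r) biset_mor) tensor_data)"
    by (intro rigid_tensor_category.intro biset_tensor_category rigid_tensor_category_axioms.intro)
      (use dual in \<open>auto simp: biset_category_simps\<close>)
  ultimately show ?thesis by blast
qed

end
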